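(* Let $\gamma=\{t+iy(t): t\in[a,b]\}\subset\mathbb{C}$, with $-\infty<a<b<\infty$, be the graph of a Lipschitz function $y:[a,b]\to\mathbb{R}$, and let $\varphi$ be a subharmonic function in a neighborhood of $\gamma$ in $\mathbb{C}$. Then polynomials are dense in $L^2(\gamma,\varphi)$: for every $f\in L^2(\gamma,\varphi)$ and every $\varepsilon>0$ there is a holomorphic polynomial $P$ with $\int_\gamma |f-P|^2e^{-\varphi}\,ds<\varepsilon$.
   Context: $ds$ denotes arc length on $\gamma$; for a function $h$ on $\gamma$, $\int_\gamma h\,ds=\int_a^b h(\gamma(t))|\gamma'(t)|\,dt$ with $\gamma(t)=t+iy(t)$, $|\gamma'(t)|=\sqrt{1+y'(t)^2}$ (defined a.e.). $L^2(\gamma,\varphi)$ is the space of measurable functions $f$ on $\gamma$ with $\int_\gamma |f|^2e^{-\varphi}\,ds<\infty$, with norm $\left(\int_\gamma|f|^2e^{-\varphi}ds\right)^{1/2}$. *)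

theory Defs
  imports "HOL-Analysis.Analysis" "HOL-Computational_Algebra.Polynomial"
begin

text \<open>Subharmonic function on an open set U, with values in [-infinity, infinity):
  upper semicontinuous, never +infinity, satisfying the sub-mean value inequality on every
  closed disc contained in U, and not identically -infinity on any connected component of U.
  The circle average is expressed with positive and negative parts (positive part is finite
  since the function is bounded above on the compact circle).\<close>
definition subharmonic_on :: "complex set \<Rightarrow> (complex \<Rightarrow> ereal) \<Rightarrow> bool" where
  "subharmonic_on U \<phi> \<longleftrightarrow>
     open U \<and>
     (\<forall>z\<in>U. \<phi> z \<noteq> \<infinity>) \<and>
     (\<forall>c::ereal. open {z\<in>U. \<phi> z < c}) \<and>
     (\<forall>z r. 0 < r \<longrightarrow> cball z r \<subseteq> U \<longrightarrow>
        ereal (2 * pi) * \<phi> z \<le>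
          enn2ereal (\<integral>\<^sup>+ \<theta>\<in>{0..2*pi}. e2ennreal (\<phi> (z + of_real r * cis \<theta>)) \<partial>lborel)
          - enn2ereal (\<integral>\<^sup>+ \<theta>\<in>{0..2*pi}. e2ennreal (- \<phi> (z + of_real r * cis \<theta>)) \<partial>lborel)) \<and>
     (\<forall>C\<in>components U. \<exists>z\<in>C. \<phi> z \<noteq> -\<infinity>)"

definition exp_neg :: "ereal \<Rightarrow> ennreal" where
  "exp_neg x = (case x of ereal r \<Rightarrow> ennreal (exp (- r)) | PInfty \<Rightarrow> 0 | MInfty \<Rightarrow> \<infinity>)"

definition graph_curve :: "(real \<Rightarrow> real) \<Rightarrow> real \<Rightarrow> complex" where
  "graph_curve y t = Complex t (y t)"

definition wL2sq :: "real \<Rightarrow> real \<Rightarrow> (real \<Rightarrow> real) \<Rightarrow> (complex \<Rightarrow> ereal) \<Rightarrow> (complex \<Rightarrow> complex) \<Rightarrow> ennreal" where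
  "wL2sq a b y \<phi> f =
     (\<integral>\<^sup>+ t\<in>{a..b}. ennreal ((cmod (f (graph_curve y t)))\<^sup>2) * exp_neg (\<phi> (graph_curve y t))
        * ennreal (sqrt (1 + (deriv y t)\<^sup>2)) \<partial>lborel)"

text \<open>Membership in L2(gamma, phi): measurable on gamma (equivalently, composed with the
  bi-Lipschitz parametrisation, Lebesgue measurable on [a,b]) with finite weighted norm.\<close>
definition in_wL2 :: "real \<Rightarrow> real \<Rightarrow> (real \<Rightarrow> real) \<Rightarrow> (complex \<Rightarrow> ereal) \<Rightarrow> (complex \<Rightarrow> complex) \<Rightarrow> bool" where
  "in_wL2 a b y \<phi> f \<longleftrightarrow>
     (\<lambda>t. f (graph_curve y t)) \<in> borel_measurable (lebesgue_on {a..b}) \<and> wL2sq a b y \<phi> f < \<infinity>"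

end

theory Submission
  imports Defs "HOL-Complex_Analysis.Complex_Analysis" "HOL-Probability.Distribution_Functions"
begin

text \<open>
  Write \<open>\<gamma>(t) = t + i y(t)\<close>. The arc length factor is bounded above and below, so only
  \<open>\<integral>|f(\<gamma>(t))|\<^sup>2 e\<^bsup>-\<phi>(\<gamma>(t))\<^esup> dt\<close> matters. The heart of the proof is a polynomial \<open>Q \<noteq> 0\<close> for which
  \<open>|Q|\<^sup>2 e\<^bsup>-\<phi>\<^esup>\<close> is integrable along \<open>\<gamma>\<close>; then \<open>f\<close> is approximated by \<open>Q p\<close>, where \<open>p\<close> approximates \<open>f / Q\<close>
  with respect to the finite measure \<open>|Q|\<^sup>2 e\<^bsup>-\<phi>\<^esup> dt\<close>.

  Near a point of \<open>\<gamma>\<close>, put \<open>g = C - \<phi> \<ge> 0\<close>. Instead of the Riesz measure one uses the nonnegative densities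
  \<open>v\<^sub>s = 4 (g - M\<^sub>s g) / s\<^sup>2\<close>, where \<open>M\<^sub>s\<close> is the mean over circles of radius \<open>s\<close>. Pairing \<open>v\<^sub>s\<close> with a compactly
  supported modification of the logarithm bounds the mollification of \<open>g\<close> at \<open>\<gamma>(t)\<close> by a constant plus
  \<open>\<integral> ln\<^sup>+ (R / |t - x|) d\<nu>(x)\<close>, where \<open>\<nu>\<close> is the projection of \<open>v\<^sub>s\<close> to the real axis and has bounded mass;
  here it is used that \<open>\<gamma>\<close> is a graph. Zeros placed at quantiles of \<open>\<nu>\<close> make the exponential of this potential
  integrable with uniform bounds, and Fatou's lemma gives \<open>Q\<close> in the limit.

  Polynomials are dense for every finite measure on \<open>\<gamma>\<close>: by pushing the branch points to infinity, the functions
  \<open>Ln (i (z - \<gamma>(c) - i h)) - Ln (- i (z - \<gamma>(c) + i h))\<close> are uniform limits of polynomials on \<open>\<gamma>\<close>, and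
  for \<open>h \<rightarrow> 0\<close> they converge boundedly to \<open>i \<pi> sgn (t - c)\<close>.
\<close>

section \<open>Lebesgue measure on the complex plane\<close>

text \<open>The factor \<open>Q\<close> is forced: for \<phi> = n ln |z - z0| with z0 on the curve
  and n \<ge> 1, the constant 1 is not in the space, and a polynomial belongs to it only if it
  vanishes at z0 to sufficient order. In general the mass of \<phi> may be smeared out instead of
  sitting at points. On the line the exponential of a logarithmic potential is integrable once the
  mass is below 1, so the zeros, spread according to the mass, have to absorb the rest. Two
  obstacles shape the proof. The Riesz measure may have atoms, which would spoil exact quantiles,
  whereas \<open>v s\<close> is a density whose projection has none; moreover the circle mean is its
  own transpose, so smoothness is demanded only of explicit radial functions. And the curve is a
  null set of the plane, so that what holds almost everywhere in the plane says nothing on it. Lower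
  semicontinuity of \<open>g\<close> brings the bounds for the mollifications back to every point of
  the curve, and the one-sided estimate it gives is precisely what Fatou's lemma accepts.\<close>

lemma lborel_complex_eq_pair:
  "(lborel :: complex measure) = distr (lborel \<Otimes>\<^sub>M lborel) borel (\<lambda>(x, y). Complex x y)"
proof (rule lborel_eqI)
  have [measurable]: "(\<lambda>(x, y). Complex x y) \<in> borel_measurable (borel :: (real \<times> real) measure)"
    unfolding Complex_eq by (intro borel_measurable_continuous_onI) (auto simp: case_prod_unfold intro!: continuous_intros)
  have m [measurable]: "(\<lambda>(x, y). Complex x y) \<in> borel_measurable (lborel \<Otimes>\<^sub>M (lborel :: real measure))"
    by (simp add: lborel_prod)
  fix l u :: complex
  assume *: "\<And>b. b \<in> Basis \<Longrightarrow> l \<bullet> b \<le> u \<bullet> b"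
  have le: "Re l \<le> Re u" "Im l \<le> Im u"
    using *[of 1] *[of \<i>] by (auto simp: Basis_complex_def)
  have "(\<lambda>(x, y). Complex x y) -` box l u = {Re l<..<Re u} \<times> {Im l<..<Im u}"
    by (auto simp: box_def Basis_complex_def)
  then have "emeasure (distr (lborel \<Otimes>\<^sub>M lborel) borel (\<lambda>(x, y). Complex x y)) (box l u)
     = emeasure (lborel \<Otimes>\<^sub>M lborel) ({Re l<..<Re u} \<times> {Im l<..<Im u})"
    by (subst emeasure_distr[OF m]) (auto simp: space_pair_measure)
  also have "\<dots> = ennreal (Re u - Re l) * ennreal (Im u - Im l)"
    using le by (subst lborel.emeasure_pair_measure_Times) auto
  also have "\<dots> = ennreal (\<Prod>b\<in>Basis. (u - l) \<bullet> b)"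
    using le by (simp add: Basis_complex_def ennreal_mult inner_diff_left)
  finally show "emeasure (distr (lborel \<Otimes>\<^sub>M lborel) borel (\<lambda>(x, y). Complex x y)) (box l u)
      = ennreal (\<Prod>b\<in>Basis. (u - l) \<bullet> b)" .
qed simp

lemma measurable_Complex [measurable (raw)]:
  assumes "f \<in> borel_measurable M" "g \<in> borel_measurable M"
  shows "(\<lambda>x. Complex (f x) (g x)) \<in> borel_measurable M"
  unfolding Complex_eq using assms by measurable

lemma nn_integral_complex_iterated:
  assumes [measurable]: "f \<in> borel_measurable borel"
  shows "(\<integral>\<^sup>+z. f z \<partial>lborel) = (\<integral>\<^sup>+x. \<integral>\<^sup>+y. f (Complex x y) \<partial>lborel \<partial>lborel)"
    and "(\<integral>\<^sup>+z. f z \<partial>lborel) = (\<integral>\<^sup>+y. \<integral>\<^sup>+x. f (Complex x y) \<partial>lborel \<partial>lborel)"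
proof -
  have "(\<integral>\<^sup>+z. f z \<partial>lborel) = (\<integral>\<^sup>+p. f (Complex (fst p) (snd p)) \<partial>(lborel \<Otimes>\<^sub>M lborel))"
    by (subst lborel_complex_eq_pair, subst nn_integral_distr) (auto simp: case_prod_unfold)
  moreover have "\<dots> = (\<integral>\<^sup>+x. \<integral>\<^sup>+y. f (Complex x y) \<partial>lborel \<partial>lborel)"
    by (subst lborel.nn_integral_fst[symmetric]) auto
  moreover have "\<dots> = (\<integral>\<^sup>+y. \<integral>\<^sup>+x. f (Complex x y) \<partial>lborel \<partial>lborel)"
    by (rule lborel_pair.Fubini') auto
  ultimately show "(\<integral>\<^sup>+z. f z \<partial>lborel) = (\<integral>\<^sup>+x. \<integral>\<^sup>+y. f (Complex x y) \<partial>lborel \<partial>lborel)"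
    "(\<integral>\<^sup>+z. f z \<partial>lborel) = (\<integral>\<^sup>+y. \<integral>\<^sup>+x. f (Complex x y) \<partial>lborel \<partial>lborel)" by simp_all
qed

lemma nn_integral_real_shift:
  fixes f :: "real \<Rightarrow> ennreal"
  assumes "f \<in> borel_measurable borel"
  shows "(\<integral>\<^sup>+x. f (x + t) \<partial>lborel) = (\<integral>\<^sup>+x. f x \<partial>lborel)"
  using nn_integral_real_affine[OF assms, of 1 t] by (simp add: add.commute)

text \<open>By Fubini a shear only translates each horizontal or vertical line, so translation
  invariance in one variable suffices.\<close>

lemma nn_integral_complex_shear:
  assumes [measurable]: "f \<in> borel_measurable borel"
  shows "(\<integral>\<^sup>+z. f (Complex (Re z + k * Im z) (Im z)) \<partial>lborel) = (\<integral>\<^sup>+z. f z \<partial>lborel)"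
    and "(\<integral>\<^sup>+z. f (Complex (Re z) (Im z + k * Re z)) \<partial>lborel) = (\<integral>\<^sup>+z. f z \<partial>lborel)"
   apply (subst (1 2) nn_integral_complex_iterated(2), measurable)
   apply (simp, subst nn_integral_real_shift, simp_all)
  apply (subst (1 2) nn_integral_complex_iterated(1), measurable)
  apply (simp, subst nn_integral_real_shift, simp_all)
  done

text \<open>A rotation other than the half turn is a product of three shears.\<close>
lemma nn_integral_complex_rotate:
  assumes [measurable]: "f \<in> borel_measurable borel" and c: "cmod c = 1" "c \<noteq> -1"
  shows "(\<integral>\<^sup>+z. f (c * z) \<partial>lborel) = (\<integral>\<^sup>+z. f z \<partial>lborel)"
proof -
  have nz: "1 + Re c \<noteq> 0"
  proof
    assume "1 + Re c = 0"
    then have "Re c = -1" by simp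
    moreover have "(Re c)\<^sup>2 + (Im c)\<^sup>2 = 1" using c(1) by (metis cmod_power2 one_power2)
    ultimately show False using c(2) by (auto simp: complex_eq_iff)
  qed
  have sq: "(Im c)\<^sup>2 = (1 - Re c) * (1 + Re c)" 
    using c(1) cmod_power2[of c] by (simp add: power2_eq_square algebra_simps)
  \<comment> \<open>For \<open>c = cis \<theta>\<close> this is - tan (\<theta> / 2), the
    coefficient of the two outer shears; the middle one has sin \<theta>. The half turn is excluded
    because the tangent is infinite there.\<close>
  define k where "k = - (Im c / (1 + Re c))"
  have k1: "k * Im c = Re c - 1"
    unfolding k_def using nz sq by (simp add: field_simps power2_eq_square)
  have k2: "k * (1 + Re c) = - Im c" unfolding k_def using nz by simp
  define s1 where "s1 = (\<lambda>z. Complex (Re z + k * Im z) (Im z))"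
  define s2 where "s2 = (\<lambda>z. Complex (Re z) (Im z + Im c * Re z))"
  have [measurable]: "s1 \<in> borel_measurable borel" "s2 \<in> borel_measurable borel"
    unfolding s1_def s2_def by measurable
  have eq: "c * z = s1 (s2 (s1 z))" for z
  proof -
    have a: "Re z + k * Im z + k * (Im z + Im c * (Re z + k * Im z))
        = Re z + 2 * k * Im z + (k * Im c) * Re z + (k * Im c) * k * Im z"
      by (simp add: algebra_simps)
    have b: "\<dots> = Re c * Re z + (k * (1 + Re c)) * Im z"
      unfolding k1 by (simp add: algebra_simps)
    have d': "Im z + Im c * (Re z + k * Im z) = Im c * Re z + (1 + k * Im c) * Im z"
      by (simp add: algebra_simps)
    then have d: "Im z + Im c * (Re z + k * Im z) = Im c * Re z + Re c * Im z"
      unfolding k1 by simp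
    show ?thesis
      unfolding s1_def s2_def using a b d k2 by (simp add: complex_eq_iff)
  qed
  have "(\<integral>\<^sup>+z. f (c * z) \<partial>lborel) = (\<integral>\<^sup>+z. f (s1 (s2 (s1 z))) \<partial>lborel)" unfolding eq ..
  also have "\<dots> = (\<integral>\<^sup>+z. f (s1 (s2 z)) \<partial>lborel)"
    using nn_integral_complex_shear(1)[of "\<lambda>z. f (s1 (s2 z))" k] unfolding s1_def by simp
  also have "\<dots> = (\<integral>\<^sup>+z. f (s1 z) \<partial>lborel)"
    using nn_integral_complex_shear(2)[of "\<lambda>z. f (s1 z)" "Im c"] unfolding s2_def by simp
  also have "\<dots> = (\<integral>\<^sup>+z. f z \<partial>lborel)"
    using nn_integral_complex_shear(1)[of f k] unfolding s1_def by simp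
  finally show ?thesis .
qed

section \<open>Exponential integrability of logarithmic potentials on the line\<close>

text \<open>The truncation at \<open>\<eta>\<close> makes the kernel bounded, so that it is
  integrable against any finite measure; the estimate of the exponential of its potential is uniform
  in \<open>\<eta>\<close>.\<close>

definition log_kernel :: "real \<Rightarrow> real \<Rightarrow> real \<Rightarrow> real" where
  "log_kernel R \<eta> u = max 0 (ln (R / max \<eta> \<bar>u\<bar>))"

lemma log_kernel_nonneg [simp]: "0 \<le> log_kernel R \<eta> u"
  by (simp add: log_kernel_def)

lemma log_kernel_measurable [measurable]: "log_kernel R \<eta> \<in> borel_measurable borel"
  unfolding log_kernel_def by measurable

lemma log_kernel_antimono:
  assumes "0 < R" "0 < \<eta>" "\<bar>u\<bar> \<le> \<bar>v\<bar>"
  shows "log_kernel R \<eta> v \<le> log_kernel R \<eta> u"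
proof -
  have "R / max \<eta> \<bar>v\<bar> \<le> R / max \<eta> \<bar>u\<bar>"
    using assms by (intro divide_left_mono) (auto simp: max_def)
  then have "ln (R / max \<eta> \<bar>v\<bar>) \<le> ln (R / max \<eta> \<bar>u\<bar>)"
    using assms by (subst ln_le_cancel_iff) (auto simp: max_def)
  then show ?thesis unfolding log_kernel_def by auto
qed

lemma log_kernel_le: "0 < R \<Longrightarrow> 0 < \<eta> \<Longrightarrow> log_kernel R \<eta> u \<le> log_kernel R \<eta> 0"
  by (rule log_kernel_antimono) auto

lemma exp_log_kernel:
  assumes "0 < R" "0 < \<eta>"
  shows "exp (log_kernel R \<eta> u) = max 1 (R / max \<eta> \<bar>u\<bar>)"
proof -
  have p: "0 < R / max \<eta> \<bar>u\<bar>" using assms by (simp add: max_def)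
  show ?thesis
  proof (cases "1 \<le> R / max \<eta> \<bar>u\<bar>")
    case True
    then have "0 \<le> ln (R / max \<eta> \<bar>u\<bar>)" by simp
    then show ?thesis using True p by (simp add: log_kernel_def max_def)
  next
    case False
    then have "ln (R / max \<eta> \<bar>u\<bar>) < 0" using p by simp
    then show ?thesis using False p by (simp add: log_kernel_def)
  qed
qed

text \<open>A weight of at most 1/2 turns the logarithmic singularity into the power |u|^(-1/2),
  which is integrable on the line. The bound is free of \<open>\<eta>\<close>.\<close>

lemma exp_log_kernel_half:
  assumes "0 < R" "0 < \<eta>" "u \<noteq> 0" "0 \<le> \<sigma>" "\<sigma> \<le> 1/2"
  shows "exp (\<sigma> * log_kernel R \<eta> u) \<le> 1 + sqrt (R / \<bar>u\<bar>)"
proof -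
  have "\<sigma> * log_kernel R \<eta> u \<le> (1/2) * log_kernel R \<eta> u"
    using assms by (intro mult_right_mono) auto
  then have "exp (\<sigma> * log_kernel R \<eta> u) \<le> exp (log_kernel R \<eta> u / 2)" by simp
  also have "\<dots> = sqrt (exp (log_kernel R \<eta> u))"
    by (rule real_sqrt_unique[symmetric]) (auto simp: power2_eq_square simp flip: exp_add)
  also have "\<dots> \<le> sqrt (max 1 (R / \<bar>u\<bar>))"
    unfolding exp_log_kernel[OF assms(1,2)] using assms
    by (intro real_sqrt_le_mono max.mono order_refl divide_left_mono) (auto simp: max_def)
  also have "\<dots> \<le> 1 + sqrt (R / \<bar>u\<bar>)"
    using assms by (auto simp: max_def)
  finally show ?thesis .
qed

text \<open>One zero pays for one unit of mass: the factor |u| / D cancels the exponential of the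
  kernel with the same centre, uniformly in \<open>\<eta>\<close>.\<close>

lemma dist_mult_exp_log_kernel:
  assumes "0 < R" "0 < \<eta>" "R \<le> D" "\<bar>u\<bar> \<le> D"
  shows "\<bar>u\<bar> / D * exp (log_kernel R \<eta> u) \<le> 1"
proof -
  have "\<bar>u\<bar> * (R / max \<eta> \<bar>u\<bar>) \<le> R"
    using assms by (auto simp: max_def field_simps intro!: mult_right_mono)
  then have "\<bar>u\<bar> * max 1 (R / max \<eta> \<bar>u\<bar>) \<le> D"
    using assms by (auto simp: max_def)
  then show ?thesis using assms by (simp add: exp_log_kernel field_simps)
qed

section \<open>Integrals of the inverse square root kernel on the line\<close>

lemma nn_integral_inverse_sqrt:
  "(\<integral>\<^sup>+u\<in>{-1..1}. ennreal (sqrt (1 / \<bar>u\<bar>)) \<partial>lborel) \<le> 4"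
proof -
  have eq: "sqrt (1 / u) = u powr - (1/2)" if "0 \<le> u" for u :: real
    using that by (simp add: powr_minus powr_half_sqrt real_sqrt_divide inverse_eq_divide)
  have "((\<lambda>u. u powr (-1/2)) has_integral (1 powr (-1/2+1) / (-1/2+1))) {0..1::real}"
    by (rule has_integral_powr_from_0) auto
  then have "((\<lambda>u. sqrt (1 / \<bar>u\<bar>)) has_integral 2) {0..1::real}"
    by (subst has_integral_cong[where g="\<lambda>u. u powr (-1/2)"]) (auto simp: eq)
  from nn_integral_has_integral_lebesgue'[OF _ this]
  have 1: "(\<integral>\<^sup>+u\<in>{0..1}. ennreal (sqrt (1 / \<bar>u\<bar>)) \<partial>lborel) = 2" by simp
  have "(\<integral>\<^sup>+u\<in>{-1..0}. ennreal (sqrt (1 / \<bar>u\<bar>)) \<partial>lborel) = (\<integral>\<^sup>+u\<in>{0..1}. ennreal (sqrt (1 / \<bar>u\<bar>)) \<partial>lborel)"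
    by (subst nn_integral_real_affine[where c="-1" and t=0]) (auto intro!: nn_integral_cong split: split_indicator)
  note 2 = this[unfolded 1]
  have "(\<integral>\<^sup>+u\<in>{-1..1}. ennreal (sqrt (1 / \<bar>u\<bar>)) \<partial>lborel) 
    \<le> (\<integral>\<^sup>+u. ennreal (sqrt (1 / \<bar>u\<bar>)) * indicator {-1..0} u + ennreal (sqrt (1 / \<bar>u\<bar>)) * indicator {0..1} u \<partial>lborel)"
    by (intro nn_integral_mono) (auto split: split_indicator)
  also have "\<dots> = 4" by (subst nn_integral_add) (auto simp: 1 2)
  finally show ?thesis .
qed

text \<open>The bound is independent of the centre \<open>x\<close>, so it survives integration over
  \<open>x\<close> after Fubini. Splitting at |t - x| = 1 separates the singular part, of integral
  at most 4 sqrt R, from the bounded one.\<close>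

lemma nn_integral_sqrt_kernel_le:
  assumes "0 < R" "A' \<le> B'"
  shows "(\<integral>\<^sup>+t\<in>{A'..B'}. ennreal (1 + sqrt (R / \<bar>t - x\<bar>)) \<partial>lborel)
    \<le> ennreal ((1 + sqrt R) * (B' - A') + 4 * sqrt R)"
proof -
  let ?g = "\<lambda>u. ennreal (sqrt (1 / \<bar>u\<bar>)) * indicator {-1..1::real} u"
  have bd: "ennreal (1 + sqrt (R / \<bar>t - x\<bar>)) \<le> ennreal (1 + sqrt R) + ennreal (sqrt R) * ?g (t - x)" for t
  proof (cases "\<bar>t - x\<bar> \<le> 1")
    case True
    have "1 + sqrt (R / \<bar>t - x\<bar>) \<le> (1 + sqrt R) + sqrt R * sqrt (1 / \<bar>t - x\<bar>)"
      using assms by (simp flip: real_sqrt_mult)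
    moreover have "t - x \<in> {-1..1}" using True by auto
    ultimately show ?thesis
      using assms by (simp add: ennreal_leI flip: ennreal_mult ennreal_plus)
  next
    case False
    then have "sqrt (R / \<bar>t - x\<bar>) \<le> sqrt R" using assms by (simp add: field_simps mult_le_cancel_left1)
    then have "ennreal (1 + sqrt (R / \<bar>t - x\<bar>)) \<le> ennreal (1 + sqrt R)" by (intro ennreal_leI) auto
    then show ?thesis by (meson add_increasing2 order_trans zero_le)
  qed
  have "(\<integral>\<^sup>+t\<in>{A'..B'}. ennreal (1 + sqrt (R / \<bar>t - x\<bar>)) \<partial>lborel)
    \<le> (\<integral>\<^sup>+t. ennreal (1 + sqrt R) * indicator {A'..B'} t + ennreal (sqrt R) * ?g (t - x) \<partial>lborel)"
    using bd by (intro nn_integral_mono) (auto split: split_indicator)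
  also have "\<dots> = ennreal (1 + sqrt R) * ennreal (B' - A') + ennreal (sqrt R) * (\<integral>\<^sup>+t. ?g (t - x) \<partial>lborel)"
    using assms by (subst nn_integral_add) (auto simp: nn_integral_cmult)
  also have "(\<integral>\<^sup>+t. ?g (t - x) \<partial>lborel) = (\<integral>\<^sup>+t. ?g t \<partial>lborel)"
    using nn_integral_real_affine[of ?g 1 "-x"] by simp
  also have "\<dots> \<le> 4" by (rule nn_integral_inverse_sqrt)
  also have "ennreal (1 + sqrt R) * ennreal (B' - A') + ennreal (sqrt R) * 4
      = ennreal ((1 + sqrt R) * (B' - A') + 4 * sqrt R)"
    using assms by (subst ennreal_plus) (auto simp: ennreal_mult mult.commute)
  finally show ?thesis by (simp add: mult_left_mono)
qed

text \<open>Without atoms the distribution function is continuous, and it runs from 0 to the total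
  mass over [A, B]; the intermediate value theorem attains every quantile exactly.\<close>

lemma quantile_points:
  assumes "finite_borel_measure \<nu>" and atom: "\<And>x. measure \<nu> {x} = 0"
    and supp: "measure \<nu> (- {A..B}) = 0" and "A \<le> B" "0 < (N::nat)"
  shows "\<exists>x::nat \<Rightarrow> real. \<forall>i\<le>N. x i \<in> {A..B} \<and> cdf \<nu> (x i) = i * measure \<nu> UNIV / N"
proof -
  interpret finite_borel_measure \<nu> by fact
  have cont: "isCont (cdf \<nu>) x" for x using atom by (simp add: isCont_cdf)
  have sp [simp]: "space \<nu> = UNIV" using borel_UNIV by (metis M_is_borel sets_eq_imp_space_eq space_borel)
  have null: "measure \<nu> X = 0" if "X \<subseteq> - {A..B} \<union> {A}" "X \<in> sets borel" for X
  proof -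
    have "measure \<nu> X \<le> measure \<nu> (- {A..B} \<union> {A})"
      using that by (intro finite_measure_mono) auto
    also have "\<dots> \<le> measure \<nu> (- {A..B}) + measure \<nu> {A}" by (intro measure_Un_le) auto
    finally show ?thesis using supp atom by (simp add: measure_le_0_iff)
  qed
  have A0: "cdf \<nu> A = 0" unfolding cdf_def by (rule null) auto
  have "measure \<nu> UNIV = measure \<nu> {..B} + measure \<nu> {B<..}"
    by (subst finite_measure_Union[symmetric]) (auto simp: ivl_disj_un_one(1) intro!: arg_cong[where f="measure \<nu>"])
  moreover have "measure \<nu> {B<..} = 0" by (rule null) auto
  ultimately have B1: "cdf \<nu> B = measure \<nu> UNIV" unfolding cdf_def by simp
  have "\<exists>x. x \<in> {A..B} \<and> cdf \<nu> x = i * measure \<nu> UNIV / N" if "i \<le> N" for i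
  proof -
    have "real i * measure \<nu> UNIV / N \<le> measure \<nu> UNIV"
      using that assms by (simp add: field_simps mult_right_mono)
    then show ?thesis
      using IVT[of "cdf \<nu>" A "i * measure \<nu> UNIV / N" B] A0 B1 assms cont by auto
  qed
  then show ?thesis by metis
qed

text \<open>Jensen's inequality for the probability measure \<nu> / \<sigma> on \<open>P\<close> and
  the function \<sigma> k, obtained by integrating the tangent line of exp at the mean
  \<open>I\<close>.\<close>

lemma exp_piece_integral_le:
  assumes fin: "finite_measure \<nu>" and P: "P \<in> sets \<nu>" and m: "measure \<nu> P = \<sigma>" "0 < \<sigma>"
    and k [measurable]: "k \<in> borel_measurable \<nu>" and bd: "\<And>x. \<bar>k x\<bar> \<le> (K::real)"
  shows "ennreal (exp (LINT x:P|\<nu>. k x)) \<le> ennreal (1 / \<sigma>) * (\<integral>\<^sup>+x\<in>P. ennreal (exp (\<sigma> * k x)) \<partial>\<nu>)"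
proof -
  interpret finite_measure \<nu> by fact
  note P [measurable]
  define I where "I = (LINT x:P|\<nu>. k x)"
  have i1: "set_integrable \<nu> P k"
    unfolding set_integrable_def
    by (rule integrable_const_bound[where B=K]) (use bd in \<open>auto intro!: AE_I2 simp: indicator_def intro: order_trans[OF abs_ge_zero]\<close>)
  have i2: "set_integrable \<nu> P (\<lambda>x. exp (\<sigma> * k x))"
    unfolding set_integrable_def
  proof (rule integrable_const_bound[where B="exp (\<sigma> * K)"])
    have "\<sigma> * k x \<le> \<sigma> * K" for x using bd[of x] m by (intro mult_left_mono) auto
    then show "AE x in \<nu>. norm (indicat_real P x *\<^sub>R exp (\<sigma> * k x)) \<le> exp (\<sigma> * K)"
      by (auto simp: indicator_def)
  qed measurable
  have tangent: "exp I * (1 - I) + exp I * \<sigma> * k x \<le> exp (\<sigma> * k x)" for x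
  proof -
    have "exp I * (1 + (\<sigma> * k x - I)) \<le> exp I * exp (\<sigma> * k x - I)"
      by (intro mult_left_mono exp_ge_add_one_self) auto
    then show ?thesis by (simp add: algebra_simps flip: exp_add)
  qed
  have i1': "integrable \<nu> (\<lambda>x. indicator P x * k x)"
    using i1 by (simp add: set_integrable_def)
  have i0: "integrable \<nu> (\<lambda>x. indicator P x :: real)"
    by (rule integrable_const_bound[where B=1]) auto
  have I': "I = (LINT x|\<nu>. indicator P x * k x)"
    by (simp add: I_def set_lebesgue_integral_def)
  have "\<sigma> * exp I = (LINT x|\<nu>. (exp I * (1 - I)) * indicator P x + (exp I * \<sigma>) * (indicator P x * k x))"
  proof (subst Bochner_Integration.integral_add)
    show "\<sigma> * exp I = (LINT x|\<nu>. (exp I * (1 - I)) * indicator P x) + (LINT x|\<nu>. (exp I * \<sigma>) * (indicator P x * k x))"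
      using m unfolding integral_mult_right_zero I'[symmetric] by (simp add: algebra_simps)
  qed (use i0 i1' in \<open>auto intro!: integrable_mult_right\<close>)
  also have "\<dots> \<le> (LINT x:P|\<nu>. exp (\<sigma> * k x))"
    unfolding set_lebesgue_integral_def
  proof (rule integral_mono)
    show "integrable \<nu> (\<lambda>x. (exp I * (1 - I)) * indicator P x + (exp I * \<sigma>) * (indicator P x * k x))"
      using i0 i1' by (intro Bochner_Integration.integrable_add integrable_mult_right) auto
  qed (use i2 tangent in \<open>auto simp: set_integrable_def indicator_def\<close>)
  finally have "exp I \<le> 1 / \<sigma> * (LINT x:P|\<nu>. exp (\<sigma> * k x))"
    using m by (simp add: field_simps)
  then have "ennreal (exp I) \<le> ennreal (1 / \<sigma>) * ennreal (LINT x:P|\<nu>. exp (\<sigma> * k x))"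
    using m by (simp add: ennreal_leI flip: ennreal_mult')
  also have "ennreal (LINT x:P|\<nu>. exp (\<sigma> * k x)) = (\<integral>\<^sup>+x\<in>P. ennreal (exp (\<sigma> * k x)) \<partial>\<nu>)"
    unfolding set_lebesgue_integral_def using i2
    by (subst nn_integral_eq_integral[symmetric]) 
      (auto simp: set_integrable_def ennreal_mult'[symmetric] mult.commute ennreal_indicator[symmetric] intro!: nn_integral_cong)
  finally show ?thesis unfolding I_def .
qed

text \<open>The zeros are placed at quantiles of the measure, so that each gap between consecutive zeros
  carries mass at most one half. A piece of the measure not lying in the gap of \<open>t\<close> is at least as
  far from \<open>t\<close> as one of its end points, hence is compensated by the zeros; the remaining piece is
  harmless by Jensen's inequality.\<close>
lemma exp_log_potential_integral_le:
  fixes N :: nat and A B A' B' R D \<eta> :: real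
  assumes "finite_borel_measure \<nu>" and atom: "\<And>x. measure \<nu> {x} = 0"
    and supp: "measure \<nu> (- {A..B}) = 0" and mass: "measure \<nu> UNIV \<le> N / 2"
    and "A \<le> B" "A' \<le> B'" "0 < N" "0 < R" "0 < \<eta>" "R \<le> D"
    and D: "\<And>t x. t \<in> {A'..B'} \<Longrightarrow> x \<in> {A..B} \<Longrightarrow> \<bar>t - x\<bar> \<le> D"
  shows "\<exists>x::nat \<Rightarrow> real. (\<forall>i\<le>N. x i \<in> {A..B}) \<and>
    (\<integral>\<^sup>+t\<in>{A'..B'}. ennreal ((\<Prod>i\<le>N. \<bar>t - x i\<bar> / D) * exp (LINT x|\<nu>. log_kernel R \<eta> (t - x))) \<partial>lborel)
    \<le> ennreal ((B' - A') + N * ((1 + sqrt R) * (B' - A') + 4 * sqrt R))"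
proof -
  interpret finite_borel_measure \<nu> by fact
  have sp [simp]: "space \<nu> = UNIV" by (rule borel_UNIV)
  have [measurable_cong]: "sets \<nu> = sets borel" by (rule M_is_borel)
  define K1 where "K1 = (1 + sqrt R) * (B' - A') + 4 * sqrt R"
  have K1: "0 \<le> K1" unfolding K1_def using assms by simp
  define m where "m = measure \<nu> UNIV"
  define \<sigma> where "\<sigma> = m / N"
  let ?k = "log_kernel R \<eta>"
  obtain x where x: "\<And>i. i \<le> N \<Longrightarrow> x i \<in> {A..B}" "\<And>i. i \<le> N \<Longrightarrow> cdf \<nu> (x i) = i * \<sigma>"
    using quantile_points[OF assms(1) atom supp \<open>A \<le> B\<close> \<open>0 < N\<close>] by (auto simp: \<sigma>_def m_def)
  have prod_le: "(\<Prod>i\<le>N. \<bar>t - x i\<bar> / D) \<le> 1" and prod_nn: "0 \<le> (\<Prod>i\<le>N. \<bar>t - x i\<bar> / D)"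
    if "t \<in> {A'..B'}" for t
    using D[OF that] x(1) assms by (auto intro!: prod_le_1 prod_nonneg simp: field_simps)
  show ?thesis
  proof (cases "m = 0")
    \<comment> \<open>The zero measure is treated apart, since the pieces below are normalised by
      \<open>1 / \<sigma>\<close>.\<close>
    case True
    then have ae: "AE x in \<nu>. False"
      unfolding m_def by (subst AE_iff_measurable[OF _ refl]) (auto simp: emeasure_eq_measure)
    have "(LINT x|\<nu>. ?k (t - x)) = (LINT x|\<nu>. 0)" for t
      by (intro integral_cong_AE) (use ae in auto)
    then have z: "(LINT x|\<nu>. ?k (t - x)) = 0" for t by simp
    have "(\<integral>\<^sup>+t\<in>{A'..B'}. ennreal ((\<Prod>i\<le>N. \<bar>t - x i\<bar> / D) * exp (LINT x|\<nu>. ?k (t - x))) \<partial>lborel)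
      \<le> (\<integral>\<^sup>+t\<in>{A'..B'}. 1 \<partial>lborel)"
      using prod_le by (intro nn_integral_mono) (auto simp: z split: split_indicator intro!: ennreal_le_1[THEN iffD2])
    also have "\<dots> = ennreal (B' - A')" using assms by simp
    also have "\<dots> \<le> ennreal ((B' - A') + N * K1)" using K1 by (intro ennreal_leI) auto
    finally show ?thesis using x unfolding K1_def by blast
  next
    case False
    then have "0 < m" unfolding m_def by (simp add: zero_less_measure_iff)
    then have \<sigma>: "0 < \<sigma>" "\<sigma> \<le> 1/2" using assms unfolding \<sigma>_def m_def by (auto simp: field_simps)
    have mono: "x i < x j" if "i < j" "j \<le> N" for i j
    proof (rule ccontr)
      assume "\<not> x i < x j"
      then have "cdf \<nu> (x j) \<le> cdf \<nu> (x i)" by (intro cdf_nondecreasing) auto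
      then show False using x(2)[of i] x(2)[of j] that \<sigma> by simp
    qed
    define P where "P i = {x i<..x (Suc i)}" for i
    have [measurable]: "P i \<in> sets borel" for i by (simp add: P_def)
    have mP: "measure \<nu> (P i) = \<sigma>" if "i < N" for i
      unfolding P_def using that mono[of i "Suc i"] x(2)[of i] x(2)[of "Suc i"]
      by (subst cdf_diff_eq[symmetric]) (auto simp: algebra_simps)
    have sumP: "(\<Sum>i<n. indicator (P i) z) = (indicator {x 0<..x n} z :: real)" if "n \<le> N" for n z
      using that
    proof (induction n)
      case (Suc n)
      then have "x n < x (Suc n)" "x 0 \<le> x n" using mono[of n "Suc n"] mono[of 0 n] by (cases n; fastforce)+
      then show ?case using Suc by (auto simp: P_def split: split_indicator)
    qed simp
    have "measure \<nu> {x 0<..x N} = m"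
      using mono[of 0 N] assms x(2)[of 0] x(2)[of N] \<sigma> by (subst cdf_diff_eq[symmetric]) (auto simp: \<sigma>_def)
    then have "measure \<nu> (UNIV - {x 0<..x N}) = 0"
      using finite_measure_compl[of "{x 0<..x N}"] by (auto simp: m_def)
    then have "UNIV - {x 0<..x N} \<in> null_sets \<nu>"
      by (auto simp: null_sets_def emeasure_eq_measure)
    from AE_not_in[OF this] have "AE z in \<nu>. z \<in> {x 0<..x N}" by simp
    then have aeP: "AE z in \<nu>. (\<Sum>i<N. indicator (P i) z) = (1::real)"
      by eventually_elim (simp add: sumP)
    have kint: "integrable \<nu> (\<lambda>z. indicator S z * ?k (t - z))" if [measurable]: "S \<in> sets borel" for S t
      using log_kernel_le[OF \<open>0 < R\<close> \<open>0 < \<eta>\<close>]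
      by (intro integrable_const_bound[where B="?k 0"] AE_I2) (auto simp: indicator_def)
    define I where "I t i = (LINT z:P i|\<nu>. ?k (t - z))" for t i
    have split: "(LINT z|\<nu>. ?k (t - z)) = (\<Sum>i<N. I t i)" for t
    proof -
      have "(LINT z|\<nu>. ?k (t - z)) = (LINT z|\<nu>. (\<Sum>i<N. indicator (P i) z * ?k (t - z)))"
        by (intro integral_cong_AE) (use aeP in \<open>auto simp flip: sum_distrib_right\<close>)
      also have "\<dots> = (\<Sum>i<N. I t i)"
        unfolding I_def set_lebesgue_integral_def by (subst Bochner_Integration.integral_sum) (auto intro!: kint)
      finally show ?thesis .
    qed
    have far: "I t i \<le> \<sigma> * (?k (t - x i) + ?k (t - x (Suc i)))" if "i < N" "t \<notin> {x i..x (Suc i)}" for t i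
    proof -
      have "?k (t - z) \<le> ?k (t - x i) + ?k (t - x (Suc i))" if "z \<in> P i" for z
      proof (cases "t < x i")
        case True
        then have "?k (t - z) \<le> ?k (t - x i)"
          using that assms by (intro log_kernel_antimono) (auto simp: P_def)
        then show ?thesis by (simp add: add_increasing2)
      next
        case False
        then have "?k (t - z) \<le> ?k (t - x (Suc i))"
          using that assms \<open>t \<notin> _\<close> by (intro log_kernel_antimono) (auto simp: P_def)
        then show ?thesis by (simp add: add_increasing)
      qed
      moreover have "integrable \<nu> (\<lambda>z. indicator (P i) z * (?k (t - x i) + ?k (t - x (Suc i))))"
        by (intro integrable_const_bound[where B="?k (t - x i) + ?k (t - x (Suc i))"] AE_I2) (auto simp: indicator_def)
      ultimately have "I t i \<le> (LINT z|\<nu>. indicator (P i) z * (?k (t - x i) + ?k (t - x (Suc i))))"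
        unfolding I_def set_lebesgue_integral_def real_scaleR_def
        by (intro integral_mono kint) (auto simp: indicator_def)
      then show ?thesis using mP[OF \<open>i < N\<close>] by simp
    qed
    define J where "J t i = ennreal (1 / \<sigma>) * (\<integral>\<^sup>+z\<in>P i. ennreal (1 + sqrt (R / \<bar>t - z\<bar>)) \<partial>\<nu>)" for t i
    have near: "ennreal (exp (I t i)) \<le> J t i" if "i < N" for t i
    proof -
      have "ennreal (exp (I t i)) \<le> ennreal (1 / \<sigma>) * (\<integral>\<^sup>+z\<in>P i. ennreal (exp (\<sigma> * ?k (t - z))) \<partial>\<nu>)"
        unfolding I_def using mP[OF that] \<sigma> log_kernel_le[OF \<open>0 < R\<close> \<open>0 < \<eta>\<close>]
        by (intro exp_piece_integral_le[where K="?k 0"]) (auto intro: finite_measure_axioms)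
      also have "\<dots> \<le> J t i"
      proof -
        have "AE z in \<nu>. z \<noteq> t"
          using atom[of t] by (subst AE_iff_measurable[OF _ refl]) (auto simp: emeasure_eq_measure)
        then have "AE z in \<nu>. ennreal (exp (\<sigma> * ?k (t - z))) \<le> ennreal (1 + sqrt (R / \<bar>t - z\<bar>))"
          by eventually_elim (use exp_log_kernel_half[of R \<eta> _ \<sigma>] assms \<sigma> in \<open>auto intro!: ennreal_leI simp del: ennreal_plus\<close>)
        then show ?thesis unfolding J_def
          by (intro mult_left_mono nn_integral_mono_AE) (auto elim!: eventually_mono intro: mult_right_mono)
      qed
      finally show ?thesis .
    qed
    have main: "ennreal ((\<Prod>i\<le>N. \<bar>t - x i\<bar> / D) * exp (LINT z|\<nu>. ?k (t - z))) \<le> 1 + (\<Sum>i<N. J t i)"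
      if t: "t \<in> {A'..B'}" and tx: "t \<notin> x ` {..N}" for t
    proof -
      let ?S = "\<Sum>i\<le>N. ?k (t - x i)"
      \<comment> \<open>Each zero is an end point of at most two pieces, each weighted with \<sigma>
        \<le> 1/2, so it is charged with at most one unit of the kernel, exactly what its factor in
        the product absorbs.\<close>
      have sumle: "(\<Sum>i<N. \<sigma> * (?k (t - x i) + ?k (t - x (Suc i)))) \<le> ?S"
      proof -
        have "(\<Sum>i<N. \<sigma> * (?k (t - x i) + ?k (t - x (Suc i))))
           \<le> (\<Sum>i<N. (1/2) * (?k (t - x i) + ?k (t - x (Suc i))))"
          using \<sigma> by (intro sum_mono mult_right_mono) auto
        also have "\<dots> = (1/2) * ((\<Sum>i<N. ?k (t - x i)) + (\<Sum>i<N. ?k (t - x (Suc i))))"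
          by (simp only: sum_distrib_left[symmetric] sum.distrib)
        also have "(\<Sum>i<N. ?k (t - x i)) \<le> ?S" by (intro sum_mono2) auto
        also have "(\<Sum>i<N. ?k (t - x (Suc i))) \<le> ?S"
          by (subst sum.atMost_shift) simp
        finally show ?thesis by simp
      qed
      have prodS: "(\<Prod>i\<le>N. \<bar>t - x i\<bar> / D) * exp ?S \<le> 1"
        unfolding exp_sum[OF finite_atMost] prod.distrib[symmetric]
        using D[OF t] x(1) assms dist_mult_exp_log_kernel[OF \<open>0 < R\<close> \<open>0 < \<eta>\<close> \<open>R \<le> D\<close>]
        by (intro prod_le_1 conjI) auto
      \<comment> \<open>\<open>E\<close> is what the zeros do not absorb: 0 if \<open>t\<close> lies
        in no gap, and otherwise the integral over the one gap that contains \<open>t\<close>,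
        unique because \<open>t\<close> is not itself a zero.\<close>
      have "\<exists>E. (\<Sum>i<N. I t i) \<le> ?S + E \<and> ennreal (exp E) \<le> 1 + (\<Sum>i<N. J t i)"
      proof (cases "\<exists>j<N. t \<in> {x j..x (Suc j)}")
        case False
        then have "(\<Sum>i<N. I t i) \<le> (\<Sum>i<N. \<sigma> * (?k (t - x i) + ?k (t - x (Suc i))))"
          by (intro sum_mono far) auto
        then show ?thesis using sumle by (intro exI[of _ 0]) auto
      next
        case True
        then obtain j where j: "j < N" "t \<in> {x j..x (Suc j)}" by blast
        have lt: "x j < t" "t < x (Suc j)" using j tx by (force simp: image_iff less_le)+
        have "t \<notin> {x i..x (Suc i)}" if "i < N" "i \<noteq> j" for i
        proof (cases "i < j")
          case True
          then have "x (Suc i) \<le> x j" using mono[of "Suc i" j] j by (cases "Suc i = j") auto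
          then show ?thesis using lt by auto
        next
          case False
          then have "x (Suc j) \<le> x i" using mono[of "Suc j" i] that by (cases "Suc j = i") auto
          then show ?thesis using lt by auto
        qed
        then have "(\<Sum>i\<in>{..<N}-{j}. I t i) \<le> (\<Sum>i\<in>{..<N}-{j}. \<sigma> * (?k (t - x i) + ?k (t - x (Suc i))))"
          by (intro sum_mono far) auto
        also have "\<dots> \<le> (\<Sum>i<N. \<sigma> * (?k (t - x i) + ?k (t - x (Suc i))))"
          using \<sigma> by (intro sum_mono2) auto
        finally have "(\<Sum>i<N. I t i) \<le> ?S + I t j"
          using sumle j by (subst sum.remove[of _ j]) auto
        moreover have "ennreal (exp (I t j)) \<le> 1 + (\<Sum>i<N. J t i)"
        proof -
          have "J t j \<le> (\<Sum>i<N. J t i)" using j by (intro member_le_sum) auto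
          then show ?thesis using near[OF j(1), of t] by (meson add_increasing order_trans zero_le)
        qed
        ultimately show ?thesis by blast
      qed
      then obtain E where E: "(\<Sum>i<N. I t i) \<le> ?S + E" "ennreal (exp E) \<le> 1 + (\<Sum>i<N. J t i)" by blast
      have "(\<Prod>i\<le>N. \<bar>t - x i\<bar> / D) * exp (LINT z|\<nu>. ?k (t - z)) \<le> (\<Prod>i\<le>N. \<bar>t - x i\<bar> / D) * exp (?S + E)"
        unfolding split using E prod_nn[OF t] by (intro mult_left_mono) auto
      also have "\<dots> = ((\<Prod>i\<le>N. \<bar>t - x i\<bar> / D) * exp ?S) * exp E" by (simp add: exp_add)
      also have "\<dots> \<le> 1 * exp E" using prodS by (intro mult_right_mono) auto
      finally show ?thesis using E(2) by (metis ennreal_leI mult_1 order_trans)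
    qed
    have Jint: "(\<integral>\<^sup>+t\<in>{A'..B'}. J t i \<partial>lborel) \<le> ennreal K1" if "i < N" for i
    proof -
      interpret pair_sigma_finite lborel \<nu> ..
      have "(\<integral>\<^sup>+t\<in>{A'..B'}. J t i \<partial>lborel)
        = (\<integral>\<^sup>+t. ennreal (1 / \<sigma>) * (\<integral>\<^sup>+z. (ennreal (1 + sqrt (R / \<bar>t - z\<bar>)) * indicator {A'..B'} t) * indicator (P i) z \<partial>\<nu>) \<partial>lborel)"
        unfolding J_def
        by (intro nn_integral_cong) (auto split: split_indicator)
      also have "\<dots> = ennreal (1 / \<sigma>) * (\<integral>\<^sup>+t. (\<integral>\<^sup>+z. (ennreal (1 + sqrt (R / \<bar>t - z\<bar>)) * indicator {A'..B'} t) * indicator (P i) z \<partial>\<nu>) \<partial>lborel)"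
        by (subst nn_integral_cmult) auto
      also have "\<dots> = ennreal (1 / \<sigma>) * (\<integral>\<^sup>+z. (\<integral>\<^sup>+t. (ennreal (1 + sqrt (R / \<bar>t - z\<bar>)) * indicator {A'..B'} t) * indicator (P i) z \<partial>lborel) \<partial>\<nu>)"
        by (subst Fubini') auto
      also have "\<dots> \<le> ennreal (1 / \<sigma>) * (\<integral>\<^sup>+z. ennreal K1 * indicator (P i) z \<partial>\<nu>)"
        using nn_integral_sqrt_kernel_le[OF \<open>0 < R\<close> \<open>A' \<le> B'\<close>]
        by (intro mult_left_mono nn_integral_mono) (auto simp: nn_integral_multc K1_def intro!: mult_right_mono)
      \<comment> \<open>The mass \<sigma> of the piece cancels the factor
        \<open>1 / \<sigma>\<close> from Jensen's inequality.\<close>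
      also have "\<dots> = ennreal (1 / \<sigma>) * (ennreal K1 * ennreal \<sigma>)"
        by (subst nn_integral_cmult_indicator) (auto simp: emeasure_eq_measure mP[OF that])
      also have "\<dots> = ennreal K1" using \<sigma> K1 by (simp flip: ennreal_mult)
      finally show ?thesis .
    qed
    have [measurable]: "(\<lambda>t. J t i) \<in> borel_measurable borel" for i
      unfolding J_def by measurable
    have "AE t in lborel. t \<notin> x ` {..N}"
      by (rule AE_not_in) (auto intro!: finite_imp_null_set_lborel)
    then have "(\<integral>\<^sup>+t\<in>{A'..B'}. ennreal ((\<Prod>i\<le>N. \<bar>t - x i\<bar> / D) * exp (LINT z|\<nu>. ?k (t - z))) \<partial>lborel)
      \<le> (\<integral>\<^sup>+t. indicator {A'..B'} t + (\<Sum>i<N. J t i * indicator {A'..B'} t) \<partial>lborel)"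
    proof (intro nn_integral_mono_AE, eventually_elim)
      case (elim t)
      then show ?case using main[of t] by (cases "t \<in> {A'..B'}") simp_all
    qed
    also have "\<dots> = ennreal (B' - A') + (\<Sum>i<N. \<integral>\<^sup>+t\<in>{A'..B'}. J t i \<partial>lborel)"
      using \<open>A' \<le> B'\<close> by (subst nn_integral_add, measurable, subst nn_integral_sum) simp_all
    also have "\<dots> \<le> ennreal (B' - A') + (\<Sum>i<N. ennreal K1)"
      using Jint by (intro add_left_mono sum_mono) auto
    also have "\<dots> = ennreal ((B' - A') + N * K1)"
      using assms K1 by (simp add: ennreal_plus ennreal_mult'' ennreal_of_nat_eq_real_of_nat ennreal_mult)
    finally show ?thesis using x(1) unfolding K1_def by blast
  qed
qed

section \<open>Circle means of radial functions\<close>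

definition circle_mean :: "real \<Rightarrow> (complex \<Rightarrow> real) \<Rightarrow> complex \<Rightarrow> real" where
  "circle_mean s f z = (LINT \<theta>:{0..2*pi}|lborel. f (z + of_real s * cis \<theta>)) / (2 * pi)"

text \<open>Taylor's formula with Lagrange remainder along the segment from \<open>z\<close> in
  direction \<open>e\<close>, on which the squared modulus is a quadratic polynomial. Profiles are
  functions of |z|^2 and not of |z| because this keeps them smooth at the origin.\<close>

lemma radial_taylor:
  fixes F F' F'' :: "real \<Rightarrow> real" and z e :: complex
  assumes F: "\<And>q. (F has_real_derivative F' q) (at q)" and F': "\<And>q. (F' has_real_derivative F'' q) (at q)"
    and e: "cmod e = 1" and s: "0 < s"
  shows "\<exists>\<xi>. 0 < \<xi> \<and> \<xi> < s \<and> F ((cmod (z + of_real s * e))\<^sup>2) = F ((cmod z)\<^sup>2) + s * (2 * F' ((cmod z)\<^sup>2) * (z \<bullet> e))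
    + s\<^sup>2 / 2 * (4 * F'' ((cmod (z + of_real \<xi> * e))\<^sup>2) * ((z + of_real \<xi> * e) \<bullet> e)\<^sup>2 + 2 * F' ((cmod (z + of_real \<xi> * e))\<^sup>2))"
proof -
  define Q where "Q t = (cmod z)\<^sup>2 + 2 * t * (z \<bullet> e) + t\<^sup>2" for t
  have ee: "(Re e)\<^sup>2 + (Im e)\<^sup>2 = 1" using e by (metis cmod_power2 one_power2)
  have Q: "(cmod (z + of_real t * e))\<^sup>2 = Q t" for t
  proof -
    have "(cmod (z + of_real t * e))\<^sup>2 = (cmod z)\<^sup>2 + 2 * t * (z \<bullet> e) + t\<^sup>2 * ((Re e)\<^sup>2 + (Im e)\<^sup>2)"
      unfolding cmod_power2 by (simp add: inner_complex_def power2_eq_square algebra_simps)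
    then show ?thesis unfolding ee Q_def by simp
  qed
  have inner: "(z + of_real t * e) \<bullet> e = z \<bullet> e + t" for t
  proof -
    have "(z + of_real t * e) \<bullet> e = z \<bullet> e + t * ((Re e)\<^sup>2 + (Im e)\<^sup>2)"
      by (simp add: inner_complex_def power2_eq_square algebra_simps)
    then show ?thesis unfolding ee by simp
  qed
  have dQ: "(Q has_real_derivative 2 * (z \<bullet> e + t)) (at t)" for t
    unfolding Q_def by (auto intro!: derivative_eq_intros)
  define d where "d m = (if m = 0 then \<lambda>t. F (Q t) else if m = 1 then \<lambda>t. F' (Q t) * (2 * (z \<bullet> e + t))
    else (\<lambda>t. 4 * F'' (Q t) * (z \<bullet> e + t)\<^sup>2 + 2 * F' (Q t)))" for m :: nat
  have "\<exists>t>0. t < s \<and> F (Q s) = (\<Sum>m<2. d m 0 / fact m * s ^ m) + d 2 t / fact 2 * s ^ 2"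
  proof (rule Maclaurin[OF s])
    show "d 0 = (\<lambda>t. F (Q t))" by (simp add: d_def)
    show "\<forall>m t. m < 2 \<and> 0 \<le> t \<and> t \<le> s \<longrightarrow> (d m has_real_derivative d (Suc m) t) (at t)"
    proof (intro allI impI)
      fix m t assume "m < (2::nat) \<and> 0 \<le> t \<and> t \<le> s"
      then consider "m = 0" | "m = 1" by linarith
      then show "(d m has_real_derivative d (Suc m) t) (at t)"
      proof cases
        case 1
        then show ?thesis using DERIV_chain2[OF F dQ] by (simp add: d_def)
      next
        case 2
        have "((\<lambda>t. F' (Q t) * (2 * (z \<bullet> e + t))) has_real_derivative
            F'' (Q t) * (2 * (z \<bullet> e + t)) * (2 * (z \<bullet> e + t)) + 2 * F' (Q t)) (at t)"
          using DERIV_chain2[OF F' dQ, of t] by (auto intro!: derivative_eq_intros)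
        then show ?thesis using 2 by (simp add: d_def power2_eq_square algebra_simps)
      qed
    qed
  qed auto
  then obtain t where t: "0 < t" "t < s" "F (Q s) = (\<Sum>m<2. d m 0 / fact m * s ^ m) + d 2 t / fact 2 * s ^ 2"
    by blast
  have "F (Q s) = F (Q 0) + F' (Q 0) * (2 * (z \<bullet> e)) * s + (4 * F'' (Q t) * (z \<bullet> e + t)\<^sup>2 + 2 * F' (Q t)) / 2 * s ^ 2"
    using t(3) by (simp add: d_def numeral_2_eq_2)
  moreover have "Q 0 = (cmod z)\<^sup>2" by (simp add: Q_def)
  ultimately show ?thesis using t unfolding Q inner by (intro exI[of _ t]) (simp add: algebra_simps)
qed

text \<open>Over a full circle the linear term averages to 0 and the square to |z|^2 / 2; an
  explicit antiderivative shows it.\<close>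

lemma integral_circle_quadratic:
  fixes z :: complex and \<alpha> \<beta> \<kappa> :: real
  shows "(LINT \<theta>:{0..2*pi}|lborel. \<alpha> + \<beta> * (z \<bullet> cis \<theta>) + \<kappa> * (z \<bullet> cis \<theta>)\<^sup>2) = 2 * pi * \<alpha> + pi * \<kappa> * (cmod z)\<^sup>2"
proof -
  let ?A = "\<lambda>\<theta>. \<alpha> * \<theta> + \<beta> * (Re z * sin \<theta> - Im z * cos \<theta>)
     + \<kappa> * ((cmod z)\<^sup>2 / 2 * \<theta> + ((Re z)\<^sup>2 - (Im z)\<^sup>2) / 4 * sin (2 * \<theta>) - Re z * Im z / 2 * cos (2 * \<theta>))"
  have "(LBINT \<theta>. (\<alpha> + \<beta> * (z \<bullet> cis \<theta>) + \<kappa> * (z \<bullet> cis \<theta>)\<^sup>2) * indicator {0..2*pi} \<theta>) = ?A (2 * pi) - ?A 0"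
  proof (rule integral_FTC_Icc_real)
    fix \<theta> :: real
    have *: "(Re z * cos \<theta> + Im z * sin \<theta>)\<^sup>2 = (cmod z)\<^sup>2 / 2 + ((Re z)\<^sup>2 - (Im z)\<^sup>2) / 2 * cos (2 * \<theta>) + Re z * Im z * sin (2 * \<theta>)"
    proof -
      have s: "(sin \<theta>)\<^sup>2 = 1 - (cos \<theta>)\<^sup>2" by (simp add: sin_squared_eq)
      have "(Re z * cos \<theta> + Im z * sin \<theta>)\<^sup>2 = (Re z)\<^sup>2 * (cos \<theta>)\<^sup>2 + (Im z)\<^sup>2 * (sin \<theta>)\<^sup>2 + 2 * Re z * Im z * sin \<theta> * cos \<theta>"
        by (simp add: power2_eq_square algebra_simps)
      then show ?thesis unfolding cos_double sin_double cmod_power2 s by (simp add: field_simps)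
    qed
    have i: "z \<bullet> cis \<theta> = Re z * cos \<theta> + Im z * sin \<theta>" by (simp add: inner_complex_def)
    show "(?A has_real_derivative \<alpha> + \<beta> * (z \<bullet> cis \<theta>) + \<kappa> * (z \<bullet> cis \<theta>)\<^sup>2) (at \<theta>)"
      unfolding i *
      by (auto intro!: derivative_eq_intros simp: algebra_simps diff_divide_distrib)
  next
    fix \<theta> :: real show "isCont (\<lambda>\<theta>. \<alpha> + \<beta> * (z \<bullet> cis \<theta>) + \<kappa> * (z \<bullet> cis \<theta>)\<^sup>2) \<theta>"
      unfolding inner_complex_def by (auto intro!: continuous_intros)
  qed simp
  then show ?thesis
    unfolding set_lebesgue_integral_def by (simp add: mult.commute right_diff_distrib)
qed

text \<open>With q = |z|^2, the term \<open>4 * (q * F'' q + F' q)\<close> is the Laplacian of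
  F(|z|^2), and to second order a circle mean exceeds the central value by s^2 / 4 times the
  Laplacian. Uniformity in \<open>z\<close> comes from uniform continuity of second derivatives on a
  compact set, outside of which they vanish.\<close>

lemma radial_mean_expansion:
  fixes F F' F'' :: "real \<Rightarrow> real"
  assumes F: "\<And>q. (F has_real_derivative F' q) (at q)" and F': "\<And>q. (F' has_real_derivative F'' q) (at q)"
    and F'': "continuous_on UNIV F''" and R: "0 < R" and zero: "\<And>q. R\<^sup>2 \<le> q \<Longrightarrow> F' q = 0 \<and> F'' q = 0"
    and \<epsilon>: "0 < \<epsilon>"
  shows "\<exists>s0>0. \<forall>s z. 0 < s \<longrightarrow> s < s0 \<longrightarrow>
    \<bar>(F ((cmod z)\<^sup>2) - circle_mean s (\<lambda>w. F ((cmod w)\<^sup>2)) z) * 4 / s\<^sup>2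
      + 4 * ((cmod z)\<^sup>2 * F'' ((cmod z)\<^sup>2) + F' ((cmod z)\<^sup>2))\<bar> \<le> \<epsilon>"
proof -
  have contF: "continuous_on S F" for S 
    by (intro continuous_at_imp_continuous_on ballI DERIV_isCont[OF F])
  have contF': "continuous_on S F'" for S 
    by (intro continuous_at_imp_continuous_on ballI DERIV_isCont[OF F'])
  \<comment> \<open>The second directional derivative of F(|.|^2) at the point \<open>fst p\<close>
    in the direction \<open>snd p\<close>.\<close>
  define G where "G p = 4 * F'' ((cmod (fst p))\<^sup>2) * (fst p \<bullet> snd p)\<^sup>2 + 2 * F' ((cmod (fst p))\<^sup>2)" for p :: "complex \<times> complex"
  \<comment> \<open>The excess 2 over \<open>R\<close> lets the ball contain every point of modulus
    at most R + 1 together with its displacement by less than 1; farther out both values of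
    \<open>G\<close> are 0.\<close>
  let ?K = "cball 0 (R + 2) \<times> sphere 0 1"
  have "continuous_on ?K G"
    unfolding G_def
    by (intro continuous_intros continuous_on_compose2[OF F''] continuous_on_compose2[OF contF'[of UNIV]]) auto
  then have "uniformly_continuous_on ?K G"
    by (intro compact_uniformly_continuous compact_Times) auto
  then obtain d where d: "0 < d" "\<And>p q. p \<in> ?K \<Longrightarrow> q \<in> ?K \<Longrightarrow> dist q p < d \<Longrightarrow> dist (G q) (G p) < \<epsilon> / 2"
    unfolding uniformly_continuous_on_def using \<epsilon> by (meson half_gt_zero)
  have Glip: "\<bar>G (z + of_real \<xi> * e, e) - G (z, e)\<bar> \<le> \<epsilon> / 2"
    if "cmod e = 1" "0 < \<xi>" "\<xi> < min 1 d" for z e \<xi>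
  proof (cases "cmod z \<le> R + 1")
    case True
    have n: "cmod (z + of_real \<xi> * e) \<le> R + 2"
      using norm_triangle_ineq[of z "of_real \<xi> * e"] True that by (simp add: norm_mult)
    have "dist (z + of_real \<xi> * e, e) (z, e) < d"
      using that by (simp add: dist_Pair_Pair dist_norm norm_mult)
    then show ?thesis using d(2)[of "(z, e)" "(z + of_real \<xi> * e, e)"] True n that
      by (simp add: dist_real_def)
  next
    case False
    have "cmod z \<le> cmod (z + of_real \<xi> * e) + \<xi>"
      using norm_triangle_ineq4[of "z + of_real \<xi> * e" "of_real \<xi> * e"] that by (simp add: norm_mult)
    then have "R \<le> cmod (z + of_real \<xi> * e)" "R \<le> cmod z" using False that by auto
    then have "R\<^sup>2 \<le> (cmod (z + of_real \<xi> * e))\<^sup>2" "R\<^sup>2 \<le> (cmod z)\<^sup>2"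
      using R by (intro power_mono; simp)+
    then show ?thesis using zero \<epsilon> unfolding G_def by simp
  qed
  show ?thesis
  proof (intro exI[of _ "min 1 d"] conjI allI impI)
    show "0 < min 1 d" using d by simp
    fix s z assume s: "0 < s" "s < min 1 d"
    let ?q = "(cmod z)\<^sup>2"
    let ?p = "\<lambda>\<theta>. (F ?q + s\<^sup>2 * F' ?q) + (2 * s * F' ?q) * (z \<bullet> cis \<theta>) + (2 * s\<^sup>2 * F'' ?q) * (z \<bullet> cis \<theta>)\<^sup>2"
    let ?f = "\<lambda>\<theta>. F ((cmod (z + of_real s * cis \<theta>))\<^sup>2)"
    have close: "\<bar>?f \<theta> - ?p \<theta>\<bar> \<le> s\<^sup>2 * \<epsilon> / 4" for \<theta>
    proof -
      obtain \<xi> where \<xi>: "0 < \<xi>" "\<xi> < s"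
        "?f \<theta> = F ?q + s * (2 * F' ?q * (z \<bullet> cis \<theta>)) + s\<^sup>2 / 2 * G (z + of_real \<xi> * cis \<theta>, cis \<theta>)"
        using radial_taylor[OF F F', of "cis \<theta>" s z] s unfolding G_def by auto
      have "?f \<theta> - ?p \<theta> = s\<^sup>2 / 2 * (G (z + of_real \<xi> * cis \<theta>, cis \<theta>) - G (z, cis \<theta>))"
        unfolding \<xi>(3) by (simp add: G_def algebra_simps)
      also have "\<bar>\<dots>\<bar> \<le> s\<^sup>2 / 2 * (\<epsilon> / 2)"
        unfolding abs_mult using Glip[of "cis \<theta>" \<xi> z] \<xi> s by (intro mult_mono) auto
      finally show ?thesis by simp
    qed
    have int: "set_integrable lborel {0..2*pi} ?f" "set_integrable lborel {0..2*pi} ?p"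
      by (auto intro!: borel_integrable_atLeastAtMost' continuous_intros continuous_on_compose2[OF contF[of UNIV]] simp: inner_complex_def)
    note int3 = set_integral_diff(1)[OF int]
    have int4: "set_integrable lborel {0..2*pi} (\<lambda>\<theta>. s\<^sup>2 * \<epsilon> / 4)" by (simp add: set_integrable_def)
    have "\<bar>(LINT \<theta>:{0..2*pi}|lborel. ?f \<theta>) - (LINT \<theta>:{0..2*pi}|lborel. ?p \<theta>)\<bar> = \<bar>LINT \<theta>:{0..2*pi}|lborel. ?f \<theta> - ?p \<theta>\<bar>"
      using int by (simp add: set_integral_diff)
    also have "\<dots> \<le> (LINT \<theta>:{0..2*pi}|lborel. s\<^sup>2 * \<epsilon> / 4)"
      unfolding real_norm_def[symmetric] using close
      by (intro set_integral_norm_bound[THEN order_trans] set_integral_mono int3 int4 set_integrable_norm) auto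
    also have "\<dots> = 2 * pi * (s\<^sup>2 * \<epsilon> / 4)"
      unfolding set_lebesgue_integral_def by simp
    finally have A: "\<bar>(LINT \<theta>:{0..2*pi}|lborel. ?f \<theta>) - (LINT \<theta>:{0..2*pi}|lborel. ?p \<theta>)\<bar> \<le> 2 * pi * (s\<^sup>2 * \<epsilon> / 4)" .
    have B: "(LINT \<theta>:{0..2*pi}|lborel. ?p \<theta>) = 2 * pi * (F ?q + s\<^sup>2 * (?q * F'' ?q + F' ?q))"
      unfolding integral_circle_quadratic by (simp add: algebra_simps)
    define m where "m = circle_mean s (\<lambda>w. F ((cmod w)\<^sup>2)) z"
    have "(LINT \<theta>:{0..2*pi}|lborel. ?f \<theta>) = 2 * pi * m"
      unfolding m_def circle_mean_def by simp
    with A B have "\<bar>2 * pi * (m - F ?q - s\<^sup>2 * (?q * F'' ?q + F' ?q))\<bar> \<le> 2 * pi * (s\<^sup>2 * \<epsilon> / 4)"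
      by (simp add: algebra_simps)
    then have C: "\<bar>m - F ?q - s\<^sup>2 * (?q * F'' ?q + F' ?q)\<bar> \<le> s\<^sup>2 * \<epsilon> / 4"
      unfolding abs_mult by (simp add: mult.commute)
    have "(F ?q - m) * 4 / s\<^sup>2 + 4 * (?q * F'' ?q + F' ?q) = - (m - F ?q - s\<^sup>2 * (?q * F'' ?q + F' ?q)) * (4 / s\<^sup>2)"
      using s by (simp add: field_simps)
    also have "\<bar>\<dots>\<bar> \<le> (s\<^sup>2 * \<epsilon> / 4) * (4 / s\<^sup>2)"
      unfolding abs_mult abs_minus_cancel using C \<epsilon> by (intro mult_mono) auto
    also have "\<dots> = \<epsilon>" using s by simp
    finally show "\<bar>(F ?q - circle_mean s (\<lambda>w. F ((cmod w)\<^sup>2)) z) * 4 / s\<^sup>2 + 4 * (?q * F'' ?q + F' ?q)\<bar> \<le> \<epsilon>"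
      unfolding m_def .
  qed
qed

section \<open>A smooth truncation of the logarithm and its Laplacian\<close>

lemma DERIV_if_less:
  fixes f g :: "real \<Rightarrow> real"
  assumes f: "\<And>x. x \<le> c \<Longrightarrow> (f has_real_derivative f' x) (at x)"
    and g: "\<And>x. c \<le> x \<Longrightarrow> (g has_real_derivative g' x) (at x)"
    and "f c = g c" "f' c = g' c"
  shows "((\<lambda>x. if x < c then f x else g x) has_real_derivative (if x < c then f' x else g' x)) (at x)"
proof (cases x c rule: linorder_cases)
  case less
  then have "eventually (\<lambda>x. x < c) (nhds x)" by (intro eventually_nhds_in_open[of "{..<c}", simplified]) auto
  then have "eventually (\<lambda>x. (if x < c then f x else g x) = f x) (nhds x)" by eventually_elim simp
  from DERIV_cong_ev[OF refl this refl] show ?thesis using f[of x] less by simp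
next
  case greater
  then have "eventually (\<lambda>x. c < x) (nhds x)" by (intro eventually_nhds_in_open[of "{c<..}", simplified]) auto
  then have "eventually (\<lambda>x. (if x < c then f x else g x) = g x) (nhds x)" by eventually_elim simp
  from DERIV_cong_ev[OF refl this refl] show ?thesis using g[of x] greater by simp
next
  case equal
  have "((\<lambda>y. ((if y < c then f y else g y) - g c) / (y - c)) \<longlongrightarrow> g' c) (at_left c)"
  proof (rule Lim_transform_eventually)
    show "((\<lambda>y. (f y - f c) / (y - c)) \<longlongrightarrow> g' c) (at_left c)"
      using f[of c] assms(4) unfolding has_field_derivative_iff
      by (metis filterlim_at_split order_refl)
    show "eventually (\<lambda>y. (f y - f c) / (y - c) = ((if y < c then f y else g y) - g c) / (y - c)) (at_left c)"
      using assms(3) by (auto simp: eventually_at_filter)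
  qed
  moreover have "((\<lambda>y. ((if y < c then f y else g y) - g c) / (y - c)) \<longlongrightarrow> g' c) (at_right c)"
  proof (rule Lim_transform_eventually)
    show "((\<lambda>y. (g y - g c) / (y - c)) \<longlongrightarrow> g' c) (at_right c)"
      using g[of c] unfolding has_field_derivative_iff
      by (metis filterlim_at_split order_refl)
    show "eventually (\<lambda>y. (g y - g c) / (y - c) = ((if y < c then f y else g y) - g c) / (y - c)) (at_right c)"
      by (auto simp: eventually_at_filter)
  qed
  ultimately show ?thesis
    using equal by (simp add: has_field_derivative_iff filterlim_at_split)
qed

text \<open>Below q = 1, \<open>- ln q\<close> is replaced by its Taylor polynomial of degree three
  at 1. The contact at 1 makes the function twice continuously differentiable, and with this degree
  the Laplacian becomes a constant times a square.\<close>

definition trunc_log :: "real \<Rightarrow> real" where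
  "trunc_log q = (if q < 1 then (1 - q) + (1 - q)\<^sup>2 / 2 + (1 - q)^3 / 3 else - ln q)"

definition trunc_log' :: "real \<Rightarrow> real" where
  "trunc_log' q = (if q < 1 then - (1 + (1 - q) + (1 - q)\<^sup>2) else - (1 / q))"

definition trunc_log'' :: "real \<Rightarrow> real" where
  "trunc_log'' q = (if q < 1 then 1 + 2 * (1 - q) else 1 / q\<^sup>2)"

lemma trunc_log_deriv:
  "(trunc_log has_real_derivative trunc_log' q) (at q)"
  "(trunc_log' has_real_derivative trunc_log'' q) (at q)"
  unfolding trunc_log_def[abs_def] trunc_log'_def[abs_def] trunc_log''_def
  by (rule DERIV_if_less; auto intro!: derivative_eq_intros simp: field_simps power2_eq_square)+

lemma trunc_log''_cont: "continuous_on UNIV trunc_log''"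
proof -
  have "continuous_on ({..1} \<union> {1..}) (\<lambda>q::real. if q < 1 then 1 + 2 * (1 - q) else 1 / q\<^sup>2)"
    by (rule continuous_on_If) (auto intro!: continuous_intros)
  moreover have "{..1} \<union> {1..} = (UNIV :: real set)" by auto
  ultimately show ?thesis unfolding trunc_log''_def[abs_def] by simp
qed

text \<open>Outside the unit disc ln |z|^2 is harmonic; inside, all terms cancel except the one
  quadratic in 1 - q. This is the origin of the constant 12.\<close>

lemma trunc_log_laplacian:
  "0 \<le> q \<Longrightarrow> 4 * (q * trunc_log'' q + trunc_log' q) = - 12 * (max 0 (1 - q))\<^sup>2"
  by (auto simp: trunc_log''_def trunc_log'_def max_def power2_eq_square field_simps)

lemma trunc_log_nonneg: "0 \<le> q \<Longrightarrow> q \<le> 1 \<Longrightarrow> 0 \<le> trunc_log q"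
  by (auto simp: trunc_log_def)

lemma trunc_log_le_two: "0 \<le> q \<Longrightarrow> q < 1 \<Longrightarrow> trunc_log q \<le> 2"
proof -
  assume "0 \<le> q" "q < 1"
  then have "(1 - q)\<^sup>2 \<le> 1" "(1 - q)^3 \<le> 1" by (auto intro!: power_le_one)
  then show "trunc_log q \<le> 2" using \<open>0 \<le> q\<close> \<open>q < 1\<close> by (simp add: trunc_log_def)
qed

text \<open>For q < 1 the truncation is a partial sum of the series of \<open>- ln q\<close> in
  powers of 1 - q, whose terms are nonnegative; the proof compares derivatives, starting from
  equality at 1.\<close>

lemma trunc_log_le_ln:
  assumes "0 < q" shows "trunc_log q \<le> - ln q"
proof (cases "q < 1")
  case True
  have "- ln 1 - trunc_log 1 \<le> - ln q - trunc_log q"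
  proof (rule DERIV_nonpos_imp_nonincreasing[where f="\<lambda>x. - ln x - trunc_log x"])
    show "q \<le> 1" using True by simp
    fix x assume x: "q \<le> x" "x \<le> 1"
    then have "0 < x" using \<open>0 < q\<close> by simp
    have "((\<lambda>x. - ln x - trunc_log x) has_real_derivative - (1/x) - trunc_log' x) (at x)"
      using \<open>0 < x\<close> by (auto intro!: derivative_eq_intros trunc_log_deriv(1))
    moreover have "- (1/x) - trunc_log' x \<le> 0"
    proof (cases "x < 1")
      case True
      have "x * (1 + (1 - x) + (1 - x)\<^sup>2) = 1 - (1 - x)^3"
        by (simp add: power2_eq_square power3_eq_cube algebra_simps)
      also have "\<dots> \<le> 1" using True by simp
      finally show ?thesis using True \<open>0 < x\<close> by (simp add: trunc_log'_def field_simps)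
    qed (simp add: trunc_log'_def)
    ultimately show "\<exists>y. ((\<lambda>x. - ln x - trunc_log x) has_real_derivative y) (at x) \<and> y \<le> 0" by blast
  qed
  then show ?thesis by (simp add: trunc_log_def)
qed (simp add: trunc_log_def)

text \<open>A compactly supported replacement for \<open>ln (R\<^sup>2 / |z|\<^sup>2)\<close>: its Laplacian is the difference of two
  multiples of the bump below at the scales \<open>R\<close> and \<open>\<delta>\<close>.\<close>
definition green_profile :: "real \<Rightarrow> real \<Rightarrow> real \<Rightarrow> real" where
  "green_profile R \<delta> q = ln (R\<^sup>2 / \<delta>\<^sup>2) + trunc_log (q / \<delta>\<^sup>2) - trunc_log (q / R\<^sup>2)"

text \<open>The factor 1 / \<delta>^2 makes the integral over the plane independent of \<delta>, so
  that one constant, \<open>bump_mass\<close>, serves all scales.\<close>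

definition bump :: "real \<Rightarrow> complex \<Rightarrow> real" where
  "bump \<delta> z = (max 0 (1 - (cmod z)\<^sup>2 / \<delta>\<^sup>2))\<^sup>2 / \<delta>\<^sup>2"

lemma green_profile_zero:
  assumes "0 < \<delta>" "\<delta> \<le> R" "R\<^sup>2 \<le> q" shows "green_profile R \<delta> q = 0"
proof -
  have "\<delta>\<^sup>2 \<le> R\<^sup>2" "0 < \<delta>\<^sup>2" using assms by (auto intro!: power_mono)
  then have "\<delta>\<^sup>2 \<le> q" "0 < R\<^sup>2" "0 < q" using assms(3) by linarith+
  then have "1 \<le> q / \<delta>\<^sup>2" "1 \<le> q / R\<^sup>2" using \<open>0 < \<delta>\<^sup>2\<close> assms(3) by simp_all
  note this \<open>0 < R\<^sup>2\<close> \<open>0 < q\<close>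
  then show ?thesis using \<open>0 < \<delta>\<^sup>2\<close> unfolding green_profile_def trunc_log_def by (simp add: ln_div)
qed

text \<open>Scaling the Laplacian of the truncated logarithm to the radii \<delta> and
  \<open>R\<close> gives - 12 (\<open>bump \<delta>\<close> - \<open>bump R\<close>); the sign is
  reversed here because the circle mean is subtracted from the value.\<close>

lemma green_mean_expansion:
  assumes "0 < \<delta>" "\<delta> \<le> R" "0 < \<epsilon>"
  shows "\<exists>s0>0. \<forall>s z. 0 < s \<longrightarrow> s < s0 \<longrightarrow>
    \<bar>(green_profile R \<delta> ((cmod z)\<^sup>2) - circle_mean s (\<lambda>w. green_profile R \<delta> ((cmod w)\<^sup>2)) z) * 4 / s\<^sup>2
      - 12 * (bump \<delta> z - bump R z)\<bar> \<le> \<epsilon>"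
proof -
  have "0 < R" using assms by simp
  define F' where "F' q = trunc_log' (q / \<delta>\<^sup>2) / \<delta>\<^sup>2 - trunc_log' (q / R\<^sup>2) / R\<^sup>2" for q
  define F'' where "F'' q = trunc_log'' (q / \<delta>\<^sup>2) / (\<delta>\<^sup>2)\<^sup>2 - trunc_log'' (q / R\<^sup>2) / (R\<^sup>2)\<^sup>2" for q
  have sc: "((\<lambda>q. f (q / c)) has_real_derivative f' (q / c) / c) (at q)"
    if "\<And>q. (f has_real_derivative f' q) (at q)" for f f' :: "real \<Rightarrow> real" and c q
  proof -
    have "((\<lambda>q. q / c) has_real_derivative 1 / c) (at q)" by (rule DERIV_cdivide[OF DERIV_ident])
    from DERIV_chain2[OF that this] show ?thesis by simp
  qed
  have 1: "(green_profile R \<delta> has_real_derivative F' q) (at q)" for q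
    unfolding green_profile_def[abs_def] F'_def
    using assms by (auto intro!: derivative_eq_intros sc[OF trunc_log_deriv(1)])
  have 2: "(F' has_real_derivative F'' q) (at q)" for q
    unfolding F'_def[abs_def] F''_def
    using assms by (auto intro!: derivative_eq_intros sc[OF trunc_log_deriv(2)] simp: power2_eq_square)
  have 3: "continuous_on UNIV F''"
    unfolding F''_def[abs_def] using assms
    by (intro continuous_intros continuous_on_compose2[OF trunc_log''_cont]) auto
  have 4: "F' q = 0 \<and> F'' q = 0" if "R\<^sup>2 \<le> q" for q
  proof -
    have "\<delta>\<^sup>2 \<le> R\<^sup>2" "0 < \<delta>\<^sup>2" using assms by (auto intro!: power_mono)
    then have "\<delta>\<^sup>2 \<le> q" "0 < R\<^sup>2" "0 < q" using that by linarith+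
    then have "1 \<le> q / \<delta>\<^sup>2" "1 \<le> q / R\<^sup>2" using \<open>0 < \<delta>\<^sup>2\<close> that by simp_all
    note this \<open>0 < R\<^sup>2\<close> \<open>0 < q\<close>
    then show ?thesis using \<open>0 < \<delta>\<close> \<open>0 < R\<close> unfolding F'_def F''_def trunc_log'_def trunc_log''_def by (simp add: field_simps power2_eq_square)
  qed
  have 5: "4 * (q * F'' q + F' q) = - 12 * (max 0 (1 - q / \<delta>\<^sup>2))\<^sup>2 / \<delta>\<^sup>2 - (- 12 * (max 0 (1 - q / R\<^sup>2))\<^sup>2 / R\<^sup>2)" if "0 \<le> q" for q
  proof -
    have "4 * (q * F'' q + F' q) = 4 * (q / \<delta>\<^sup>2 * trunc_log'' (q / \<delta>\<^sup>2) + trunc_log' (q / \<delta>\<^sup>2)) / \<delta>\<^sup>2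
       - 4 * (q / R\<^sup>2 * trunc_log'' (q / R\<^sup>2) + trunc_log' (q / R\<^sup>2)) / R\<^sup>2"
      using assms \<open>0 < R\<close> unfolding F'_def F''_def by (simp add: field_simps power2_eq_square)
    then show ?thesis
      using trunc_log_laplacian[of "q / \<delta>\<^sup>2"] trunc_log_laplacian[of "q / R\<^sup>2"] that by simp
  qed
  have L: "4 * ((cmod z)\<^sup>2 * F'' ((cmod z)\<^sup>2) + F' ((cmod z)\<^sup>2)) = - (12 * (bump \<delta> z - bump R z))" for z
    unfolding 5[OF zero_le_power2] bump_def by (simp add: algebra_simps)
  show ?thesis
    using radial_mean_expansion[OF 1 2 3 \<open>0 < R\<close> 4 \<open>0 < \<epsilon>\<close>] unfolding L add_uminus_conv_diff .
qed

text \<open>Here the plane is traded for the line: |Re z| \<le> |z|, and the kernel decreases with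
  the distance. The factor 2 comes from the squared modulus.\<close>

lemma green_profile_le_log_kernel:
  assumes "0 < \<delta>" "\<delta> \<le> R"
  shows "green_profile R \<delta> ((cmod z)\<^sup>2) \<le> 2 * log_kernel R (\<delta> / exp 1) (Re z)"
proof (cases "R\<^sup>2 \<le> (cmod z)\<^sup>2")
  case True
  then show ?thesis using green_profile_zero[OF assms] by simp
next
  case False
  \<comment> \<open>On the disc |z| < \<delta> the truncated logarithm is at most 2 = ln (\<delta>^2
    / \<eta>^2); this dictates \<eta> = \<delta> / e.\<close>
  let ?\<eta> = "\<delta> / exp 1"
  have R: "0 < R" using assms by simp
  have lt: "cmod z < R" using False assms by (meson R not_le power_mono norm_ge_zero less_imp_le)
  define M where "M = max ?\<eta> (cmod z)"
  have \<eta>: "0 < ?\<eta>" "?\<eta> \<le> \<delta>" using assms by (simp_all add: divide_le_eq mult_le_cancel_left1)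
  then have M: "0 < M" unfolding M_def by linarith
  have "trunc_log ((cmod z)\<^sup>2 / \<delta>\<^sup>2) \<le> - ln (M\<^sup>2 / \<delta>\<^sup>2)"
  proof (cases "?\<eta> \<le> cmod z")
    case True
    then have "0 < cmod z" using \<eta> by linarith
    then show ?thesis using True assms trunc_log_le_ln[of "(cmod z)\<^sup>2 / \<delta>\<^sup>2"] by (simp add: M_def)
  next
    case False
    then have "cmod z < \<delta>" using \<eta> by linarith
    then have "(cmod z)\<^sup>2 < \<delta>\<^sup>2" by (intro power_strict_mono) auto
    then have "trunc_log ((cmod z)\<^sup>2 / \<delta>\<^sup>2) \<le> 2" using assms by (intro trunc_log_le_two) auto
    also have "2 = - ln (M\<^sup>2 / \<delta>\<^sup>2)"
    proof -
      have "M\<^sup>2 / \<delta>\<^sup>2 = (1 / exp 1)\<^sup>2" using False assms by (simp add: M_def power_divide)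
      also have "ln \<dots> = -2" by (simp add: ln_realpow ln_div)
      finally show ?thesis by simp
    qed
    finally show ?thesis .
  qed
  moreover have "0 \<le> trunc_log ((cmod z)\<^sup>2 / R\<^sup>2)"
    using False R by (intro trunc_log_nonneg) auto
  ultimately have "green_profile R \<delta> ((cmod z)\<^sup>2) \<le> ln (R\<^sup>2 / \<delta>\<^sup>2) - ln (M\<^sup>2 / \<delta>\<^sup>2)"
    unfolding green_profile_def by simp
  also have "\<dots> = 2 * ln (R / M)" using assms R M by (simp add: ln_div ln_realpow)
  also have "\<dots> \<le> 2 * log_kernel R ?\<eta> (cmod z)" by (simp add: log_kernel_def M_def)
  also have "log_kernel R ?\<eta> (cmod z) \<le> log_kernel R ?\<eta> (Re z)"
    using R assms abs_Re_le_cmod[of z] by (intro log_kernel_antimono) auto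
  finally show ?thesis by simp
qed

section \<open>A cutoff with bounded Laplacian\<close>

lemma DERIV_max_power:
  "((\<lambda>x::real. (max 0 x) ^ Suc (Suc n)) has_real_derivative real (Suc (Suc n)) * (max 0 x) ^ Suc n) (at x)"
proof -
  have "((\<lambda>x::real. if x < 0 then 0 else x ^ Suc (Suc n)) has_real_derivative
      (if x < 0 then 0 else real (Suc (Suc n)) * x ^ Suc n)) (at x)"
  proof (rule DERIV_if_less)
    show "((\<lambda>x::real. x ^ Suc (Suc n)) has_real_derivative real (Suc (Suc n)) * x ^ Suc n) (at x)" for x
      using DERIV_pow[of "Suc (Suc n)" x UNIV] by simp
  qed auto
  moreover have "(\<lambda>x::real. if x < 0 then 0 else x ^ Suc (Suc n)) = (\<lambda>x. (max 0 x) ^ Suc (Suc n))"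
    by (auto simp: max_def)
  ultimately show ?thesis by (auto simp: max_def split: if_splits)
qed

text \<open>The cube gives two continuous derivatives across |z| = \<rho>, which the expansion of
  circle means requires.\<close>

definition cutoff :: "real \<Rightarrow> complex \<Rightarrow> real" where
  "cutoff \<rho> z = (max 0 (1 - (cmod z)\<^sup>2 / \<rho>\<^sup>2)) ^ 3"

text \<open>For small \<open>s\<close> the rescaled difference is within 1 of minus the Laplacian of
  the cutoff, a continuous function of compact support.\<close>

lemma cutoff_mean_bound:
  assumes "0 < \<rho>"
  shows "\<exists>s0>0. \<exists>C. \<forall>s z. 0 < s \<longrightarrow> s < s0 \<longrightarrow> \<bar>(cutoff \<rho> z - circle_mean s (cutoff \<rho>) z) * 4 / s\<^sup>2\<bar> \<le> C"
proof -
  define F where "F q = (max 0 (1 - q / \<rho>\<^sup>2)) ^ Suc (Suc 1)" for q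
  define F' where "F' q = - (3 / \<rho>\<^sup>2 * (max 0 (1 - q / \<rho>\<^sup>2)) ^ Suc (Suc 0))" for q
  define F'' where "F'' q = 6 / (\<rho>\<^sup>2 * \<rho>\<^sup>2) * max 0 (1 - q / \<rho>\<^sup>2)" for q
  have d: "((\<lambda>q. (max 0 (1 - q / \<rho>\<^sup>2)) ^ Suc (Suc n)) has_real_derivative
    real (Suc (Suc n)) * (max 0 (1 - q / \<rho>\<^sup>2)) ^ Suc n * (- (1 / \<rho>\<^sup>2))) (at q)" for n q
  proof (rule DERIV_chain2[OF DERIV_max_power])
    show "((\<lambda>q. 1 - q / \<rho>\<^sup>2) has_real_derivative - (1 / \<rho>\<^sup>2)) (at q)"
      by (rule DERIV_cong[OF DERIV_diff[OF DERIV_const DERIV_cdivide[OF DERIV_ident]]]) simp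
  qed
  have 1: "(F has_real_derivative F' q) (at q)" for q
    unfolding F_def[abs_def] F'_def using d[of 1 q] by (simp add: numeral_3_eq_3)
  have 2: "(F' has_real_derivative F'' q) (at q)" for q
    unfolding F'_def[abs_def] F''_def
    by (rule DERIV_cong[OF DERIV_minus[OF DERIV_cmult[OF d]]]) simp
  have 3: "continuous_on UNIV F''"
    unfolding F''_def[abs_def] by (intro continuous_intros) (use assms in auto)
  have cF': "continuous_on UNIV F'"
    using 2 by (intro continuous_at_imp_continuous_on ballI) (auto intro: DERIV_isCont)
  have 4: "F' q = 0 \<and> F'' q = 0" if "\<rho>\<^sup>2 \<le> q" for q
    using that assms by (simp add: F'_def F''_def field_simps)
  obtain s0 where s0: "0 < s0" "\<And>s z. 0 < s \<Longrightarrow> s < s0 \<Longrightarrow>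
    \<bar>(F ((cmod z)\<^sup>2) - circle_mean s (\<lambda>w. F ((cmod w)\<^sup>2)) z) * 4 / s\<^sup>2
      + 4 * ((cmod z)\<^sup>2 * F'' ((cmod z)\<^sup>2) + F' ((cmod z)\<^sup>2))\<bar> \<le> 1"
    using radial_mean_expansion[OF 1 2 3 assms 4, of 1] by auto
  have "compact ((\<lambda>q. 4 * (q * F'' q + F' q)) ` {0..\<rho>\<^sup>2})"
    by (intro compact_continuous_image continuous_intros continuous_on_subset[OF 3] continuous_on_subset[OF cF']) auto
  then obtain C where C: "\<And>q. q \<in> {0..\<rho>\<^sup>2} \<Longrightarrow> \<bar>4 * (q * F'' q + F' q)\<bar> \<le> C"
    unfolding real_norm_def[symmetric] by (blast dest!: compact_imp_bounded bounded_iff[THEN iffD1])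
  have "\<bar>4 * (q * F'' q + F' q)\<bar> \<le> \<bar>C\<bar>" if "0 \<le> q" for q
    using C[of q] 4[of q] that by (cases "q \<le> \<rho>\<^sup>2") auto
  note C' = this[OF zero_le_power2]
  have eq: "cutoff \<rho> = (\<lambda>w. F ((cmod w)\<^sup>2))"
    by (auto simp: cutoff_def F_def numeral_3_eq_3)
  have "\<bar>(cutoff \<rho> z - circle_mean s (cutoff \<rho>) z) * 4 / s\<^sup>2\<bar> \<le> 1 + \<bar>C\<bar>" if "0 < s" "s < s0" for s z
    using s0(2)[OF that, of z] C'[of "cmod z"] unfolding eq by linarith
  then show ?thesis using s0(1) by blast
qed

section \<open>Local integrability of subharmonic functions\<close>

lemma nn_integral_periodic_shift:
  fixes p :: "real \<Rightarrow> ennreal"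
  assumes [measurable]: "p \<in> borel_measurable borel" and per: "\<And>\<theta>. p (\<theta> + T) = p \<theta>"
    and \<alpha>: "0 \<le> \<alpha>" "\<alpha> \<le> T"
  shows "(\<integral>\<^sup>+\<theta>\<in>{0..T}. p (\<theta> + \<alpha>) \<partial>lborel) = (\<integral>\<^sup>+\<theta>\<in>{0..T}. p \<theta> \<partial>lborel)"
proof -
  have [measurable]: "(\<lambda>\<theta>. p \<theta> * indicator S \<theta>) \<in> borel_measurable borel" if "S \<in> sets borel" for S
    using that by measurable
  have "(\<integral>\<^sup>+\<theta>\<in>{0..T}. p (\<theta> + \<alpha>) \<partial>lborel) = (\<integral>\<^sup>+\<theta>. p (\<theta> + \<alpha>) * indicator {\<alpha>..T + \<alpha>} (\<theta> + \<alpha>) \<partial>lborel)"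
    by (intro nn_integral_cong) (auto split: split_indicator)
  also have "\<dots> = (\<integral>\<^sup>+\<theta>\<in>{\<alpha>..T + \<alpha>}. p \<theta> \<partial>lborel)"
    by (rule nn_integral_real_shift[of "\<lambda>\<theta>. p \<theta> * indicator {\<alpha>..T + \<alpha>} \<theta>"]) measurable
  also have "\<dots> = (\<integral>\<^sup>+\<theta>. p \<theta> * indicator {\<alpha>..<T} \<theta> + p \<theta> * indicator {T..T + \<alpha>} \<theta> \<partial>lborel)"
    using \<alpha> by (intro nn_integral_cong) (auto split: split_indicator)
  also have "\<dots> = (\<integral>\<^sup>+\<theta>\<in>{\<alpha>..<T}. p \<theta> \<partial>lborel) + (\<integral>\<^sup>+\<theta>\<in>{T..T + \<alpha>}. p \<theta> \<partial>lborel)"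
    by (subst nn_integral_add) auto
  also have "(\<integral>\<^sup>+\<theta>\<in>{T..T + \<alpha>}. p \<theta> \<partial>lborel) = (\<integral>\<^sup>+\<theta>. p (\<theta> + T) * indicator {T..T + \<alpha>} (\<theta> + T) \<partial>lborel)"
    by (rule nn_integral_real_shift[of "\<lambda>\<theta>. p \<theta> * indicator {T..T + \<alpha>} \<theta>", symmetric]) measurable
  also have "\<dots> = (\<integral>\<^sup>+\<theta>\<in>{0..\<alpha>}. p \<theta> \<partial>lborel)"
    by (intro nn_integral_cong) (auto simp: per split: split_indicator)
  also have "\<dots> = (\<integral>\<^sup>+\<theta>\<in>{0..<\<alpha>}. p \<theta> \<partial>lborel)"
    using AE_lborel_singleton[of \<alpha>] by (intro nn_integral_cong_AE) (auto elim!: eventually_mono split: split_indicator)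
  also have "(\<integral>\<^sup>+\<theta>\<in>{\<alpha>..<T}. p \<theta> \<partial>lborel) = (\<integral>\<^sup>+\<theta>\<in>{\<alpha>..T}. p \<theta> \<partial>lborel)"
    using AE_lborel_singleton[of T] by (intro nn_integral_cong_AE) (auto elim!: eventually_mono split: split_indicator)
  also have "(\<integral>\<^sup>+\<theta>\<in>{\<alpha>..T}. p \<theta> \<partial>lborel) + (\<integral>\<^sup>+\<theta>\<in>{0..<\<alpha>}. p \<theta> \<partial>lborel)
      = (\<integral>\<^sup>+\<theta>. p \<theta> * indicator {\<alpha>..T} \<theta> + p \<theta> * indicator {0..<\<alpha>} \<theta> \<partial>lborel)"
    by (subst nn_integral_add) auto
  also have "\<dots> = (\<integral>\<^sup>+\<theta>\<in>{0..T}. p \<theta> \<partial>lborel)"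
    using \<alpha> by (intro nn_integral_cong) (auto split: split_indicator)
  finally show ?thesis .
qed

text \<open>Averaging over rotations turns the inequality on circles into one on discs.\<close>
lemma circle_means_imp_disc_integral_finite:
  fixes g :: "complex \<Rightarrow> ennreal"
  assumes [measurable]: "g \<in> borel_measurable borel"
    and mean: "\<And>s. 0 < s \<Longrightarrow> s < r \<Longrightarrow> (\<integral>\<^sup>+\<theta>\<in>{0..2*pi}. g (z + of_real s * cis \<theta>) \<partial>lborel) \<le> c"
    and c: "c < \<infinity>"
  shows "(\<integral>\<^sup>+w\<in>ball z r. g w \<partial>lborel) < \<infinity>"
proof -
  define G where "G w = g (z + w) * indicator (ball 0 r) w" for w
  have [measurable]: "ball (0::complex) r \<in> sets borel" "ball z r \<in> sets borel" by simp_all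
  have [measurable]: "G \<in> borel_measurable borel" unfolding G_def by measurable
  have "(\<integral>\<^sup>+w\<in>ball z r. g w \<partial>lborel) = (\<integral>\<^sup>+w. g (z + w) * indicator (ball z r) (z + w) \<partial>lborel)"
    by (subst lborel_distr_plus[of z, symmetric], subst nn_integral_distr) auto
  also have "\<dots> = (\<integral>\<^sup>+w. G w \<partial>lborel)"
    by (intro nn_integral_cong) (auto simp: G_def dist_norm split: split_indicator)
  finally have eq: "(\<integral>\<^sup>+w\<in>ball z r. g w \<partial>lborel) = (\<integral>\<^sup>+w. G w \<partial>lborel)" .
  \<comment> \<open>The half turn has to be left out here; it is a single angle, hence negligible in
    the integral over \<theta>.\<close>
  have rot: "(\<integral>\<^sup>+w. G w \<partial>lborel) = (\<integral>\<^sup>+w. G (cis \<theta> * w) \<partial>lborel)" if "\<theta> \<in> {0..2*pi} - {pi}" for \<theta>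
  proof (rule nn_integral_complex_rotate[symmetric])
    show "cis \<theta> \<noteq> -1"
    proof
      assume "cis \<theta> = -1"
      then have "cos \<theta> = -1" by (metis cis.sel(1) uminus_complex.sel(1) one_complex.sel(1))
      then have "cos (\<theta> - pi) = 1" by simp
      then obtain n :: int where n: "\<theta> - pi = real_of_int n * 2 * pi" unfolding cos_one_2pi_int by blast
      moreover have "\<bar>\<theta> - pi\<bar> \<le> pi" using that by auto
      ultimately have "\<bar>real_of_int n\<bar> * 2 * pi \<le> pi" by (simp add: abs_mult)
      then have "\<bar>real_of_int n\<bar> < 1" by simp
      then have "n = 0" by linarith
      then show False using n that by simp
    qed
  qed auto
  have circ: "(\<integral>\<^sup>+\<theta>\<in>{0..2*pi}. G (cis \<theta> * w) \<partial>lborel) \<le> c * indicator (ball 0 r) w" if "w \<noteq> 0" for w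
  proof (cases "w \<in> ball 0 r")
    case True
    define \<alpha> where "\<alpha> = Arg2pi w"
    have \<alpha>: "0 \<le> \<alpha>" "\<alpha> \<le> 2 * pi" using Arg2pi[of w] by (auto simp: \<alpha>_def)
    have w: "w = of_real (cmod w) * cis \<alpha>"
      using Arg2pi[of w] by (simp add: \<alpha>_def is_Arg_def cis_conv_exp)
    have p: "(\<lambda>\<theta>. g (z + of_real (cmod w) * cis \<theta>)) \<in> borel_measurable borel"
      by (intro measurable_compose[OF _ assms(1)] borel_measurable_continuous_onI continuous_intros)
    have "(\<integral>\<^sup>+\<theta>\<in>{0..2*pi}. G (cis \<theta> * w) \<partial>lborel) = (\<integral>\<^sup>+\<theta>\<in>{0..2*pi}. g (z + of_real (cmod w) * cis (\<theta> + \<alpha>)) \<partial>lborel)"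
    proof (intro nn_integral_cong)
      fix \<theta> :: real
      have "cis \<theta> * w = of_real (cmod w) * cis (\<theta> + \<alpha>)"
        by (subst w) (simp add: cis_mult[symmetric])
      moreover have "cis \<theta> * w \<in> ball 0 r" using True by (simp add: norm_mult)
      ultimately show "G (cis \<theta> * w) * indicator {0..2*pi} \<theta>
          = g (z + of_real (cmod w) * cis (\<theta> + \<alpha>)) * indicator {0..2*pi} \<theta>" by (simp add: G_def)
    qed
    also have "\<dots> = (\<integral>\<^sup>+\<theta>\<in>{0..2*pi}. g (z + of_real (cmod w) * cis \<theta>) \<partial>lborel)"
      by (rule nn_integral_periodic_shift[OF p _ \<alpha>]) (simp add: cis_mult[symmetric])
    also have "\<dots> \<le> c" using that True by (intro mean) auto
    finally show ?thesis using True by simp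
  next
    case False
    then have "G (cis \<theta> * w) = 0" for \<theta> by (simp add: G_def norm_mult)
    then show ?thesis by simp
  qed
  have meas: "(\<lambda>p. G (cis (fst p) * snd p)) \<in> borel_measurable (lborel \<Otimes>\<^sub>M lborel)"
  proof -
    have "(\<lambda>p::real \<times> complex. cis (fst p) * snd p) \<in> borel_measurable borel"
      by (intro borel_measurable_continuous_onI continuous_intros)
    from measurable_compose[OF this \<open>G \<in> borel_measurable borel\<close>] show ?thesis by (simp add: lborel_prod)
  qed
  have [measurable]: "(\<lambda>(\<theta>, w). G (cis \<theta> * w)) \<in> borel_measurable (lborel \<Otimes>\<^sub>M lborel)"
    using meas by (simp add: case_prod_unfold)
  have "ennreal (2 * pi) * (\<integral>\<^sup>+w. G w \<partial>lborel) = (\<integral>\<^sup>+\<theta>\<in>{0..2*pi}. (\<integral>\<^sup>+w. G w \<partial>lborel) \<partial>lborel)"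
    by (subst nn_integral_cmult_indicator) (auto simp: mult.commute)
  also have "\<dots> = (\<integral>\<^sup>+\<theta>\<in>{0..2*pi}. (\<integral>\<^sup>+w. G (cis \<theta> * w) \<partial>lborel) \<partial>lborel)"
    using AE_lborel_singleton[of pi]
    by (intro nn_integral_cong_AE, eventually_elim) (use rot in \<open>auto split: split_indicator\<close>)
  also have "\<dots> = (\<integral>\<^sup>+\<theta>. (\<integral>\<^sup>+w. G (cis \<theta> * w) * indicator {0..2*pi} \<theta> \<partial>lborel) \<partial>lborel)"
    by (intro nn_integral_cong) (auto split: split_indicator)
  also have "\<dots> = (\<integral>\<^sup>+w. (\<integral>\<^sup>+\<theta>\<in>{0..2*pi}. G (cis \<theta> * w) \<partial>lborel) \<partial>lborel)"
    by (rule lborel_pair.Fubini') measurable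
  also have "\<dots> \<le> (\<integral>\<^sup>+w. c * indicator (ball (0::complex) r) w \<partial>lborel)"
    using AE_lborel_singleton[of "0::complex"] circ by (intro nn_integral_mono_AE) (auto elim!: eventually_mono)
  also have "\<dots> = c * emeasure lborel (ball (0::complex) r)"
    by (subst nn_integral_cmult_indicator) auto
  also have "\<dots> < \<infinity>" using c emeasure_bounded_finite[OF bounded_ball, of "0::complex" r]
    by (auto simp: ennreal_mult_less_top)
  finally show ?thesis unfolding eq by (auto simp: ennreal_mult_less_top)
qed

section \<open>From subharmonic functions to nonnegative superharmonic ones\<close>

lemma subharmonic_measurable:
  assumes "subharmonic_on U \<phi>"
  shows "(\<lambda>z. if z \<in> U then \<phi> z else c) \<in> borel_measurable borel"
proof (rule borel_measurableI_less)
  fix y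
  have "open U" "open {z \<in> U. \<phi> z < y}" using assms by (auto simp: subharmonic_on_def)
  then have "{z \<in> U. \<phi> z < y} \<union> (if c < y then - U else {}) \<in> sets borel" by auto
  also have "{z \<in> U. \<phi> z < y} \<union> (if c < y then - U else {}) = {z \<in> space borel. (if z \<in> U then \<phi> z else c) < y}"
    by auto
  finally show "{z \<in> space borel. (if z \<in> U then \<phi> z else c) < y} \<in> sets borel" .
qed

lemma subharmonic_bounded_above:
  assumes "subharmonic_on U \<phi>" "compact K" "K \<subseteq> U"
  shows "\<exists>C::real. 0 < C \<and> (\<forall>z\<in>K. \<phi> z < ereal C)"
proof -
  have op: "open {z \<in> U. \<phi> z < ereal c}" for c using assms by (auto simp: subharmonic_on_def)
  have cov: "K \<subseteq> (\<Union>n::nat. {z \<in> U. \<phi> z < ereal (real n)})"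
  proof
    fix z assume "z \<in> K"
    then have "z \<in> U" "\<phi> z \<noteq> \<infinity>" using assms by (auto simp: subharmonic_on_def)
    then obtain n :: nat where "\<phi> z < ereal (real n)" using less_PInf_Ex_of_nat by blast
    then show "z \<in> (\<Union>n::nat. {z \<in> U. \<phi> z < ereal (real n)})" using \<open>z \<in> U\<close> by blast
  qed
  obtain F where F: "F \<subseteq> UNIV" "finite F" "K \<subseteq> (\<Union>n\<in>F. {z \<in> U. \<phi> z < ereal (real n)})"
    by (rule compactE_image[OF assms(2), of UNIV "\<lambda>n. {z \<in> U. \<phi> z < ereal (real n)}"]) (use op cov in auto)
  have "\<phi> z < ereal (real (Suc (Max F)))" if z: "z \<in> K" for z
  proof -
    obtain n where n: "n \<in> F" "\<phi> z < ereal (real n)" using F z by blast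
    then have "n \<le> Max F" using F by simp
    then show ?thesis using n(2) by (meson ereal_less_eq(3) le_Suc_eq of_nat_mono order_less_le_trans)
  qed
  then show ?thesis by (intro exI[of _ "real (Suc (Max F))"]) simp
qed

text \<open>The shift to C - \<phi> \<ge> 0 removes the difference of two possibly infinite
  integrals. Since \<phi> < C, the positive part \<open>P\<close> is finite; at a point with \<phi>
  finite the inequality then forces \<open>N\<close> to be finite, and the rest is arithmetic of
  reals.\<close>

lemma subharmonic_supermean:
  assumes sub: "subharmonic_on U \<phi>" and C: "0 < C" "\<And>w. w \<in> V \<Longrightarrow> \<phi> w < ereal C" and "V \<subseteq> U"
    and z: "cball z r \<subseteq> V" "0 < r"
  shows "(\<integral>\<^sup>+\<theta>\<in>{0..2*pi}. e2ennreal (ereal C - \<phi> (z + of_real r * cis \<theta>)) \<partial>lborel)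
    \<le> ennreal (2 * pi) * e2ennreal (ereal C - \<phi> z)"
proof (cases "\<phi> z = - \<infinity>")
  case True
  then show ?thesis by (simp add: e2ennreal_infty ennreal_mult_top)
next
  case False
  let ?c = "\<lambda>\<theta>. z + of_real r * cis \<theta>"
  have inV: "?c \<theta> \<in> V" for \<theta>
  proof -
    have "?c \<theta> \<in> cball z r" using z by (simp add: dist_norm norm_mult)
    then show ?thesis using z by blast
  qed
  have "z \<in> V" using z by auto
  then have "\<phi> z < ereal C" using C by simp
  then obtain x where x: "\<phi> z = ereal x" using False by (cases "\<phi> z") auto
  have [measurable]: "(\<lambda>\<theta>. \<phi> (?c \<theta>)) \<in> borel_measurable borel"
  proof -
    have "(\<lambda>\<theta>. if ?c \<theta> \<in> U then \<phi> (?c \<theta>) else 0) \<in> borel_measurable borel"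
      by (intro measurable_compose[OF _ subharmonic_measurable[OF sub, of 0]] borel_measurable_continuous_onI continuous_intros)
    moreover have "?c \<theta> \<in> U" for \<theta> using inV \<open>V \<subseteq> U\<close> by blast
    ultimately show ?thesis by simp
  qed
  define P where "P = (\<integral>\<^sup>+\<theta>\<in>{0..2*pi}. e2ennreal (\<phi> (?c \<theta>)) \<partial>lborel)"
  define N where "N = (\<integral>\<^sup>+\<theta>\<in>{0..2*pi}. e2ennreal (- \<phi> (?c \<theta>)) \<partial>lborel)"
  define G where "G = (\<integral>\<^sup>+\<theta>\<in>{0..2*pi}. e2ennreal (ereal C - \<phi> (?c \<theta>)) \<partial>lborel)"
  have le: "ereal (2 * pi) * \<phi> z \<le> enn2ereal P - enn2ereal N"
    using sub z \<open>V \<subseteq> U\<close> unfolding subharmonic_on_def P_def N_def by blast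
  \<comment> \<open>Written as a sum and not as a difference, the identity of the parts makes sense
    even where \<phi> = -\<infinity>.\<close>
  have pt: "e2ennreal (ereal C - \<phi> (?c \<theta>)) + e2ennreal (\<phi> (?c \<theta>)) = e2ennreal (- \<phi> (?c \<theta>)) + ennreal C" for \<theta>
  proof (cases "\<phi> (?c \<theta>)")
    case (real u)
    then have "u < C" using C(2)[OF inV, of \<theta>] by simp
    then show ?thesis
      using real C(1) by (cases "0 \<le> u") (auto simp: e2ennreal_neg ennreal_neg simp flip: ennreal.abs_eq ennreal_plus)
  qed (use C(2)[OF inV, of \<theta>] in auto)
  have sum: "G + P = N + ennreal (2 * pi * C)"
  proof -
    have "G + P = (\<integral>\<^sup>+\<theta>\<in>{0..2*pi}. (e2ennreal (ereal C - \<phi> (?c \<theta>)) + e2ennreal (\<phi> (?c \<theta>))) \<partial>lborel)"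
      unfolding G_def P_def by (subst nn_integral_add[symmetric]) (auto simp: distrib_right)
    also have "\<dots> = N + (\<integral>\<^sup>+\<theta>\<in>{0..2*pi}. ennreal C \<partial>lborel)"
      unfolding pt N_def by (subst nn_integral_add[symmetric]) (auto simp: distrib_right)
    also have "(\<integral>\<^sup>+\<theta>\<in>{0..2*pi}. ennreal C \<partial>lborel) = ennreal (2 * pi * C)"
      using C by (subst nn_integral_cmult_indicator) (auto simp: ennreal_mult mult.commute)
    finally show ?thesis .
  qed
  have "P \<le> (\<integral>\<^sup>+\<theta>\<in>{0..2*pi}. ennreal C \<partial>lborel)"
    unfolding P_def
  proof (intro nn_integral_mono mult_right_mono)
    fix \<theta> show "e2ennreal (\<phi> (?c \<theta>)) \<le> ennreal C"
      using C(2)[OF inV, of \<theta>] by (metis e2ennreal_mono ennreal.abs_eq less_imp_le e2ennreal_ereal)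
  qed simp
  also have "\<dots> < \<infinity>" by (subst nn_integral_cmult_indicator) (auto simp: ennreal_mult_less_top)
  finally obtain p where p: "P = ennreal p" "0 \<le> p" by (cases P) auto
  have "N \<noteq> \<infinity>" using le x p by auto
  then obtain n where n: "N = ennreal n" "0 \<le> n" by (cases N) auto
  have le': "2 * pi * x \<le> p - n" using le unfolding x p n using p n by simp
  have "G \<noteq> \<infinity>"
  proof
    assume "G = \<infinity>"
    with sum have "ennreal n + ennreal (2 * pi * C) = top" unfolding p n by simp
    then show False by (simp add: ennreal_add_eq_top)
  qed
  then obtain q where q: "G = ennreal q" "0 \<le> q" by (cases G) auto
  have "q + p = n + 2 * pi * C"
    using sum C unfolding p n q using p n q by (simp flip: ennreal_plus)
  then have "q \<le> 2 * pi * (C - x)" using le' by (simp add: algebra_simps)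
  then have "G \<le> ennreal (2 * pi * (C - x))" unfolding q by (rule ennreal_leI)
  also have "\<dots> = ennreal (2 * pi) * e2ennreal (ereal C - \<phi> z)"
    unfolding x by (simp add: ennreal_mult')
  finally show ?thesis unfolding G_def .
qed

text \<open>Outside \<open>U\<close> the value \<open>C\<close> is substituted, so the function
  vanishes there and is Borel on the whole plane.\<close>

definition defect :: "complex set \<Rightarrow> (complex \<Rightarrow> ereal) \<Rightarrow> real \<Rightarrow> complex \<Rightarrow> ennreal" where
  "defect U \<phi> C z = e2ennreal (ereal C - (if z \<in> U then \<phi> z else ereal C))"

lemma defect_measurable:
  assumes "subharmonic_on U \<phi>"
  shows "defect U \<phi> C \<in> borel_measurable borel"
proof -
  note [measurable] = subharmonic_measurable[OF assms, of "ereal C"]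
  show ?thesis unfolding defect_def[abs_def] by measurable
qed

lemma defect_supermean:
  assumes sub: "subharmonic_on U \<phi>" and C: "0 < C" "\<And>w. w \<in> V \<Longrightarrow> \<phi> w < ereal C" and "V \<subseteq> U"
    and z: "cball z r \<subseteq> V" "0 < r"
  shows "(\<integral>\<^sup>+\<theta>\<in>{0..2*pi}. defect U \<phi> C (z + of_real r * cis \<theta>) \<partial>lborel) \<le> ennreal (2 * pi) * defect U \<phi> C z"
proof -
  have "z + of_real r * cis \<theta> \<in> U" for \<theta>
  proof -
    have "z + of_real r * cis \<theta> \<in> cball z r" using z by (simp add: dist_norm norm_mult)
    then show ?thesis using z \<open>V \<subseteq> U\<close> by blast
  qed
  moreover have "z \<in> cball z r" using z by simp
  then have "z \<in> U" using z \<open>V \<subseteq> U\<close> by blast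
  ultimately show ?thesis using subharmonic_supermean[OF assms] by (simp add: defect_def)
qed

lemma defect_disc_integral_finite:
  assumes sub: "subharmonic_on U \<phi>" and C: "0 < C" "\<And>w. w \<in> cball z r \<Longrightarrow> \<phi> w < ereal C"
    and z: "cball z r \<subseteq> U" "0 < r" "\<phi> z \<noteq> -\<infinity>"
  shows "(\<integral>\<^sup>+w\<in>ball z r. defect U \<phi> C w \<partial>lborel) < \<infinity>"
proof (rule circle_means_imp_disc_integral_finite[where c="ennreal (2 * pi) * defect U \<phi> C z"])
  show "defect U \<phi> C \<in> borel_measurable borel" by (rule defect_measurable[OF sub])
  have "z \<in> U" "\<phi> z < ereal C" using z C(2)[of z] by auto
  then obtain x where "\<phi> z = ereal x" using z(3) by (cases "\<phi> z") auto
  then show "ennreal (2 * pi) * defect U \<phi> C z < \<infinity>"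
    using \<open>z \<in> U\<close> by (simp add: defect_def ennreal_mult_less_top)
  show "(\<integral>\<^sup>+\<theta>\<in>{0..2*pi}. defect U \<phi> C (z + of_real s * cis \<theta>) \<partial>lborel) \<le> ennreal (2 * pi) * defect U \<phi> C z"
    if "0 < s" "s < r" for s
    using that by (intro defect_supermean[OF sub C z(1)]) auto
qed

text \<open>In each component the closure of the set of finite points is relatively closed and open:
  a disc around a finite point close to a limit point carries an integrable defect, so \<phi> cannot
  be -\<infinity> on any nonempty open subset of it. The component condition in the definition
  supplies a first finite point.\<close>

lemma subharmonic_finite_dense:
  assumes sub: "subharmonic_on U \<phi>"
  shows "U \<subseteq> closure {w \<in> U. \<phi> w \<noteq> -\<infinity>}"
proof
  fix z assume "z \<in> U"
  let ?F = "{w \<in> U. \<phi> w \<noteq> -\<infinity>}"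
  have "open U" using sub by (simp add: subharmonic_on_def)
  have nbhd: "\<exists>r>0. ball x r \<subseteq> closure ?F" if x: "x \<in> U" "x \<in> closure ?F" for x
  proof -
    obtain e where e: "0 < e" "cball x e \<subseteq> U" using \<open>open U\<close> x(1) open_contains_cball by blast
    obtain C where C: "0 < C" "\<And>w. w \<in> cball x e \<Longrightarrow> \<phi> w < ereal C"
      using subharmonic_bounded_above[OF sub compact_cball e(2)] by blast
    define r where "r = e / 3"
    have "0 < r" using e by (simp add: r_def)
    then obtain w where w: "w \<in> ?F" "dist w x < r"
      using x(2) unfolding closure_approachable by blast
    have sub1: "cball w (2 * r) \<subseteq> cball x e"
    proof
      fix u assume "u \<in> cball w (2 * r)"
      then show "u \<in> cball x e" using w(2) dist_triangle[of x u w] by (simp add: r_def dist_commute)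
    qed
    have sub2: "ball x r \<subseteq> ball w (2 * r)"
    proof
      fix u assume "u \<in> ball x r"
      then show "u \<in> ball w (2 * r)" using w(2) dist_triangle[of w u x] by simp
    qed
    have fin: "(\<integral>\<^sup>+y\<in>ball w (2 * r). defect U \<phi> C y \<partial>lborel) < \<infinity>"
      using sub1 e C w unfolding r_def by (intro defect_disc_integral_finite[OF sub]) auto
    note [measurable] = defect_measurable[OF sub, of C]
    have [measurable]: "ball w (2 * r) \<in> sets borel" by simp
    have ae: "AE y in lborel. defect U \<phi> C y * indicator (ball w (2 * r)) y \<noteq> \<infinity>"
      using fin by (intro nn_integral_PInf_AE) auto
    have "y \<in> closure ?F" if y: "y \<in> ball x r" for y
    proof (rule ccontr)
      assume "y \<notin> closure ?F"
      then have "y \<in> - closure ?F \<inter> ball x r" using y by blast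
      moreover have "open (- closure ?F \<inter> ball x r)" by auto
      ultimately obtain d where d: "0 < d" "ball y d \<subseteq> - closure ?F \<inter> ball x r"
        using open_contains_ball by blast
      have "\<phi> u = -\<infinity>" "u \<in> U" "u \<in> ball w (2 * r)" if "u \<in> ball y d" for u
      proof -
        have "u \<notin> closure ?F" and "u \<in> ball x r" using d(2) that by auto
        then have "u \<notin> ?F" using closure_subset[of ?F] by blast
        have "u \<in> cball x e" using \<open>u \<in> ball x r\<close> \<open>0 < r\<close> by (simp add: r_def)
        then show "u \<in> U" using e(2) by blast
        show "u \<in> ball w (2 * r)" using \<open>u \<in> ball x r\<close> sub2 by blast
        show "\<phi> u = -\<infinity>" using \<open>u \<notin> ?F\<close> \<open>u \<in> U\<close> by blast
      qed
      then have "ball y d \<subseteq> {u. \<not> defect U \<phi> C u * indicator (ball w (2 * r)) u \<noteq> \<infinity>}"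
        by (auto simp: defect_def)
      moreover obtain N where N: "{u \<in> space lborel. \<not> defect U \<phi> C u * indicator (ball w (2 * r)) u \<noteq> \<infinity>} \<subseteq> N"
        "emeasure lborel N = 0" "N \<in> sets lborel" using ae by (rule AE_E)
      ultimately have "ball y d \<subseteq> N" by auto
      then have "emeasure lborel (ball y d) = 0" using N emeasure_mono[of "ball y d" N lborel] by simp
      then have "ball y d \<in> null_sets lborel" by (auto simp: null_sets_def)
      then have "negligible (ball y d)" by (simp add: negligible_iff_null_sets null_sets_completionI)
      moreover have "ball y d \<noteq> {}" using d(1) by simp
      ultimately show False using open_not_negligible[OF open_ball] by blast
    qed
    then show ?thesis using e unfolding r_def by (intro exI[of _ "e/3"]) auto
  qed
  let ?Cz = "connected_component_set U z"
  have comp: "?Cz \<in> components U" using \<open>z \<in> U\<close> by (auto simp: components_def)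
  have "\<forall>C\<in>components U. \<exists>z\<in>C. \<phi> z \<noteq> -\<infinity>"
    using sub unfolding subharmonic_on_def by (elim conjE)
  from this[rule_format, OF comp] obtain w where w: "w \<in> ?Cz" "\<phi> w \<noteq> -\<infinity>" by (rule bexE)
  have CU: "?Cz \<subseteq> U" by (rule connected_component_subset)
  have "openin (top_of_set ?Cz) (?Cz \<inter> closure ?F)"
  proof -
    have "\<exists>r>0. ball x r \<inter> ?Cz \<subseteq> ?Cz \<inter> closure ?F" if "x \<in> ?Cz \<inter> closure ?F" for x
    proof -
      from that CU have "x \<in> U" "x \<in> closure ?F" by blast+
      from nbhd[OF this] show ?thesis by blast
    qed
    then show ?thesis unfolding openin_contains_ball by simp
  qed
  moreover have "closedin (top_of_set ?Cz) (?Cz \<inter> closure ?F)"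
    by (rule closedin_closed_Int) simp
  moreover have "w \<in> ?F" using w CU by blast
  then have "w \<in> ?Cz \<inter> closure ?F" using w closure_subset[of ?F] by blast
  moreover have "connected ?Cz" by (rule connected_connected_component)
  ultimately have "?Cz \<inter> closure ?F = ?Cz"
    unfolding connected_clopen by (metis empty_iff)
  moreover have "z \<in> ?Cz" using \<open>z \<in> U\<close> by simp
  ultimately show "z \<in> closure ?F" by blast
qed

text \<open>At the centre \<open>z0\<close> itself \<phi> may be -\<infinity>, so the integral is
  taken over a disc around a nearby finite point that still covers a disc around
  \<open>z0\<close>.\<close>

lemma subharmonic_locally_integrable:
  assumes sub: "subharmonic_on U \<phi>" and z0: "z0 \<in> U"
  shows "\<exists>\<rho>>0. \<exists>C>0. cball z0 \<rho> \<subseteq> U \<and> (\<forall>w\<in>cball z0 \<rho>. \<phi> w < ereal C) \<and>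
    (\<integral>\<^sup>+w\<in>ball z0 \<rho>. defect U \<phi> C w \<partial>lborel) < \<infinity>"
proof -
  have "open U" using sub by (simp add: subharmonic_on_def)
  obtain e where e: "0 < e" "cball z0 e \<subseteq> U" using \<open>open U\<close> z0 open_contains_cball by blast
  obtain C where C: "0 < C" "\<And>w. w \<in> cball z0 e \<Longrightarrow> \<phi> w < ereal C"
    using subharmonic_bounded_above[OF sub compact_cball e(2)] by blast
  define r where "r = e / 3"
  have r: "0 < r" "cball z0 r \<subseteq> cball z0 e" using e unfolding r_def by (auto intro!: subset_cball)
  have "z0 \<in> closure {w \<in> U. \<phi> w \<noteq> -\<infinity>}" using subharmonic_finite_dense[OF sub] z0 by blast
  then obtain w where w: "w \<in> U" "\<phi> w \<noteq> -\<infinity>" "dist w z0 < r"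
    using r(1) unfolding closure_approachable by blast
  have sub1: "cball w (2 * r) \<subseteq> cball z0 e"
  proof
    fix u assume "u \<in> cball w (2 * r)"
    then show "u \<in> cball z0 e" using w(3) dist_triangle[of z0 u w] by (simp add: r_def dist_commute)
  qed
  have sub2: "ball z0 r \<subseteq> ball w (2 * r)"
  proof
    fix u assume "u \<in> ball z0 r"
    then show "u \<in> ball w (2 * r)" using w(3) dist_triangle[of w u z0] by simp
  qed
  have "(\<integral>\<^sup>+y\<in>ball z0 r. defect U \<phi> C y \<partial>lborel) \<le> (\<integral>\<^sup>+y\<in>ball w (2 * r). defect U \<phi> C y \<partial>lborel)"
    using sub2 by (intro nn_integral_mono) (auto split: split_indicator)
  also have "\<dots> < \<infinity>"
    using sub1 e C w r by (intro defect_disc_integral_finite[OF sub]) auto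
  finally show ?thesis using r e C by (intro exI[of _ r] conjI exI[of _ C]) auto
qed

section \<open>Riesz densities of positive superharmonic functions\<close>

lemma integral_complex_shift:
  fixes f :: "complex \<Rightarrow> real"
  assumes [measurable]: "f \<in> borel_measurable borel"
  shows "(LBINT w. f (w + a)) = (LBINT w. f w)"
  by (subst lborel_distr_plus[of a, symmetric], subst integral_distr) (auto simp: add.commute)

lemma nn_integral_complex_shift:
  fixes f :: "complex \<Rightarrow> ennreal"
  assumes [measurable]: "f \<in> borel_measurable borel"
  shows "(\<integral>\<^sup>+w. f (w + a) \<partial>lborel) = (\<integral>\<^sup>+w. f w \<partial>lborel)"
  by (subst lborel_distr_plus[of a, symmetric], subst nn_integral_distr) (auto simp: add.commute)

text \<open>By translation invariance every displaced copy of \<psi> has the same integral of its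
  modulus; this licenses the exchange of integrals in the duality below.\<close>

lemma circle_kernel_integrable:
  fixes f \<psi> :: "complex \<Rightarrow> real"
  assumes [measurable]: "f \<in> borel_measurable borel" "\<psi> \<in> borel_measurable borel"
    and bd: "\<And>w. \<bar>f w\<bar> \<le> B" and \<psi>: "integrable lborel \<psi>"
  shows "integrable (lborel \<Otimes>\<^sub>M lborel) (\<lambda>(w, \<theta>). f (z - w) * \<psi> (w + of_real s * cis \<theta>) * indicator {0..2*pi} \<theta>)"
proof (rule integrableI_bounded)
  have c [measurable]: "(\<lambda>p::complex \<times> real. fst p + of_real s * cis (snd p)) \<in> borel_measurable (borel \<Otimes>\<^sub>M borel)"
    unfolding borel_prod by (intro borel_measurable_continuous_onI continuous_intros)
  have [measurable]: "(\<lambda>p::complex \<times> real. \<psi> (fst p + of_real s * cis (snd p))) \<in> borel_measurable (borel \<Otimes>\<^sub>M borel)"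
    by (rule measurable_compose[OF c assms(2)])
  show m: "(\<lambda>(w, \<theta>). f (z - w) * \<psi> (w + of_real s * cis \<theta>) * indicator {0..2*pi} \<theta>) \<in> borel_measurable (lborel \<Otimes>\<^sub>M lborel)"
    unfolding case_prod_unfold by measurable
  have [measurable]: "(\<lambda>(w, \<theta>). ennreal \<bar>\<psi> (w + of_real s * cis \<theta>)\<bar>) \<in> borel_measurable (lborel \<Otimes>\<^sub>M lborel)"
    unfolding case_prod_unfold by measurable
  have "0 \<le> B" using bd[of 0] by linarith
  have "(\<integral>\<^sup>+p. ennreal (norm (case p of (w, \<theta>) \<Rightarrow> f (z - w) * \<psi> (w + of_real s * cis \<theta>) * indicator {0..2*pi} \<theta>)) \<partial>(lborel \<Otimes>\<^sub>M lborel))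
    \<le> (\<integral>\<^sup>+p. (case p of (w, \<theta>) \<Rightarrow> ennreal B * (ennreal \<bar>\<psi> (w + of_real s * cis \<theta>)\<bar> * indicator {0..2*pi} \<theta>)) \<partial>(lborel \<Otimes>\<^sub>M lborel))"
    by (intro nn_integral_mono) (use bd \<open>0 \<le> B\<close> in \<open>auto split: split_indicator simp: abs_mult simp flip: ennreal_mult intro!: ennreal_leI mult_right_mono\<close>)
  also have "\<dots> = (\<integral>\<^sup>+w. \<integral>\<^sup>+\<theta>. ennreal B * (ennreal \<bar>\<psi> (w + of_real s * cis \<theta>)\<bar> * indicator {0..2*pi} \<theta>) \<partial>lborel \<partial>lborel)"
    by (subst lborel.nn_integral_fst[symmetric]) (auto simp: case_prod_unfold)
  also have "\<dots> = (\<integral>\<^sup>+\<theta>. \<integral>\<^sup>+w. ennreal B * (ennreal \<bar>\<psi> (w + of_real s * cis \<theta>)\<bar> * indicator {0..2*pi} \<theta>) \<partial>lborel \<partial>lborel)"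
    by (rule lborel_pair.Fubini'[symmetric]) measurable
  also have "\<dots> = (\<integral>\<^sup>+\<theta>. (ennreal B * (\<integral>\<^sup>+w. ennreal \<bar>\<psi> w\<bar> \<partial>lborel)) * indicator {0..2*pi} \<theta> \<partial>lborel)"
  proof (intro nn_integral_cong)
    fix \<theta> :: real
    show "(\<integral>\<^sup>+w. ennreal B * (ennreal \<bar>\<psi> (w + of_real s * cis \<theta>)\<bar> * indicator {0..2*pi} \<theta>) \<partial>lborel)
      = (ennreal B * (\<integral>\<^sup>+w. ennreal \<bar>\<psi> w\<bar> \<partial>lborel)) * indicator {0..2*pi} \<theta>"
      using nn_integral_complex_shift[of "\<lambda>w. ennreal \<bar>\<psi> w\<bar>" "of_real s * cis \<theta>"]
      by (simp add: nn_integral_cmult nn_integral_multc mult.assoc)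
  qed
  also have "\<dots> = (ennreal B * (\<integral>\<^sup>+w. ennreal \<bar>\<psi> w\<bar> \<partial>lborel)) * ennreal (2 * pi)"
    by (subst nn_integral_cmult_indicator) auto
  also have "\<dots> < \<infinity>"
    using \<psi> by (auto simp: integrable_iff_bounded ennreal_mult_less_top)
  finally show "(\<integral>\<^sup>+p. ennreal (norm (case p of (w, \<theta>) \<Rightarrow> f (z - w) * \<psi> (w + of_real s * cis \<theta>) * indicator {0..2*pi} \<theta>)) \<partial>(lborel \<Otimes>\<^sub>M lborel)) < \<infinity>" .
qed

text \<open>For each fixed angle a translation of the plane moves the displacement from one factor
  to the other; in the convolution form f(z - w) it keeps its sign, so both sides use the same
  mean.\<close>

lemma circle_mean_adjoint:
  fixes f \<psi> :: "complex \<Rightarrow> real"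
  assumes f [measurable]: "f \<in> borel_measurable borel" and \<psi>m [measurable]: "\<psi> \<in> borel_measurable borel"
    and bd: "\<And>w. \<bar>f w\<bar> \<le> B" and \<psi>: "integrable lborel \<psi>"
  shows "integrable lborel (\<lambda>w. f (z - w) * circle_mean s \<psi> w)"
    and "(LBINT w. f (z - w) * circle_mean s \<psi> w) = (LBINT w. \<psi> w * circle_mean s f (z - w))"
proof -
  let ?H = "\<lambda>w \<theta>. f (z - w) * \<psi> (w + of_real s * cis \<theta>) * indicator {0..2*pi} \<theta>"
  let ?K = "\<lambda>w \<theta>. \<psi> w * f (z - w + of_real s * cis \<theta>) * indicator {0..2*pi} \<theta>"
  have H: "integrable (lborel \<Otimes>\<^sub>M lborel) (\<lambda>(w, \<theta>). ?H w \<theta>)"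
    by (rule circle_kernel_integrable[OF f \<psi>m bd \<psi>])
  have eqH: "(LBINT \<theta>. ?H w \<theta>) = 2 * pi * (f (z - w) * circle_mean s \<psi> w)" for w
  proof -
    have "(LBINT \<theta>. ?H w \<theta>) = (LBINT \<theta>. f (z - w) * (indicator {0..2*pi} \<theta> * \<psi> (w + of_real s * cis \<theta>)))"
      by (simp add: mult_ac)
    then show ?thesis unfolding circle_mean_def set_lebesgue_integral_def integral_mult_right_zero by simp
  qed
  have eqK: "(LBINT \<theta>. ?K w \<theta>) = 2 * pi * (\<psi> w * circle_mean s f (z - w))" for w
  proof -
    have "(LBINT \<theta>. ?K w \<theta>) = (LBINT \<theta>. \<psi> w * (indicator {0..2*pi} \<theta> * f (z - w + of_real s * cis \<theta>)))"
      by (simp add: mult_ac)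
    then show ?thesis unfolding circle_mean_def set_lebesgue_integral_def integral_mult_right_zero by simp
  qed
  have "integrable lborel (\<lambda>w. LBINT \<theta>. ?H w \<theta>)"
    using lborel_pair.integrable_fst'[OF H] by (simp add: case_prod_unfold)
  then show "integrable lborel (\<lambda>w. f (z - w) * circle_mean s \<psi> w)" unfolding eqH by simp
  have c [measurable]: "(\<lambda>p::complex \<times> real. z - fst p + of_real s * cis (snd p)) \<in> borel_measurable (borel \<Otimes>\<^sub>M borel)"
    unfolding borel_prod by (intro borel_measurable_continuous_onI continuous_intros)
  have [measurable]: "(\<lambda>p::complex \<times> real. f (z - fst p + of_real s * cis (snd p))) \<in> borel_measurable (borel \<Otimes>\<^sub>M borel)"
    by (rule measurable_compose[OF c f])
  have K: "integrable (lborel \<Otimes>\<^sub>M lborel) (\<lambda>(w, \<theta>). ?K w \<theta>)"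
  proof (rule Bochner_Integration.integrable_bound)
    \<comment> \<open>The dominating function is a kernel of the same kind, with \<open>f\<close>
      constant and radius 0.\<close>
    show "integrable (lborel \<Otimes>\<^sub>M lborel) (\<lambda>(w, \<theta>). B * \<psi> (w + of_real 0 * cis \<theta>) * indicator {0..2*pi} \<theta>)"
      by (rule circle_kernel_integrable[where B="\<bar>B\<bar>" and f="\<lambda>_. B"]) (use \<psi> in auto)
    show "(\<lambda>(w, \<theta>). ?K w \<theta>) \<in> borel_measurable (lborel \<Otimes>\<^sub>M lborel)"
      unfolding case_prod_unfold by measurable
    have "0 \<le> B" using bd[of 0] by linarith
    moreover have "\<bar>\<psi> w\<bar> * \<bar>f u\<bar> \<le> B * \<bar>\<psi> w\<bar>" for w u
      using mult_right_mono[OF bd[of u], of "\<bar>\<psi> w\<bar>"] by (simp add: mult.commute)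
    ultimately show "AE p in lborel \<Otimes>\<^sub>M lborel. norm (case p of (w, \<theta>) \<Rightarrow> ?K w \<theta>) \<le> norm (case p of (w, \<theta>) \<Rightarrow> B * \<psi> (w + of_real 0 * cis \<theta>) * indicator {0..2*pi} \<theta>)"
      by (intro AE_I2) (auto simp: abs_mult split: split_indicator)
  qed
  have "2 * pi * (LBINT w. f (z - w) * circle_mean s \<psi> w) = (LBINT w. LBINT \<theta>. ?H w \<theta>)"
    unfolding eqH by simp
  also have "\<dots> = (LBINT \<theta>. LBINT w. ?H w \<theta>)"
    by (rule lborel_pair.Fubini_integral[symmetric, OF H])
  also have "\<dots> = (LBINT \<theta>. LBINT w. ?K w \<theta>)"
  proof (rule Bochner_Integration.integral_cong[OF refl])
    fix \<theta> :: real
    have "(LBINT w. ?K w \<theta>) = (LBINT w. ?K (w + of_real s * cis \<theta>) \<theta>)"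
      by (rule integral_complex_shift[symmetric]) measurable
    then show "(LBINT w. ?H w \<theta>) = (LBINT w. ?K w \<theta>)" by (simp add: algebra_simps)
  qed
  also have "\<dots> = (LBINT w. LBINT \<theta>. ?K w \<theta>)"
    by (rule lborel_pair.Fubini_integral[OF K])
  also have "\<dots> = 2 * pi * (LBINT w. \<psi> w * circle_mean s f (z - w))"
    unfolding eqK by simp
  finally show "(LBINT w. f (z - w) * circle_mean s \<psi> w) = (LBINT w. \<psi> w * circle_mean s f (z - w))"
    by simp
qed

lemma circle_mean_measurable:
  assumes "f \<in> borel_measurable borel"
  shows "circle_mean s f \<in> borel_measurable borel"
proof -
  have c: "(\<lambda>p::complex \<times> real. fst p + of_real s * cis (snd p)) \<in> borel_measurable (borel \<Otimes>\<^sub>M borel)"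
    unfolding borel_prod by (intro borel_measurable_continuous_onI continuous_intros)
  have [measurable]: "(\<lambda>p::complex \<times> real. f (fst p + of_real s * cis (snd p))) \<in> borel_measurable (borel \<Otimes>\<^sub>M borel)"
    by (rule measurable_compose[OF c assms])
  show ?thesis unfolding circle_mean_def[abs_def] set_lebesgue_integral_def by measurable
qed

lemma circle_mean_bound:
  assumes [measurable]: "f \<in> borel_measurable borel" and "\<And>w. \<bar>f w\<bar> \<le> B"
  shows "\<bar>circle_mean s f z\<bar> \<le> B"
proof -
  have c: "(\<lambda>\<theta>. z + of_real s * cis \<theta>) \<in> borel_measurable borel"
    by (intro borel_measurable_continuous_onI continuous_intros)
  have [measurable]: "(\<lambda>\<theta>. f (z + of_real s * cis \<theta>)) \<in> borel_measurable borel"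
    by (rule measurable_compose[OF c assms(1)])
  have i: "integrable lborel (\<lambda>\<theta>. B * indicator {0..2*pi} \<theta>)" by simp
  have bd: "norm (indicator {0..2*pi} \<theta> *\<^sub>R f (z + of_real s * cis \<theta>)) \<le> B * indicator {0..2*pi} \<theta>" for \<theta>
    using assms(2) by (auto split: split_indicator)
  then have j: "integrable lborel (\<lambda>\<theta>. indicator {0..2*pi} \<theta> *\<^sub>R f (z + of_real s * cis \<theta>))"
    by (intro Bochner_Integration.integrable_bound[OF i] AE_I2) (auto intro: order_trans[OF _ abs_ge_self])
  have "norm (LINT \<theta>:{0..2*pi}|lborel. f (z + of_real s * cis \<theta>)) \<le> (LBINT \<theta>. B * indicator {0..2*pi} \<theta>)"
    unfolding set_lebesgue_integral_def
    by (rule Bochner_Integration.integral_norm_bound_integral[OF j i bd])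
  then show ?thesis unfolding circle_mean_def by (simp add: field_simps)
qed

lemma cutoff_meas [measurable]: "cutoff \<rho> \<in> borel_measurable borel"
  unfolding cutoff_def[abs_def] by measurable

lemma bump_meas [measurable]: "bump \<delta> \<in> borel_measurable borel"
  unfolding bump_def[abs_def] by measurable

lemma bump_nonneg: "0 \<le> bump \<delta> w" by (simp add: bump_def)

lemma bump_le: "bump \<delta> w \<le> 1 / \<delta>\<^sup>2"
  unfolding bump_def by (intro divide_right_mono power_le_one) auto

text \<open>On the disc of radius \<delta> / 2 the bump is at least (3/4)^2 / \<delta>^2; times the
  area, a quarter of that of the \<delta>-disc, this gives 9/64. It is only a lower bound for the
  integral of the bump.\<close>

definition bump_mass :: real where "bump_mass = 9 / 64 * unit_ball_vol 2"

lemma bump_mass_pos: "0 < bump_mass" by (simp add: bump_mass_def)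

lemma bump_integral_ge:
  assumes "0 < \<delta>"
  shows "integrable lborel (\<lambda>w. bump \<delta> (z - w))" "bump_mass \<le> (LBINT w. bump \<delta> (z - w))"
proof -
  have [measurable]: "ball z r \<in> sets borel" for r by simp
  have bi: "integrable lborel (\<lambda>w. indicator (ball z r) w * c :: real)" for r c
    using emeasure_bounded_finite[OF bounded_ball, of z r] by (intro integrable_mult_left) auto
  have zero: "bump \<delta> (z - w) = 0" if "w \<notin> ball z \<delta>" for w
  proof -
    have "\<delta>\<^sup>2 \<le> (cmod (z - w))\<^sup>2" using that assms by (intro power_mono) (auto simp: dist_norm)
    then show ?thesis using assms by (simp add: bump_def field_simps)
  qed
  show i: "integrable lborel (\<lambda>w. bump \<delta> (z - w))"
  proof (rule Bochner_Integration.integrable_bound[OF bi[of \<delta> "1 / \<delta>\<^sup>2"]])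
    show "AE w in lborel. norm (bump \<delta> (z - w)) \<le> norm (indicator (ball z \<delta>) w * (1 / \<delta>\<^sup>2))"
      using zero bump_le bump_nonneg by (intro AE_I2) (auto split: split_indicator)
  qed measurable
  have "bump_mass = (LBINT w. indicator (ball z (\<delta> / 2)) w * (9 / 16 / \<delta>\<^sup>2))"
    using assms by (simp add: bump_mass_def measure_def emeasure_ball field_simps power2_eq_square)
  also have "\<dots> \<le> (LBINT w. bump \<delta> (z - w))"
  proof (intro integral_mono bi i)
    fix w show "indicator (ball z (\<delta> / 2)) w * (9 / 16 / \<delta>\<^sup>2) \<le> bump \<delta> (z - w)"
    proof (cases "w \<in> ball z (\<delta> / 2)")
      case True
      then have "(cmod (z - w))\<^sup>2 \<le> (\<delta> / 2)\<^sup>2" by (intro power_mono) (auto simp: dist_norm)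
      then have "(cmod (z - w))\<^sup>2 / \<delta>\<^sup>2 \<le> 1 / 4" using assms by (simp add: field_simps power2_eq_square)
      then have *: "3 / 4 \<le> max 0 (1 - (cmod (z - w))\<^sup>2 / \<delta>\<^sup>2)" by linarith
      have "(3 / 4)\<^sup>2 / \<delta>\<^sup>2 \<le> bump \<delta> (z - w)" unfolding bump_def
        by (intro divide_right_mono power_mono[OF *]) auto
      then show ?thesis using True by (simp add: power2_eq_square)
    qed (simp add: bump_nonneg)
  qed
  finally show "bump_mass \<le> (LBINT w. bump \<delta> (z - w))" .
qed

text \<open>The radius 6R leaves room for nested discs: the curve stays within R of the centre, the
  support of the kernel around a point of it within 2R, the cutoff that bounds the mass within 4R,
  and for s < R nonnegativity of \<open>v s\<close> is available within 5R because circles of radius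
  \<open>s\<close> then remain in the large disc.\<close>

locale positive_superharmonic_disc =
  fixes g :: "complex \<Rightarrow> ennreal" and z0 :: complex and R :: real
  assumes g_meas [measurable]: "g \<in> borel_measurable borel" and R: "0 < R"
    and supermean: "\<And>z r. 0 < r \<Longrightarrow> cball z r \<subseteq> ball z0 (6 * R) \<Longrightarrow>
      (\<integral>\<^sup>+\<theta>\<in>{0..2*pi}. g (z + of_real r * cis \<theta>) \<partial>lborel) \<le> ennreal (2 * pi) * g z"
    and g_integrable: "(\<integral>\<^sup>+w\<in>ball z0 (6 * R). g w \<partial>lborel) < \<infinity>"
begin

text \<open>\<open>enn2real\<close> sends \<infinity> to 0, so this real-valued version lies below
  \<open>g\<close> everywhere and agrees with it almost everywhere on the disc.\<close>

definition \<psi> :: "complex \<Rightarrow> real" where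
  "\<psi> w = enn2real (g w) * indicator (ball z0 (6 * R)) w"

definition v :: "real \<Rightarrow> complex \<Rightarrow> real" where
  "v s w = (\<psi> w - circle_mean s \<psi> w) * 4 / s\<^sup>2"

lemma ball_meas [measurable]: "ball z0 r \<in> sets borel" by simp

lemma \<psi>_meas [measurable]: "\<psi> \<in> borel_measurable borel"
  unfolding \<psi>_def[abs_def] by measurable

lemma v_meas [measurable]: "v s \<in> borel_measurable borel"
proof -
  note [measurable] = circle_mean_measurable[OF \<psi>_meas, of s]
  show ?thesis unfolding v_def[abs_def] by measurable
qed

lemma \<psi>_nonneg [simp]: "0 \<le> \<psi> w" by (simp add: \<psi>_def)

lemma \<psi>_le: "ennreal (\<psi> w) \<le> g w"
  by (cases "g w") (auto simp: \<psi>_def split: split_indicator)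

lemma AE_\<psi>_eq: "AE w in lborel. w \<in> ball z0 (6 * R) \<longrightarrow> g w = ennreal (\<psi> w)"
proof -
  have "AE w in lborel. g w * indicator (ball z0 (6 * R)) w \<noteq> \<infinity>"
    using g_integrable by (intro nn_integral_PInf_AE) auto
  then show ?thesis
    by eventually_elim (auto simp: \<psi>_def top.not_eq_extremum split: split_indicator)
qed

lemma \<psi>_integrable: "integrable lborel \<psi>"
proof (rule integrableI_bounded)
  have "(\<integral>\<^sup>+w. ennreal (norm (\<psi> w)) \<partial>lborel) \<le> (\<integral>\<^sup>+w\<in>ball z0 (6 * R). g w \<partial>lborel)"
  proof (intro nn_integral_mono)
    fix w show "ennreal (norm (\<psi> w)) \<le> g w * indicator (ball z0 (6 * R)) w"
      using \<psi>_le[of w] by (auto simp: \<psi>_def split: split_indicator)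
  qed
  then show "(\<integral>\<^sup>+w. ennreal (norm (\<psi> w)) \<partial>lborel) < \<infinity>" using g_integrable by (rule le_less_trans)
qed simp

text \<open>The supermean inequality passes from \<open>g\<close> to \<psi> where the two agree.
  This is only almost everywhere: where \<open>g\<close> is infinite, \<psi> is 0 and the inequality
  for \<open>g\<close> says nothing.\<close>

lemma AE_v_nonneg:
  assumes s: "0 < s" "s < R"
  shows "AE w in lborel. w \<in> ball z0 (5 * R) \<longrightarrow> 0 \<le> v s w"
  using AE_\<psi>_eq
proof eventually_elim
  case (elim w)
  show ?case
  proof
    assume w: "w \<in> ball z0 (5 * R)"
    have sub: "cball w s \<subseteq> ball z0 (6 * R)"
    proof
      fix u assume "u \<in> cball w s"
      then show "u \<in> ball z0 (6 * R)" using w s dist_triangle[of z0 u w] by simp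
    qed
    have gw: "g w = ennreal (\<psi> w)" using elim w R by simp
    have c: "(\<lambda>\<theta>. w + of_real s * cis \<theta>) \<in> borel_measurable borel"
      by (intro borel_measurable_continuous_onI continuous_intros)
    have [measurable]: "(\<lambda>\<theta>. \<psi> (w + of_real s * cis \<theta>)) \<in> borel_measurable borel"
      by (rule measurable_compose[OF c \<psi>_meas])
    have le: "(\<integral>\<^sup>+\<theta>. ennreal (indicator {0..2*pi} \<theta> *\<^sub>R \<psi> (w + of_real s * cis \<theta>)) \<partial>lborel) \<le> ennreal (2 * pi * \<psi> w)"
    proof -
      have "(\<integral>\<^sup>+\<theta>. ennreal (indicator {0..2*pi} \<theta> *\<^sub>R \<psi> (w + of_real s * cis \<theta>)) \<partial>lborel)
          \<le> (\<integral>\<^sup>+\<theta>\<in>{0..2*pi}. g (w + of_real s * cis \<theta>) \<partial>lborel)"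
        using \<psi>_le by (intro nn_integral_mono) (auto split: split_indicator)
      also have "\<dots> \<le> ennreal (2 * pi) * g w" by (rule supermean[OF s(1) sub])
      also have "\<dots> = ennreal (2 * pi * \<psi> w)" unfolding gw by (simp add: ennreal_mult)
      finally show ?thesis .
    qed
    have "(LINT \<theta>:{0..2*pi}|lborel. \<psi> (w + of_real s * cis \<theta>))
        = enn2real (\<integral>\<^sup>+\<theta>. ennreal (indicator {0..2*pi} \<theta> *\<^sub>R \<psi> (w + of_real s * cis \<theta>)) \<partial>lborel)"
      unfolding set_lebesgue_integral_def by (rule integral_eq_nn_integral) auto
    also have "\<dots> \<le> 2 * pi * \<psi> w" using le by (rule enn2real_leI[rotated]) simp
    finally have "circle_mean s \<psi> w \<le> \<psi> w" unfolding circle_mean_def by (simp add: field_simps)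
    then show "0 \<le> v s w" unfolding v_def by simp
  qed
qed

text \<open>Self-adjointness of the circle mean transfers the difference quotient from \<psi>, which
  is merely integrable, to the test function, where Taylor expansion can be applied.\<close>

lemma v_pairing:
  assumes [measurable]: "f \<in> borel_measurable borel" and bd: "\<And>w. \<bar>f w\<bar> \<le> B"
  shows "integrable lborel (\<lambda>w. f (z - w) * v s w)"
    and "integrable lborel (\<lambda>w. \<psi> w * ((f (z - w) - circle_mean s f (z - w)) * 4 / s\<^sup>2))"
    and "(LBINT w. f (z - w) * v s w) = (LBINT w. \<psi> w * ((f (z - w) - circle_mean s f (z - w)) * 4 / s\<^sup>2))"
proof -
  note [measurable] = circle_mean_measurable[OF assms(1), of s]
  have m: "integrable lborel (\<lambda>w. \<psi> w * h (z - w))" if [measurable]: "h \<in> borel_measurable borel" and "\<And>w. \<bar>h w\<bar> \<le> B" for h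
  proof (rule Bochner_Integration.integrable_bound)
    show "integrable lborel (\<lambda>w. B * \<psi> w)" using \<psi>_integrable by simp
    have "0 \<le> B" using that(2)[of 0] by linarith
    moreover have "\<psi> w * \<bar>h u\<bar> \<le> B * \<psi> w" for w u
      using mult_right_mono[OF that(2)[of u], of "\<psi> w"] by (simp add: mult.commute)
    ultimately show "AE w in lborel. norm (\<psi> w * h (z - w)) \<le> norm (B * \<psi> w)"
      by (intro AE_I2) (auto simp: abs_mult)
  qed measurable
  have i1: "integrable lborel (\<lambda>w. \<psi> w * f (z - w))" by (rule m[OF assms])
  have i2: "integrable lborel (\<lambda>w. \<psi> w * circle_mean s f (z - w))"
    by (rule m) (use circle_mean_bound[OF assms] in auto)
  note adj = circle_mean_adjoint[OF assms(1) \<psi>_meas bd \<psi>_integrable, of z s]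
  have e1: "f (z - w) * v s w = (4 / s\<^sup>2) * (\<psi> w * f (z - w) - f (z - w) * circle_mean s \<psi> w)" for w
    unfolding v_def by (simp add: field_simps)
  have e2: "\<psi> w * ((f (z - w) - circle_mean s f (z - w)) * 4 / s\<^sup>2)
      = (4 / s\<^sup>2) * (\<psi> w * f (z - w) - \<psi> w * circle_mean s f (z - w))" for w
    by (simp add: field_simps)
  show "integrable lborel (\<lambda>w. f (z - w) * v s w)"
    unfolding e1 by (intro integrable_mult_right Bochner_Integration.integrable_diff i1 adj)
  show "integrable lborel (\<lambda>w. \<psi> w * ((f (z - w) - circle_mean s f (z - w)) * 4 / s\<^sup>2))"
    unfolding e2 by (intro integrable_mult_right Bochner_Integration.integrable_diff i1 i2)
  show "(LBINT w. f (z - w) * v s w) = (LBINT w. \<psi> w * ((f (z - w) - circle_mean s f (z - w)) * 4 / s\<^sup>2))"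
    unfolding e1 e2 integral_mult_right_zero
    using i1 i2 adj by simp
qed

lemma v_integrable: "integrable lborel (v s)"
  using v_pairing(1)[of "\<lambda>_. 1" 1 0 s] by simp

text \<open>Testing \<open>v s\<close> against a cutoff bounds its mass by the integral of \<psi>
  times a bound for the difference quotients of the cutoff, uniformly in \<open>s\<close>.\<close>

lemma v_mass_bound: "\<exists>s0>0. \<exists>M\<ge>0. \<forall>s. 0 < s \<longrightarrow> s < s0 \<longrightarrow>
  (LBINT w. indicator (ball z0 (2 * R)) w * max 0 (v s w)) \<le> M"
proof -
  obtain s0 C where s0: "0 < s0"
    and C: "\<And>s z. 0 < s \<Longrightarrow> s < s0 \<Longrightarrow> \<bar>(cutoff (4 * R) z - circle_mean s (cutoff (4 * R)) z) * 4 / s\<^sup>2\<bar> \<le> C"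
    using cutoff_mean_bound[of "4 * R"] R by auto
  have cut01: "0 \<le> cutoff \<rho> z" "cutoff \<rho> z \<le> 1" for \<rho> z
    by (auto simp: cutoff_def intro!: power_le_one)
  define M where "M = C * (LBINT w. \<psi> w)"
  have "(LBINT w. indicator (ball z0 (2 * R)) w * max 0 (v s w)) \<le> 4 * M" if s: "0 < s" "s < min s0 R" for s
  proof -
    have s': "0 < s" "s < s0" "s < R" using s by auto
    have "(LBINT w. cutoff (4 * R) (z0 - w) * v s w)
        = (LBINT w. \<psi> w * ((cutoff (4 * R) (z0 - w) - circle_mean s (cutoff (4 * R)) (z0 - w)) * 4 / s\<^sup>2))"
      by (rule v_pairing(3)[where B=1]) (use cut01 in \<open>auto simp: abs_le_iff intro: order_trans[of _ 0]\<close>)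
    also have "\<dots> \<le> (LBINT w. \<psi> w * C)"
      using cut01 order_trans[OF abs_ge_self C[OF s'(1,2)]]
      by (intro integral_mono v_pairing(2)[where B=1] mult_left_mono integrable_mult_left \<psi>_integrable) auto
    also have "\<dots> = M" by (simp add: M_def)
    finally have le: "(LBINT w. cutoff (4 * R) (z0 - w) * v s w) \<le> M" .
    have "(LBINT w. indicator (ball z0 (2 * R)) w * max 0 (v s w))
        \<le> (LBINT w. 4 * (cutoff (4 * R) (z0 - w) * v s w))"
    proof (rule integral_mono_AE)
      show "integrable lborel (\<lambda>w. indicator (ball z0 (2 * R)) w * max 0 (v s w))"
        by (rule Bochner_Integration.integrable_bound[OF v_integrable[of s]]) (auto split: split_indicator)
      show "integrable lborel (\<lambda>w. 4 * (cutoff (4 * R) (z0 - w) * v s w))"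
        by (intro integrable_mult_right v_pairing(1)[where B=1]) (use cut01 in \<open>auto simp: abs_le_iff intro: order_trans[of _ 0]\<close>)
      show "AE w in lborel. indicator (ball z0 (2 * R)) w * max 0 (v s w) \<le> 4 * (cutoff (4 * R) (z0 - w) * v s w)"
        using AE_v_nonneg[OF s'(1,3)]
      proof eventually_elim
        case (elim w)
        show ?case
        proof (cases "w \<in> ball z0 (4 * R)")
          case True
          then have "w \<in> ball z0 (5 * R)" using R by simp
          then have vn: "0 \<le> v s w" using elim by simp
          show ?thesis
          proof (cases "w \<in> ball z0 (2 * R)")
            case True
            then have "(cmod (z0 - w))\<^sup>2 \<le> (2 * R)\<^sup>2" by (intro power_mono) (auto simp: dist_norm)
            then have "(cmod (z0 - w))\<^sup>2 / (4 * R)\<^sup>2 \<le> 1 / 4"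
              using R by (simp add: field_simps power2_eq_square)
            then have *: "3 / 4 \<le> max 0 (1 - (cmod (z0 - w))\<^sup>2 / (4 * R)\<^sup>2)" by linarith
            \<comment> \<open>(3/4)^3 = 27/64 exceeds 1/4; hence the factor 4.\<close>
            have "(3 / 4) ^ 3 \<le> cutoff (4 * R) (z0 - w)" unfolding cutoff_def by (rule power_mono[OF *]) simp
            then have "1 \<le> 4 * cutoff (4 * R) (z0 - w)" by (simp add: power3_eq_cube)
            then have "1 * v s w \<le> (4 * cutoff (4 * R) (z0 - w)) * v s w" using vn by (intro mult_right_mono)
            then show ?thesis using True vn by simp
          qed (use vn cut01 in simp)
        next
          case False
          then have "(4 * R)\<^sup>2 \<le> (cmod (z0 - w))\<^sup>2" using R by (intro power_mono) (auto simp: dist_norm)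
          then have "cutoff (4 * R) (z0 - w) = 0" using R by (simp add: cutoff_def field_simps)
          then show ?thesis using False R by simp
        qed
      qed
    qed
    also have "\<dots> \<le> 4 * M" using le by simp
    finally show ?thesis .
  qed
  then show ?thesis using s0 R by (intro exI[of _ "min s0 R"] conjI exI[of _ "max 0 (4 * M)"]) (auto simp: le_max_iff_disj)
qed

lemma \<psi>_bump_integrable: "integrable lborel (\<lambda>w. \<psi> w * bump \<delta> (z - w))"
proof (rule Bochner_Integration.integrable_bound)
  show "integrable lborel (\<lambda>w. \<psi> w * (1 / \<delta>\<^sup>2))" using \<psi>_integrable by simp
  show "AE w in lborel. norm (\<psi> w * bump \<delta> (z - w)) \<le> norm (\<psi> w * (1 / \<delta>\<^sup>2))"
    using mult_left_mono[OF bump_le \<psi>_nonneg] bump_nonneg by (intro AE_I2) (auto simp: abs_mult)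
qed measurable

text \<open>The bump has integral at least \<open>bump_mass\<close>, so the average normalised by
  this constant can only be too large, which is harmless for a lower bound.\<close>

lemma \<psi>_bump_ge:
  assumes "0 < \<delta>" "ball z \<delta> \<subseteq> ball z0 (6 * R)" "0 \<le> c" and c: "\<And>w. w \<in> ball z \<delta> \<Longrightarrow> ennreal c \<le> g w"
  shows "c \<le> (LBINT w. \<psi> w * bump \<delta> (z - w)) / bump_mass"
proof -
  have "c * bump_mass \<le> c * (LBINT w. bump \<delta> (z - w))"
    using bump_integral_ge(2)[OF assms(1)] assms by (intro mult_left_mono)
  also have "\<dots> = (LBINT w. c * bump \<delta> (z - w))" by simp
  also have "\<dots> \<le> (LBINT w. \<psi> w * bump \<delta> (z - w))"
  proof (intro integral_mono_AE integrable_mult_right bump_integral_ge(1) assms(1) \<psi>_bump_integrable)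
    show "AE w in lborel. c * bump \<delta> (z - w) \<le> \<psi> w * bump \<delta> (z - w)"
      using AE_\<psi>_eq
    proof eventually_elim
      case (elim w)
      show ?case
      proof (cases "w \<in> ball z \<delta>")
        case True
        then have "ennreal c \<le> ennreal (\<psi> w)" using elim c[OF True] assms(2) by auto
        then have "c \<le> \<psi> w" by simp
        then show ?thesis using bump_nonneg by (intro mult_right_mono)
      next
        case False
        have "\<delta>\<^sup>2 \<le> (cmod (z - w))\<^sup>2" using False assms by (intro power_mono) (auto simp: dist_norm)
        then have "bump \<delta> (z - w) = 0" using assms by (simp add: bump_def field_simps)
        then show ?thesis by simp
      qed
    qed
  qed
  finally show ?thesis using bump_mass_pos by (simp add: field_simps)
qed

lemma green_bounded:
  assumes "0 < \<delta>" "\<delta> \<le> R"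
  shows "(\<lambda>w. green_profile R \<delta> ((cmod w)\<^sup>2)) \<in> borel_measurable borel"
    and "\<exists>B. \<forall>w. \<bar>green_profile R \<delta> ((cmod w)\<^sup>2)\<bar> \<le> B"
proof -
  have cT: "continuous_on UNIV trunc_log"
    by (intro continuous_at_imp_continuous_on ballI DERIV_isCont[OF trunc_log_deriv(1)])
  have cont: "continuous_on UNIV (\<lambda>q. green_profile R \<delta> q)"
    unfolding green_profile_def using assms R
    by (intro continuous_intros continuous_on_compose2[OF cT]) auto
  have "continuous_on UNIV (\<lambda>w::complex. green_profile R \<delta> ((cmod w)\<^sup>2))"
    by (intro continuous_on_compose2[OF cont] continuous_intros) auto
  then show "(\<lambda>w. green_profile R \<delta> ((cmod w)\<^sup>2)) \<in> borel_measurable borel"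
    by (rule borel_measurable_continuous_onI)
  have "compact (green_profile R \<delta> ` {0..R\<^sup>2})"
    by (intro compact_continuous_image continuous_on_subset[OF cont]) auto
  then obtain B where B: "\<forall>x\<in>green_profile R \<delta> ` {0..R\<^sup>2}. norm x \<le> B"
    using compact_imp_bounded bounded_iff by metis
  have "\<bar>green_profile R \<delta> ((cmod w)\<^sup>2)\<bar> \<le> \<bar>B\<bar>" for w
  proof (cases "R\<^sup>2 \<le> (cmod w)\<^sup>2")
    case True
    then show ?thesis using green_profile_zero[OF assms True] by simp
  next
    case False
    then have "norm (green_profile R \<delta> ((cmod w)\<^sup>2)) \<le> B" using B by auto
    then show ?thesis by simp
  qed
  then show "\<exists>B. \<forall>w. \<bar>green_profile R \<delta> ((cmod w)\<^sup>2)\<bar> \<le> B" by blast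
qed

text \<open>Test \<open>v s\<close> against the profile centred at \<open>z\<close>. Duality turns
  the profile into 12 (\<open>bump \<delta>\<close> - \<open>bump R\<close>) up to an error 1, and
  \<open>bump R\<close> is at most 1 / R^2, whence 12 / R^2 + 1. The profile vanishes beyond
  distance \<open>R\<close>, so only the part of \<open>v s\<close> in the 2R-disc enters, where it
  is nonnegative almost everywhere. The threshold \<open>s0\<close> depends on \<delta>, the
  constants do not.\<close>

lemma potential_bound:
  assumes "0 < \<delta>" "\<delta> \<le> R"
  shows "\<exists>s0>0. \<forall>s z. 0 < s \<longrightarrow> s < s0 \<longrightarrow> z \<in> ball z0 R \<longrightarrow>
    12 * (LBINT w. \<psi> w * bump \<delta> (z - w)) \<le> (12 / R\<^sup>2 + 1) * (LBINT w. \<psi> w)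
      + 2 * (LBINT w. log_kernel R (\<delta> / exp 1) (Re z - Re w) * (indicator (ball z0 (2 * R)) w * max 0 (v s w)))"
proof -
  let ?k = "\<lambda>w. green_profile R \<delta> ((cmod w)\<^sup>2)"
  let ?l = "log_kernel R (\<delta> / exp 1)"
  have \<eta>: "0 < \<delta> / exp 1" using assms by simp
  obtain B where B: "\<And>w. \<bar>?k w\<bar> \<le> B" using green_bounded(2)[OF assms] by blast
  note km [measurable] = green_bounded(1)[OF assms]
  obtain s0 where s0: "0 < s0" "\<And>s z. 0 < s \<Longrightarrow> s < s0 \<Longrightarrow>
    \<bar>(?k z - circle_mean s ?k z) * 4 / s\<^sup>2 - 12 * (bump \<delta> z - bump R z)\<bar> \<le> 1"
    using green_mean_expansion[OF assms, of 1] by auto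
  have "12 * (LBINT w. \<psi> w * bump \<delta> (z - w)) \<le> (12 / R\<^sup>2 + 1) * (LBINT w. \<psi> w)
      + 2 * (LBINT w. ?l (Re z - Re w) * (indicator (ball z0 (2 * R)) w * max 0 (v s w)))"
    if s: "0 < s" "s < min s0 R" and z: "z \<in> ball z0 R" for s z
  proof -
    let ?e = "\<lambda>w. (?k (z - w) - circle_mean s ?k (z - w)) * 4 / s\<^sup>2"
    have sR: "s < R" using s by simp
    note p = v_pairing[OF km B, of z s]
    have "12 * (LBINT w. \<psi> w * bump \<delta> (z - w)) = (LBINT w. 12 * (\<psi> w * bump \<delta> (z - w)))" by simp
    also have "\<dots> \<le> (LBINT w. \<psi> w * ?e w + (12 / R\<^sup>2 + 1) * \<psi> w)"
    proof (intro integral_mono integrable_mult_right \<psi>_bump_integrable Bochner_Integration.integrable_add p(2) \<psi>_integrable)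
      fix w
      have "12 * bump \<delta> (z - w) \<le> ?e w + 12 * bump R (z - w) + 1"
        using s0(2)[OF s(1), of "z - w"] s(2) by (simp add: abs_le_iff)
      also have "12 * bump R (z - w) \<le> 12 / R\<^sup>2" using bump_le[of R "z - w"] by simp
      finally have "\<psi> w * (12 * bump \<delta> (z - w)) \<le> \<psi> w * (?e w + 12 / R\<^sup>2 + 1)"
        by (intro mult_left_mono) auto
      then show "12 * (\<psi> w * bump \<delta> (z - w)) \<le> \<psi> w * ?e w + (12 / R\<^sup>2 + 1) * \<psi> w"
        by (simp add: algebra_simps)
    qed
    also have "\<dots> = (LBINT w. ?k (z - w) * v s w) + (12 / R\<^sup>2 + 1) * (LBINT w. \<psi> w)"
      using p \<psi>_integrable by (subst Bochner_Integration.integral_add) auto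
    also have "(LBINT w. ?k (z - w) * v s w)
       \<le> (LBINT w. 2 * (?l (Re z - Re w) * (indicator (ball z0 (2 * R)) w * max 0 (v s w))))"
    proof (intro integral_mono_AE p(1) integrable_mult_right)
      show "integrable lborel (\<lambda>w. ?l (Re z - Re w) * (indicator (ball z0 (2 * R)) w * max 0 (v s w)))"
      proof (rule Bochner_Integration.integrable_bound[OF integrable_mult_right[OF v_integrable[of s], of "?l 0"]])
        show "AE w in lborel. norm (?l (Re z - Re w) * (indicator (ball z0 (2 * R)) w * max 0 (v s w))) \<le> norm (?l 0 * v s w)"
          using log_kernel_le[OF R \<eta>] by (intro AE_I2) (auto simp: abs_mult split: split_indicator intro!: mult_mono)
      qed measurable
      show "AE w in lborel. ?k (z - w) * v s w \<le> 2 * (?l (Re z - Re w) * (indicator (ball z0 (2 * R)) w * max 0 (v s w)))"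
        using AE_v_nonneg[OF s(1) sR]
      proof eventually_elim
        case (elim w)
        show ?case
        proof (cases "w \<in> ball z0 (2 * R)")
          case True
          then have "0 \<le> v s w" using elim R by simp
          moreover have "?k (z - w) \<le> 2 * ?l (Re z - Re w)"
            using green_profile_le_log_kernel[OF assms, of "z - w"] by simp
          ultimately have "?k (z - w) * v s w \<le> (2 * ?l (Re z - Re w)) * v s w"
            by (intro mult_right_mono)
          then show ?thesis using True \<open>0 \<le> v s w\<close> by (simp add: max_absorb2)
        next
          case False
          have "R \<le> cmod (z - w)" using False z dist_triangle[of z0 w z] by (simp add: dist_norm)
          then have "R\<^sup>2 \<le> (cmod (z - w))\<^sup>2" using R by (intro power_mono) auto
          then show ?thesis using False green_profile_zero[OF assms] by simp
        qed
      qed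
    qed
    finally show ?thesis by simp
  qed
  then show ?thesis using s0 R by (intro exI[of _ "min s0 R"]) auto
qed

text \<open>\<open>N\<close> comes from the mass bound alone, and \<open>s\<close> is chosen after
  \<delta>; so neither \<open>N\<close> nor \<open>C\<close> depends on \<delta>, as the limit
  \<delta> \<rightarrow> 0 requires. Only the positions of the zeros do.\<close>

lemma exp_mollified_integral_le:
  assumes AB: "A' \<le> B'" and \<gamma>: "\<And>t. t \<in> {A'..B'} \<Longrightarrow> Re (\<gamma> t) = t" "\<And>t. t \<in> {A'..B'} \<Longrightarrow> \<gamma> t \<in> ball z0 R"
  shows "\<exists>(N::nat) C. \<forall>\<delta>. 0 < \<delta> \<longrightarrow> \<delta> \<le> R \<longrightarrow> (\<exists>x::nat \<Rightarrow> real. (\<forall>i\<le>N. \<bar>x i - Re z0\<bar> \<le> 2 * R) \<and>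
    (\<integral>\<^sup>+t\<in>{A'..B'}. ennreal ((\<Prod>i\<le>N. \<bar>t - x i\<bar> / (3 * R)) *
       exp ((LBINT w. \<psi> w * bump \<delta> (\<gamma> t - w)) / bump_mass)) \<partial>lborel) \<le> ennreal C)"
proof -
  obtain s1 M where s1: "0 < s1" and M: "0 \<le> M" "\<And>s. 0 < s \<Longrightarrow> s < s1 \<Longrightarrow>
      (LBINT w. indicator (ball z0 (2 * R)) w * max 0 (v s w)) \<le> M"
    using v_mass_bound by blast
  \<comment> \<open>After division of the potential bound by 12 \<open>bump_mass\<close>, its factor
    2 becomes this constant.\<close>
  define c where "c = 1 / (6 * bump_mass)"
  have c: "0 < c" using bump_mass_pos by (simp add: c_def)
  \<comment> \<open>This makes the total mass at most N / 2, so that each of the \<open>N\<close>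
    pieces has mass at most 1/2.\<close>
  obtain N :: nat where N: "2 * c * M < N" using reals_Archimedean2 by blast
  moreover have "0 \<le> 2 * c * M" using c M by simp
  ultimately have "0 < N" by (metis of_nat_0_less_iff order_le_less_trans)
  define C0 where "C0 = (12 / R\<^sup>2 + 1) * (LBINT w. \<psi> w) / (12 * bump_mass)"
  define C1 where "C1 = (B' - A') + N * ((1 + sqrt R) * (B' - A') + 4 * sqrt R)"
  have "\<exists>x::nat \<Rightarrow> real. (\<forall>i\<le>N. \<bar>x i - Re z0\<bar> \<le> 2 * R) \<and>
    (\<integral>\<^sup>+t\<in>{A'..B'}. ennreal ((\<Prod>i\<le>N. \<bar>t - x i\<bar> / (3 * R)) *
       exp ((LBINT w. \<psi> w * bump \<delta> (\<gamma> t - w)) / bump_mass)) \<partial>lborel) \<le> ennreal (exp C0 * C1)"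
    if \<delta>: "0 < \<delta>" "\<delta> \<le> R" for \<delta>
  proof -
    let ?l = "log_kernel R (\<delta> / exp 1)"
    obtain s0 where s0: "0 < s0" "\<And>s z. 0 < s \<Longrightarrow> s < s0 \<Longrightarrow> z \<in> ball z0 R \<Longrightarrow>
      12 * (LBINT w. \<psi> w * bump \<delta> (z - w)) \<le> (12 / R\<^sup>2 + 1) * (LBINT w. \<psi> w)
      + 2 * (LBINT w. ?l (Re z - Re w) * (indicator (ball z0 (2 * R)) w * max 0 (v s w)))"
      using potential_bound[OF \<delta>] by blast
    define s where "s = min s0 s1 / 2"
    have s: "0 < s" "s < s0" "s < s1" using s0 s1 by (auto simp: s_def)
    define h where "h w = c * (indicator (ball z0 (2 * R)) w * max 0 (v s w))" for w
    have h0: "0 \<le> h w" for w using c by (simp add: h_def)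
    have [measurable]: "h \<in> borel_measurable borel" unfolding h_def[abs_def] by measurable
    have hi: "integrable lborel h" unfolding h_def[abs_def]
      by (intro integrable_mult_right Bochner_Integration.integrable_bound[OF v_integrable[of s]]) (auto split: split_indicator)
    have hM: "(LBINT w. h w) \<le> N / 2"
    proof -
      have "(LBINT w. h w) = c * (LBINT w. indicator (ball z0 (2 * R)) w * max 0 (v s w))" by (simp add: h_def)
      also have "\<dots> \<le> c * M" using M(2)[OF s(1,3)] c by (intro mult_left_mono) auto
      finally show ?thesis using N by simp
    qed
    define \<nu> where "\<nu> = distr (density lborel (\<lambda>w. ennreal (h w))) borel Re"
    have em: "emeasure \<nu> S = (\<integral>\<^sup>+w. ennreal (h w) * indicator (Re -` S) w \<partial>lborel)" if "S \<in> sets borel" for S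
    proof -
      have "Re \<in> borel_measurable borel" by measurable
      from measurable_sets[OF this that] have "Re -` S \<in> sets borel" by simp
      then show ?thesis unfolding \<nu>_def using that by (subst emeasure_distr) (auto simp: emeasure_density)
    qed
    have tot: "emeasure \<nu> UNIV = ennreal (LBINT w. h w)"
      using nn_integral_eq_integral[OF hi] h0 by (subst em) auto
    have fb: "finite_borel_measure \<nu>"
    proof (intro finite_borel_measure.intro finite_measureI finite_borel_measure_axioms.intro)
      show "emeasure \<nu> (space \<nu>) \<noteq> \<infinity>" using tot by (simp add: \<nu>_def)
    qed (simp add: \<nu>_def)
    \<comment> \<open>The measure is the projection of a planar density, and vertical lines are null
      sets.\<close>
    have atom: "measure \<nu> {x} = 0" for x
    proof -
      have "negligible {w::complex. w \<bullet> 1 = x}" by (rule negligible_standard_hyperplane) (simp add: Basis_complex_def)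
      then have "{w::complex. Re w = x} \<in> null_sets lebesgue" by (simp add: negligible_iff_null_sets)
      moreover have "{w::complex. Re w = x} \<in> sets borel" by measurable
      ultimately have "{w::complex. Re w = x} \<in> null_sets lborel" by (simp add: null_sets_completion_iff)
      then have "AE w in lborel. Re w \<noteq> x" using AE_not_in by fastforce
      then have "(\<integral>\<^sup>+w. ennreal (h w) * indicator (Re -` {x}) w \<partial>lborel) = (\<integral>\<^sup>+w. 0 \<partial>(lborel :: complex measure))"
        by (intro nn_integral_cong_AE) (auto elim!: eventually_mono)
      then show ?thesis using em[of "{x}"] by (simp add: measure_def)
    qed
    let ?A = "Re z0 - 2 * R" and ?B = "Re z0 + 2 * R"
    have supp: "measure \<nu> (- {?A..?B}) = 0"
    proof -
      have "h w = 0" if "Re w \<notin> {?A..?B}" for w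
        using that abs_Re_le_cmod[of "z0 - w"] by (auto simp: h_def dist_norm split: split_indicator)
      then have eq0: "ennreal (h w) * indicator (Re -` (- {?A..?B})) w = 0" for w
        by (auto split: split_indicator)
      have "emeasure \<nu> (- {?A..?B}) = (\<integral>\<^sup>+w. ennreal (h w) * indicator (Re -` (- {?A..?B})) w \<partial>lborel)"
        by (rule em) simp
      also have "\<dots> = 0" unfolding eq0 by simp
      finally show ?thesis by (simp add: measure_def)
    qed
    have mass: "measure \<nu> UNIV \<le> N / 2"
      using tot hM h0 by (simp add: measure_def integral_nonneg_AE)
    have le3: "\<bar>t - x\<bar> \<le> 3 * R" if "t \<in> {A'..B'}" "x \<in> {?A..?B}" for t x
    proof -
      have "\<bar>Re (z0 - \<gamma> t)\<bar> < R" using \<gamma>(2)[OF that(1)] abs_Re_le_cmod[of "z0 - \<gamma> t"] by (simp add: dist_norm)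
      then show ?thesis using \<gamma>(1)[OF that(1)] that(2) by auto
    qed
    have \<eta>: "0 < \<delta> / exp 1" using \<delta> by simp
    obtain x :: "nat \<Rightarrow> real" where x: "\<forall>i\<le>N. x i \<in> {?A..?B}"
      and xb: "(\<integral>\<^sup>+t\<in>{A'..B'}. ennreal ((\<Prod>i\<le>N. \<bar>t - x i\<bar> / (3 * R)) * exp (LINT x|\<nu>. ?l (t - x))) \<partial>lborel) \<le> ennreal C1"
      using exp_log_potential_integral_le[OF fb atom supp mass _ AB \<open>0 < N\<close> R \<eta> _ le3] R unfolding C1_def by auto
    have pt: "(LBINT w. \<psi> w * bump \<delta> (\<gamma> t - w)) / bump_mass \<le> C0 + (LINT x|\<nu>. ?l (t - x))" if t: "t \<in> {A'..B'}" for t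
    proof -
      have "(LINT x|\<nu>. ?l (t - x)) = (LINT w|density lborel (\<lambda>w. ennreal (h w)). ?l (t - Re w))"
        unfolding \<nu>_def by (rule integral_distr) measurable
      also have "\<dots> = (LBINT w. h w * ?l (t - Re w))"
        using h0 by (subst integral_density) auto
      also have "\<dots> = c * (LBINT w. ?l (Re (\<gamma> t) - Re w) * (indicator (ball z0 (2 * R)) w * max 0 (v s w)))"
        unfolding h_def \<gamma>(1)[OF t] integral_mult_right_zero[symmetric] by (simp add: mult_ac)
      finally have "12 * bump_mass * (LINT x|\<nu>. ?l (t - x))
        = 2 * (LBINT w. ?l (Re (\<gamma> t) - Re w) * (indicator (ball z0 (2 * R)) w * max 0 (v s w)))"
        using bump_mass_pos by (simp add: c_def)
      moreover have "12 * bump_mass * C0 = (12 / R\<^sup>2 + 1) * (LBINT w. \<psi> w)"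
        using bump_mass_pos by (simp add: C0_def)
      ultimately have "12 * (LBINT w. \<psi> w * bump \<delta> (\<gamma> t - w)) \<le> 12 * (bump_mass * (C0 + (LINT x|\<nu>. ?l (t - x))))"
        using s0(2)[OF s(1,2) \<gamma>(2)[OF t]] by (simp add: distrib_left)
      then show ?thesis using bump_mass_pos by (simp add: field_simps)
    qed
    have [measurable]: "(\<lambda>t. LINT x|\<nu>. ?l (t - x)) \<in> borel_measurable borel"
    proof -
      interpret finite_borel_measure \<nu> by (rule fb)
      have [measurable_cong]: "sets \<nu> = sets borel" by (simp add: \<nu>_def)
      show ?thesis by measurable
    qed
    have "(\<integral>\<^sup>+t\<in>{A'..B'}. ennreal ((\<Prod>i\<le>N. \<bar>t - x i\<bar> / (3 * R)) * exp ((LBINT w. \<psi> w * bump \<delta> (\<gamma> t - w)) / bump_mass)) \<partial>lborel)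
      \<le> (\<integral>\<^sup>+t. ennreal (exp C0) * (ennreal ((\<Prod>i\<le>N. \<bar>t - x i\<bar> / (3 * R)) * exp (LINT x|\<nu>. ?l (t - x))) * indicator {A'..B'} t) \<partial>lborel)"
    proof (intro nn_integral_mono)
      fix t
      show "ennreal ((\<Prod>i\<le>N. \<bar>t - x i\<bar> / (3 * R)) * exp ((LBINT w. \<psi> w * bump \<delta> (\<gamma> t - w)) / bump_mass)) * indicator {A'..B'} t
        \<le> ennreal (exp C0) * (ennreal ((\<Prod>i\<le>N. \<bar>t - x i\<bar> / (3 * R)) * exp (LINT x|\<nu>. ?l (t - x))) * indicator {A'..B'} t)"
      proof (cases "t \<in> {A'..B'}")
        case True
        let ?p = "\<Prod>i\<le>N. \<bar>t - x i\<bar> / (3 * R)"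
        have p0: "0 \<le> ?p" using R by (intro prod_nonneg) auto
        have "?p * exp ((LBINT w. \<psi> w * bump \<delta> (\<gamma> t - w)) / bump_mass) \<le> ?p * exp (C0 + (LINT x|\<nu>. ?l (t - x)))"
          using pt[OF True] p0 by (intro mult_left_mono) auto
        also have "\<dots> = exp C0 * (?p * exp (LINT x|\<nu>. ?l (t - x)))" by (simp add: exp_add mult_ac)
        finally show ?thesis using True p0 by (simp add: ennreal_leI flip: ennreal_mult)
      qed simp
    qed
    also have "\<dots> = ennreal (exp C0) * (\<integral>\<^sup>+t\<in>{A'..B'}. ennreal ((\<Prod>i\<le>N. \<bar>t - x i\<bar> / (3 * R)) * exp (LINT x|\<nu>. ?l (t - x))) \<partial>lborel)"
      by (rule nn_integral_cmult) measurable
    also have "\<dots> \<le> ennreal (exp C0) * ennreal C1" using xb by (intro mult_left_mono) auto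
    also have "\<dots> = ennreal (exp C0 * C1)" by (simp add: ennreal_mult')
    finally show ?thesis using x by (intro exI[of _ x]) (auto simp: abs_le_iff)
  qed
  then show ?thesis by blast
qed

end

section \<open>Polynomials that are square integrable against the weight\<close>

lemma finite_family_convergent_subseq:
  fixes x :: "nat \<Rightarrow> nat \<Rightarrow> real"
  assumes "\<And>n i. i < N \<Longrightarrow> \<bar>x n i - c\<bar> \<le> r"
  shows "\<exists>l k. strict_mono k \<and> (\<forall>i<N. (\<lambda>n. x (k n) i) \<longlonglongrightarrow> l i)"
  using assms
proof (induction N)
  case 0
  then show ?case by (intro exI[of _ "\<lambda>_. 0"] exI[of _ id]) (auto simp: strict_mono_def)
next
  case (Suc N)
  then obtain l k where k: "strict_mono k" "\<And>i. i < N \<Longrightarrow> (\<lambda>n. x (k n) i) \<longlonglongrightarrow> l i"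
    by (metis less_SucI)
  have "seq_compact {c - r..c + r}" by (simp add: compact_imp_seq_compact)
  moreover have "x (k n) N \<in> {c - r..c + r}" for n
    using Suc.prems[of N "k n"] unfolding atLeastAtMost_iff by linarith
  ultimately obtain l' k' where k': "strict_mono k'" "((\<lambda>n. x (k n) N) \<circ> k') \<longlonglongrightarrow> l'"
    using seq_compactE[of "{c - r..c + r}" "\<lambda>n. x (k n) N"] by blast
  have "(\<lambda>n. x ((k \<circ> k') n) i) \<longlonglongrightarrow> (l(N := l')) i" if "i < Suc N" for i
  proof (cases "i = N")
    case True
    then show ?thesis using k'(2) by (simp add: o_def)
  next
    case False
    then show ?thesis using LIMSEQ_subseq_LIMSEQ[OF k(2) k'(1)] that by (simp add: o_def)
  qed
  moreover have "strict_mono (k \<circ> k')" using k k' by (simp add: strict_mono_o)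
  ultimately show ?case by blast
qed

text \<open>The exponential on [0, \<infinity>], written as a supremum over real levels strictly
  below \<open>x\<close> because lower semicontinuity provides a neighbourhood for precisely such
  levels. Admitting c = 0 unconditionally gives the value 1 at 0.\<close>

definition eexp :: "ennreal \<Rightarrow> ennreal" where
  "eexp x = (SUP c\<in>{c::real. 0 \<le> c \<and> (c = 0 \<or> ennreal c < x)}. ennreal (exp c))"

lemma exp_le_eexp:
  assumes "0 \<le> r" shows "ennreal (exp r) \<le> eexp (ennreal r)"
proof (rule dense_le)
  fix y assume "y < ennreal (exp r)"
  then obtain u where u: "y = ennreal u" "0 \<le> u" "u < exp r" by (cases y) (auto simp: ennreal_less_iff)
  define c where "c = (if u \<le> 1 then 0 else ln u)"
  have c: "0 \<le> c" "c = 0 \<or> c < r" "u \<le> exp c"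
    using u by (auto simp: c_def ln_less_cancel_iff[of u "exp r", simplified])
  then have "c \<in> {c. 0 \<le> c \<and> (c = 0 \<or> ennreal c < ennreal r)}" by (auto simp: ennreal_less_iff)
  then have "ennreal (exp c) \<le> eexp (ennreal r)" unfolding eexp_def by (intro SUP_upper)
  then show "y \<le> eexp (ennreal r)" using c(3) u(1) by (meson ennreal_leI order_trans)
qed

lemma eexp_top: "eexp \<infinity> = \<infinity>"
proof (rule ccontr)
  assume "eexp \<infinity> \<noteq> \<infinity>"
  then obtain b where b: "eexp \<infinity> = ennreal b" "0 \<le> b" by (cases "eexp \<infinity>") auto
  have "ennreal (exp b) \<le> eexp \<infinity>" unfolding eexp_def using b by (intro SUP_upper) auto
  then have "exp b \<le> b" using b by simp
  then show False using exp_ge_add_one_self[of b] by linarith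
qed

lemma exp_neg_le_eexp:
  assumes "0 \<le> C" "x < ereal C"
  shows "exp_neg x \<le> eexp (e2ennreal (ereal C - x))"
proof (cases x)
  case (real r)
  then have "exp_neg x \<le> ennreal (exp (C - r))" using assms by (simp add: exp_neg_def ennreal_leI)
  also have "\<dots> \<le> eexp (ennreal (C - r))" using assms real by (intro exp_le_eexp) simp
  finally show ?thesis using real by simp
next
  case MInf
  then show ?thesis using eexp_top by (simp add: exp_neg_def)
qed (use assms in auto)

context positive_superharmonic_disc
begin

text \<open>The zeros vary with the mollification radius but stay in a compact interval, so they
  converge along a subsequence. At each \<open>t\<close> the mollifications eventually reach every
  level below g(\<gamma> t), and Fatou's lemma carries the uniform bound to the limit.\<close>

lemma exp_superharmonic_integrable:
  assumes AB: "A' \<le> B'" and \<gamma>: "\<And>t. t \<in> {A'..B'} \<Longrightarrow> Re (\<gamma> t) = t" "\<And>t. t \<in> {A'..B'} \<Longrightarrow> \<gamma> t \<in> ball z0 R"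
    and [measurable]: "\<gamma> \<in> borel_measurable borel"
    and lsc: "\<And>t c. t \<in> {A'..B'} \<Longrightarrow> ennreal c < g (\<gamma> t) \<Longrightarrow> \<exists>d>0. \<forall>w\<in>ball (\<gamma> t) d. ennreal c \<le> g w"
  shows "\<exists>(N::nat) x. (\<forall>i<N. \<bar>x i - Re z0\<bar> \<le> 2 * R) \<and>
    (\<integral>\<^sup>+t\<in>{A'..B'}. ennreal (\<Prod>i<N. \<bar>t - x i\<bar> / (3 * R)) * eexp (g (\<gamma> t)) \<partial>lborel) < \<infinity>"
proof -
  define \<delta> where "\<delta> n = R / real (Suc n)" for n
  have \<delta>: "0 < \<delta> n" "\<delta> n \<le> R" for n using R by (auto simp: \<delta>_def field_simps)
  have \<delta>lim: "\<delta> \<longlonglongrightarrow> 0" unfolding \<delta>_def by (rule LIMSEQ_Suc[OF lim_const_over_n])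
  obtain N0 C where NC: "\<And>\<delta>. 0 < \<delta> \<Longrightarrow> \<delta> \<le> R \<Longrightarrow> \<exists>x::nat \<Rightarrow> real. (\<forall>i\<le>N0. \<bar>x i - Re z0\<bar> \<le> 2 * R) \<and>
    (\<integral>\<^sup>+t\<in>{A'..B'}. ennreal ((\<Prod>i\<le>N0. \<bar>t - x i\<bar> / (3 * R)) *
       exp ((LBINT w. \<psi> w * bump \<delta> (\<gamma> t - w)) / bump_mass)) \<partial>lborel) \<le> ennreal C"
    using exp_mollified_integral_le[OF AB \<gamma>] by auto
  define N where "N = Suc N0"
  define G where "G n t = (LBINT w. \<psi> w * bump (\<delta> n) (\<gamma> t - w)) / bump_mass" for n t
  have "\<exists>x. \<forall>n. (\<forall>i<N. \<bar>x n i - Re z0\<bar> \<le> 2 * R) \<and>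
    (\<integral>\<^sup>+t\<in>{A'..B'}. ennreal ((\<Prod>i<N. \<bar>t - x n i\<bar> / (3 * R)) * exp (G n t)) \<partial>lborel) \<le> ennreal C"
    using NC[OF \<delta>] unfolding G_def N_def lessThan_Suc_atMost less_Suc_eq_le by (intro choice) blast
  then obtain x where x: "\<And>n i. i < N \<Longrightarrow> \<bar>x n i - Re z0\<bar> \<le> 2 * R"
    and xC: "\<And>n. (\<integral>\<^sup>+t\<in>{A'..B'}. ennreal ((\<Prod>i<N. \<bar>t - x n i\<bar> / (3 * R)) * exp (G n t)) \<partial>lborel) \<le> ennreal C"
    by blast
  obtain l k where k: "strict_mono k" and l: "\<And>i. i < N \<Longrightarrow> (\<lambda>n. x (k n) i) \<longlonglongrightarrow> l i"
    using finite_family_convergent_subseq[of N x "Re z0" "2 * R"] x by blast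
  have l2: "\<bar>l i - Re z0\<bar> \<le> 2 * R" if "i < N" for i
    using x[OF that] by (intro LIMSEQ_le_const2[OF tendsto_rabs[OF tendsto_diff[OF l[OF that] tendsto_const]]]) blast
  define u where "u n t = ennreal ((\<Prod>i<N. \<bar>t - x (k n) i\<bar> / (3 * R)) * exp (G (k n) t)) * indicator {A'..B'} t" for n t
  have Gm [measurable]: "G n \<in> borel_measurable borel" for n
  proof -
    have [measurable]: "(\<lambda>p. \<psi> (snd p) * bump (\<delta> n) (\<gamma> (fst p) - snd p)) \<in> borel_measurable (borel \<Otimes>\<^sub>M borel)"
      by measurable
    show ?thesis unfolding G_def[abs_def] by measurable
  qed
  have [measurable]: "u n \<in> borel_measurable borel" for n unfolding u_def by measurable
  have "(\<integral>\<^sup>+t. liminf (\<lambda>n. u n t) \<partial>lborel) \<le> liminf (\<lambda>n. \<integral>\<^sup>+t. u n t \<partial>lborel)"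
    by (rule nn_integral_liminf) simp
  also have "\<dots> \<le> ennreal C"
    using xC unfolding u_def by (intro Liminf_le) auto
  finally have fatou: "(\<integral>\<^sup>+t. liminf (\<lambda>n. u n t) \<partial>lborel) \<le> ennreal C" .
  have pt: "ennreal (\<Prod>i<N. \<bar>t - l i\<bar> / (3 * R)) * eexp (g (\<gamma> t)) \<le> liminf (\<lambda>n. u n t)" if t: "t \<in> {A'..B'}" for t
  proof -
    let ?P = "\<lambda>n. \<Prod>i<N. \<bar>t - x (k n) i\<bar> / (3 * R)"
    let ?S = "{c::real. 0 \<le> c \<and> (c = 0 \<or> ennreal c < g (\<gamma> t))}"
    have P0: "0 \<le> ?P n" for n using R by (intro prod_nonneg) auto
    have Plim: "?P \<longlonglongrightarrow> (\<Prod>i<N. \<bar>t - l i\<bar> / (3 * R))"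
      using R by (intro tendsto_prod tendsto_divide tendsto_rabs tendsto_diff tendsto_const l) auto
    have "ennreal (\<Prod>i<N. \<bar>t - l i\<bar> / (3 * R)) * ennreal (exp c) \<le> liminf (\<lambda>n. u n t)" if c: "c \<in> ?S" for c
    proof -
      have "\<exists>d>0. \<forall>w\<in>ball (\<gamma> t) d. ennreal c \<le> g w"
        using c lsc[OF t, of c] by (cases "c = 0") (auto intro: exI[of _ 1])
      then obtain d where d: "0 < d" "\<And>w. w \<in> ball (\<gamma> t) d \<Longrightarrow> ennreal c \<le> g w" by blast
      have "(\<lambda>n. \<delta> (k n)) \<longlonglongrightarrow> 0" using LIMSEQ_subseq_LIMSEQ[OF \<delta>lim k] by (simp add: o_def)
      then have "eventually (\<lambda>n. \<delta> (k n) < d) sequentially" using d by (simp add: order_tendstoD)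
      then have ev: "eventually (\<lambda>n. ennreal (?P n * exp c) \<le> u n t) sequentially"
      proof eventually_elim
        case (elim n)
        have "ball (\<gamma> t) (\<delta> (k n)) \<subseteq> ball z0 (6 * R)"
        proof
          fix w assume "w \<in> ball (\<gamma> t) (\<delta> (k n))"
          then show "w \<in> ball z0 (6 * R)"
            using \<gamma>(2)[OF t] \<delta>(2)[of "k n"] R dist_triangle[of z0 w "\<gamma> t"] by simp
        qed
        then have "c \<le> G (k n) t"
          unfolding G_def using d(2) elim c by (intro \<psi>_bump_ge \<delta>) auto
        then show ?case using t P0 unfolding u_def by (auto intro!: ennreal_leI mult_left_mono)
      qed
      have "(\<lambda>n. ennreal (?P n * exp c)) \<longlonglongrightarrow> ennreal ((\<Prod>i<N. \<bar>t - l i\<bar> / (3 * R)) * exp c)"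
        using Plim by (intro tendsto_ennrealI tendsto_mult tendsto_const)
      then have "liminf (\<lambda>n. ennreal (?P n * exp c)) = ennreal ((\<Prod>i<N. \<bar>t - l i\<bar> / (3 * R)) * exp c)"
        by (intro lim_imp_Liminf) auto
      then show ?thesis using Liminf_mono[OF ev] by (simp add: ennreal_mult'')
    qed
    then show ?thesis unfolding eexp_def SUP_mult_left_ennreal by (intro SUP_least)
  qed
  have "(\<integral>\<^sup>+t\<in>{A'..B'}. ennreal (\<Prod>i<N. \<bar>t - l i\<bar> / (3 * R)) * eexp (g (\<gamma> t)) \<partial>lborel) \<le> (\<integral>\<^sup>+t. liminf (\<lambda>n. u n t) \<partial>lborel)"
    using pt by (intro nn_integral_mono) (auto split: split_indicator)
  also have "\<dots> < \<infinity>" using fatou by (auto intro: le_less_trans)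
  finally show ?thesis using l2 by blast
qed

end

section \<open>From zeros on the axis to polynomials on the curve\<close>

lemma graph_curve_measurable:
  assumes "continuous_on UNIV y" shows "graph_curve y \<in> borel_measurable borel"
  unfolding graph_curve_def[abs_def] Complex_eq
  by (intro borel_measurable_continuous_onI continuous_intros assms)

lemma graph_curve_lipschitz:
  assumes "L-lipschitz_on UNIV y"
  shows "cmod (graph_curve y t - graph_curve y s) \<le> (1 + L) * \<bar>t - s\<bar>"
proof -
  have "cmod (graph_curve y t - graph_curve y s) \<le> \<bar>t - s\<bar> + \<bar>y t - y s\<bar>"
    using cmod_le[of "graph_curve y t - graph_curve y s"] by (simp add: graph_curve_def)
  also have "\<bar>y t - y s\<bar> \<le> L * \<bar>t - s\<bar>"
    using lipschitz_onD[OF assms, of t s] by (simp add: dist_real_def)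
  finally show ?thesis by (simp add: algebra_simps)
qed

text \<open>The zeros on the axis are lifted to the points of the curve above them. The Lipschitz
  bound compares |\<gamma> t - \<gamma> (x i)| with |t - x i|; after normalisation each ratio is at
  most 1, so its square is bounded by its first power, and the first powers are what integrability
  is known for.\<close>

lemma subharmonic_local_polynomial:
  assumes sub: "subharmonic_on U \<phi>" and lip: "L-lipschitz_on UNIV y" and t0: "graph_curve y t0 \<in> U"
  shows "\<exists>r>0. \<exists>Q::complex poly. Q \<noteq> 0 \<and>
    (\<integral>\<^sup>+t\<in>{t0-r..t0+r}. ennreal ((cmod (poly Q (graph_curve y t)))\<^sup>2) * exp_neg (\<phi> (graph_curve y t)) \<partial>lborel) < \<infinity>"
proof -
  define \<gamma> where "\<gamma> = graph_curve y"
  have L: "0 \<le> L" by (rule lipschitz_on_nonneg[OF lip])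
  have \<gamma>L: "cmod (\<gamma> t - \<gamma> s) \<le> (1 + L) * \<bar>t - s\<bar>" for t s
    unfolding \<gamma>_def by (rule graph_curve_lipschitz[OF lip])
  have Re\<gamma>: "Re (\<gamma> t) = t" for t by (simp add: \<gamma>_def graph_curve_def)
  obtain \<rho> C where \<rho>: "0 < \<rho>" and C: "0 < C" and sU: "cball (\<gamma> t0) \<rho> \<subseteq> U"
    and bd: "\<And>w. w \<in> cball (\<gamma> t0) \<rho> \<Longrightarrow> \<phi> w < ereal C"
    and fin: "(\<integral>\<^sup>+w\<in>ball (\<gamma> t0) \<rho>. defect U \<phi> C w \<partial>lborel) < \<infinity>"
    using subharmonic_locally_integrable[OF sub, of "\<gamma> t0"] t0 unfolding \<gamma>_def by blast
  define R where "R = \<rho> / 6"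
  have R6: "0 < R" "6 * R = \<rho>" using \<rho> by (auto simp: R_def)
  interpret positive_superharmonic_disc "defect U \<phi> C" "\<gamma> t0" R
  proof
    show "(\<integral>\<^sup>+\<theta>\<in>{0..2*pi}. defect U \<phi> C (z + of_real r * cis \<theta>) \<partial>lborel) \<le> ennreal (2 * pi) * defect U \<phi> C z"
      if "0 < r" "cball z r \<subseteq> ball (\<gamma> t0) (6 * R)" for z r
      using that unfolding R6(2)
      by (intro defect_supermean[OF sub C bd sU]) auto
  qed (use R6 fin defect_measurable[OF sub] in auto)
  \<comment> \<open>Half of \<open>R\<close> over the Lipschitz constant 1 + L of \<gamma>: this
    piece of the curve stays in the R-disc, and r \<le> R.\<close>
  define r where "r = R / 2 / (1 + L)"
  have r: "0 < r" "(1 + L) * r < R" "r \<le> R"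
  proof -
    show "0 < r" using R L by (simp add: r_def)
    have "1 + L \<noteq> 0" using L by linarith
    then have "(1 + L) * r = R / 2" unfolding r_def by (rule nonzero_mult_div_cancel_left[of "1 + L" "R / 2", folded times_divide_eq_right])
    then show "(1 + L) * r < R" using R by simp
    moreover have "1 * r \<le> (1 + L) * r" using L \<open>0 < r\<close> by (intro mult_right_mono) auto
    ultimately show "r \<le> R" by simp
  qed
  have inb: "\<gamma> t \<in> ball (\<gamma> t0) R" if "t \<in> {t0-r..t0+r}" for t
  proof -
    have "cmod (\<gamma> t0 - \<gamma> t) \<le> (1 + L) * \<bar>t0 - t\<bar>" by (rule \<gamma>L)
    also have "\<dots> \<le> (1 + L) * r" using that L by (intro mult_left_mono) auto
    finally show ?thesis using r by (simp add: dist_norm)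
  qed
  have inc: "\<gamma> t \<in> U" "\<phi> (\<gamma> t) < ereal C" if "t \<in> {t0-r..t0+r}" for t
  proof -
    have "dist (\<gamma> t0) (\<gamma> t) < R" using inb[OF that] by simp
    then have "\<gamma> t \<in> cball (\<gamma> t0) \<rho>" using R6 unfolding mem_cball by linarith
    then show "\<gamma> t \<in> U" "\<phi> (\<gamma> t) < ereal C" using sU bd by blast+
  qed
  have lsc: "\<exists>d>0. \<forall>w\<in>ball (\<gamma> t) d. ennreal c \<le> defect U \<phi> C w"
    if t: "t \<in> {t0-r..t0+r}" and c: "ennreal c < defect U \<phi> C (\<gamma> t)" for t c
  proof -
    note tU = inc[OF t]
    show ?thesis
    proof (cases "0 \<le> c")
      case True
      have "\<phi> (\<gamma> t) < ereal (C - c)"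
      proof (cases "\<phi> (\<gamma> t)")
        case (real x)
        then show ?thesis using c tU True by (simp add: defect_def ennreal_less_iff)
      qed (use tU in auto)
      moreover have "open {z \<in> U. \<phi> z < ereal (C - c)}" using sub by (auto simp: subharmonic_on_def)
      ultimately obtain d where d: "0 < d" "ball (\<gamma> t) d \<subseteq> {z \<in> U. \<phi> z < ereal (C - c)}"
        using tU by (metis (mono_tags, lifting) mem_Collect_eq open_contains_ball)
      have "ennreal c \<le> defect U \<phi> C w" if "w \<in> ball (\<gamma> t) d" for w
      proof -
        have w: "w \<in> U" "\<phi> w < ereal (C - c)" using d that by auto
        show ?thesis
        proof (cases "\<phi> w")
          case (real x)
          then show ?thesis using w by (simp add: defect_def ennreal_leI)
        qed (use w in \<open>auto simp: defect_def\<close>)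
      qed
      then show ?thesis using d by blast
    qed (auto simp: ennreal_neg intro!: exI[of _ 1])
  qed
  have contL: "continuous_on UNIV y" by (rule lipschitz_on_continuous_on[OF lip])
  have m: "\<gamma> \<in> borel_measurable borel" unfolding \<gamma>_def by (rule graph_curve_measurable[OF contL])
  have le: "t0 - r \<le> t0 + r" using r by simp
  obtain N :: nat and x where x: "\<And>i. i < N \<Longrightarrow> \<bar>x i - t0\<bar> \<le> 2 * R"
    and xfin: "(\<integral>\<^sup>+t\<in>{t0-r..t0+r}. ennreal (\<Prod>i<N. \<bar>t - x i\<bar> / (3 * R)) * eexp (defect U \<phi> C (\<gamma> t)) \<partial>lborel) < \<infinity>"
    using exp_superharmonic_integrable[OF le Re\<gamma> inb m lsc] unfolding Re\<gamma> by blast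
  \<comment> \<open>Since |t - x i| \<le> r + 2R \<le> 3R, this bounds the product of the
    \<open>N\<close> linear factors.\<close>
  define K where "K = ((1 + L) * (3 * R)) ^ N"
  have K: "0 < K" using L R by (simp add: K_def)
  define Q where "Q = smult (of_real (1 / K)) (\<Prod>i<N. [:- \<gamma> (x i), 1:])"
  have Q0: "Q \<noteq> 0" using K by (auto simp: Q_def)
  have Qle: "(cmod (poly Q (\<gamma> t)))\<^sup>2 \<le> (\<Prod>i<N. \<bar>t - x i\<bar> / (3 * R))" if t: "t \<in> {t0-r..t0+r}" for t
  proof -
    have "cmod (poly Q (\<gamma> t)) = (\<Prod>i<N. cmod (\<gamma> t - \<gamma> (x i))) / K"
      using K by (simp add: Q_def poly_prod prod_norm norm_mult norm_divide)
    then have "(cmod (poly Q (\<gamma> t)))\<^sup>2 * K\<^sup>2 = (\<Prod>i<N. (cmod (\<gamma> t - \<gamma> (x i)))\<^sup>2)"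
      using K by (simp add: prod_power_distrib power_divide)
    also have "\<dots> \<le> (\<Prod>i<N. ((1 + L) * (3 * R))\<^sup>2 * (\<bar>t - x i\<bar> / (3 * R)))"
    proof (intro prod_mono conjI)
      fix i assume "i \<in> {..<N}"
      then have le: "\<bar>t - x i\<bar> \<le> 3 * R" using x[of i] t r by auto
      have "(cmod (\<gamma> t - \<gamma> (x i)))\<^sup>2 \<le> ((1 + L) * \<bar>t - x i\<bar>)\<^sup>2" by (intro power_mono \<gamma>L) simp
      also have "\<dots> = ((1 + L) * (3 * R))\<^sup>2 * (\<bar>t - x i\<bar> / (3 * R))\<^sup>2" using R by (simp add: power_mult_distrib power_divide)
      also have "\<dots> \<le> ((1 + L) * (3 * R))\<^sup>2 * (\<bar>t - x i\<bar> / (3 * R))"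
      proof (rule mult_left_mono)
        have "0 \<le> \<bar>t - x i\<bar> / (3 * R)" "\<bar>t - x i\<bar> / (3 * R) \<le> 1" using le R by auto
        then show "(\<bar>t - x i\<bar> / (3 * R))\<^sup>2 \<le> \<bar>t - x i\<bar> / (3 * R)"
          unfolding power2_eq_square by (rule mult_left_le[rotated])
      qed simp
      finally show "(cmod (\<gamma> t - \<gamma> (x i)))\<^sup>2 \<le> ((1 + L) * (3 * R))\<^sup>2 * (\<bar>t - x i\<bar> / (3 * R))" .
    qed simp
    also have "\<dots> = (\<Prod>i<N. \<bar>t - x i\<bar> / (3 * R)) * K\<^sup>2"
      unfolding prod.distrib by (simp add: K_def power_mult[symmetric] mult.commute[of N])
    finally show ?thesis using K by simp
  qed
  have "(\<integral>\<^sup>+t\<in>{t0-r..t0+r}. ennreal ((cmod (poly Q (\<gamma> t)))\<^sup>2) * exp_neg (\<phi> (\<gamma> t)) \<partial>lborel)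
    \<le> (\<integral>\<^sup>+t\<in>{t0-r..t0+r}. ennreal (\<Prod>i<N. \<bar>t - x i\<bar> / (3 * R)) * eexp (defect U \<phi> C (\<gamma> t)) \<partial>lborel)"
  proof (intro nn_integral_mono)
    fix t
    show "ennreal ((cmod (poly Q (\<gamma> t)))\<^sup>2) * exp_neg (\<phi> (\<gamma> t)) * indicator {t0-r..t0+r} t
      \<le> ennreal (\<Prod>i<N. \<bar>t - x i\<bar> / (3 * R)) * eexp (defect U \<phi> C (\<gamma> t)) * indicator {t0-r..t0+r} t"
    proof (cases "t \<in> {t0-r..t0+r}")
      case True
      from inc[OF True] have "exp_neg (\<phi> (\<gamma> t)) \<le> eexp (defect U \<phi> C (\<gamma> t))"
        using exp_neg_le_eexp[of C] C by (simp add: defect_def)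
      then show ?thesis using True ennreal_leI[OF Qle[OF True]] by (auto intro!: mult_mono)
    qed simp
  qed
  also have "\<dots> < \<infinity>" by (rule xfin)
  finally show ?thesis using Q0 r unfolding \<gamma>_def by blast
qed

section \<open>Uniform approximation by polynomials on a graph\<close>

definition poly_approx :: "(real \<Rightarrow> complex) \<Rightarrow> real set \<Rightarrow> (real \<Rightarrow> complex) \<Rightarrow> bool" where
  "poly_approx \<gamma> K f \<longleftrightarrow> (\<forall>\<epsilon>>0. \<exists>p. \<forall>t\<in>K. cmod (f t - poly p (\<gamma> t)) < \<epsilon>)"

lemma poly_approx_poly: "poly_approx \<gamma> K (\<lambda>t. poly p (\<gamma> t))"
  unfolding poly_approx_def by (intro allI impI exI[of _ p]) simp

lemma poly_approx_const: "poly_approx \<gamma> K (\<lambda>t. c)"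
  using poly_approx_poly[of \<gamma> K "[:c:]"] by simp

lemma poly_approx_self: "poly_approx \<gamma> K \<gamma>"
  using poly_approx_poly[of \<gamma> K "[:0, 1:]"] by simp

lemma poly_approx_limit:
  assumes "\<And>\<epsilon>. 0 < \<epsilon> \<Longrightarrow> \<exists>g. poly_approx \<gamma> K g \<and> (\<forall>t\<in>K. cmod (f t - g t) < \<epsilon>)"
  shows "poly_approx \<gamma> K f"
  unfolding poly_approx_def
proof (intro allI impI)
  fix \<epsilon> :: real assume "0 < \<epsilon>"
  then obtain g where g: "poly_approx \<gamma> K g" "\<forall>t\<in>K. cmod (f t - g t) < \<epsilon> / 2"
    using assms[of "\<epsilon> / 2"] by auto
  obtain p where p: "\<forall>t\<in>K. cmod (g t - poly p (\<gamma> t)) < \<epsilon> / 2"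
    using g(1) \<open>0 < \<epsilon>\<close> unfolding poly_approx_def by (meson half_gt_zero)
  have "cmod (f t - poly p (\<gamma> t)) < \<epsilon>" if "t \<in> K" for t
  proof -
    have "cmod (f t - g t) + cmod (g t - poly p (\<gamma> t)) < \<epsilon>"
      using g(2)[rule_format, OF that] p[rule_format, OF that] by linarith
    from norm_triangle_lt[OF this] show ?thesis by simp
  qed
  then show "\<exists>p. \<forall>t\<in>K. cmod (f t - poly p (\<gamma> t)) < \<epsilon>" by blast
qed

lemma poly_approx_cong: "(\<And>t. t \<in> K \<Longrightarrow> f t = g t) \<Longrightarrow> poly_approx \<gamma> K f \<Longrightarrow> poly_approx \<gamma> K g"
  unfolding poly_approx_def by simp

lemma poly_approx_add:
  assumes "poly_approx \<gamma> K f" "poly_approx \<gamma> K g" shows "poly_approx \<gamma> K (\<lambda>t. f t + g t)"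
  unfolding poly_approx_def
proof (intro allI impI)
  fix \<epsilon> :: real assume "0 < \<epsilon>"
  then have h: "0 < \<epsilon> / 2" by simp
  obtain p where p: "\<forall>t\<in>K. cmod (f t - poly p (\<gamma> t)) < \<epsilon> / 2"
    using assms(1) h unfolding poly_approx_def by blast
  obtain q where q: "\<forall>t\<in>K. cmod (g t - poly q (\<gamma> t)) < \<epsilon> / 2"
    using assms(2) h unfolding poly_approx_def by blast
  have "cmod (f t + g t - poly (p + q) (\<gamma> t)) < \<epsilon>" if "t \<in> K" for t
  proof -
    have "cmod (f t - poly p (\<gamma> t)) + cmod (g t - poly q (\<gamma> t)) < \<epsilon>"
      using p[rule_format, OF that] q[rule_format, OF that] by linarith
    from norm_triangle_lt[OF this] show ?thesis by (simp add: algebra_simps)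
  qed
  then show "\<exists>p. \<forall>t\<in>K. cmod (f t + g t - poly p (\<gamma> t)) < \<epsilon>" by blast
qed

lemma poly_approx_bounded:
  assumes "poly_approx \<gamma> K f" and B: "\<And>t. t \<in> K \<Longrightarrow> cmod (\<gamma> t) \<le> B"
  shows "\<exists>M>0. \<forall>t\<in>K. cmod (f t) \<le> M"
proof -
  obtain p where p: "\<forall>t\<in>K. cmod (f t - poly p (\<gamma> t)) < 1"
    using assms(1) unfolding poly_approx_def by (meson zero_less_one)
  have "compact (poly p ` cball 0 B)"
    by (intro compact_continuous_image continuous_intros) auto
  then have "bounded (poly p ` cball 0 B)" by (rule compact_imp_bounded)
  then obtain M where M: "\<And>z. z \<in> poly p ` cball 0 B \<Longrightarrow> cmod z \<le> M"
    unfolding bounded_iff by blast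
  have "cmod (f t) \<le> \<bar>M\<bar> + 1" if "t \<in> K" for t
  proof -
    have "cmod (poly p (\<gamma> t)) \<le> M" using B[OF that] by (intro M imageI) auto
    then show ?thesis using p[rule_format, OF that] norm_triangle_sub[of "f t" "poly p (\<gamma> t)"] by linarith
  qed
  then show ?thesis by (intro exI[of _ "\<bar>M\<bar> + 1"]) auto
qed

lemma poly_approx_mult:
  assumes f: "poly_approx \<gamma> K f" and g: "poly_approx \<gamma> K g" and B: "\<And>t. t \<in> K \<Longrightarrow> cmod (\<gamma> t) \<le> B"
  shows "poly_approx \<gamma> K (\<lambda>t. f t * g t)"
  unfolding poly_approx_def
proof (intro allI impI)
  fix \<epsilon> :: real assume \<epsilon>: "0 < \<epsilon>"
  obtain M where M: "0 < M" "\<forall>t\<in>K. cmod (f t) \<le> M" using poly_approx_bounded[OF f B] by blast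
  have "0 < \<epsilon> / (2 * M)" using \<epsilon> M by simp
  then obtain q where q: "\<forall>t\<in>K. cmod (g t - poly q (\<gamma> t)) < \<epsilon> / (2 * M)"
    using g unfolding poly_approx_def by blast
  obtain M' where M': "0 < M'" "\<forall>t\<in>K. cmod (poly q (\<gamma> t)) \<le> M'"
    using poly_approx_bounded[OF poly_approx_poly[of \<gamma> K q] B] by blast
  have "0 < \<epsilon> / (2 * M')" using \<epsilon> M' by simp
  then obtain p where p: "\<forall>t\<in>K. cmod (f t - poly p (\<gamma> t)) < \<epsilon> / (2 * M')"
    using f unfolding poly_approx_def by blast
  have "cmod (f t * g t - poly (p * q) (\<gamma> t)) < \<epsilon>" if t: "t \<in> K" for t
  proof -
    have "f t * g t - poly (p * q) (\<gamma> t) = f t * (g t - poly q (\<gamma> t)) + (f t - poly p (\<gamma> t)) * poly q (\<gamma> t)"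
      by (simp add: algebra_simps)
    also have "cmod \<dots> \<le> cmod (f t) * cmod (g t - poly q (\<gamma> t)) + cmod (f t - poly p (\<gamma> t)) * cmod (poly q (\<gamma> t))"
      using norm_triangle_ineq by (metis norm_mult)
    also have "cmod (f t) * cmod (g t - poly q (\<gamma> t)) \<le> M * cmod (g t - poly q (\<gamma> t))"
      using M t by (intro mult_right_mono) auto
    also have "M * cmod (g t - poly q (\<gamma> t)) < M * (\<epsilon> / (2 * M))"
      using q t M by (intro mult_strict_left_mono) auto
    also have "cmod (f t - poly p (\<gamma> t)) * cmod (poly q (\<gamma> t)) \<le> \<epsilon> / (2 * M') * M'"
      using less_imp_le[OF p[rule_format, OF t]] M'(2)[rule_format, OF t] M'(1) \<epsilon> by (intro mult_mono) auto
    finally show ?thesis using M M' by simp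
  qed
  then show "\<exists>p. \<forall>t\<in>K. cmod (f t * g t - poly p (\<gamma> t)) < \<epsilon>" by blast
qed

lemma poly_approx_power:
  assumes f: "poly_approx \<gamma> K f" and B: "\<And>t. t \<in> K \<Longrightarrow> cmod (\<gamma> t) \<le> B"
  shows "poly_approx \<gamma> K (\<lambda>t. f t ^ n)"
  by (induction n) (auto intro!: poly_approx_const poly_approx_mult f B)

lemma poly_approx_sum:
  assumes "\<And>i. i \<in> I \<Longrightarrow> poly_approx \<gamma> K (f i)"
  shows "poly_approx \<gamma> K (\<lambda>t. \<Sum>i\<in>I. f i t)"
  using assms by (induction I rule: infinite_finite_induct) (auto intro!: poly_approx_const poly_approx_add)

text \<open>The Taylor polynomials of \<Phi> at 0 converge uniformly on the closed disc of radius
  \<rho> < r, and polynomials in \<open>q\<close> are again approximable.\<close>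

lemma poly_approx_holomorphic:
  assumes q: "poly_approx \<gamma> K q" and B: "\<And>t. t \<in> K \<Longrightarrow> cmod (\<gamma> t) \<le> B"
    and hol: "\<Phi> holomorphic_on ball 0 r" and \<rho>: "\<And>t. t \<in> K \<Longrightarrow> cmod (q t) \<le> \<rho>" "\<rho> < r" "0 \<le> \<rho>"
  shows "poly_approx \<gamma> K (\<lambda>t. \<Phi> (q t))"
proof (rule poly_approx_limit)
  fix \<epsilon> :: real assume \<epsilon>: "0 < \<epsilon>"
  define a where "a n = (deriv ^^ n) \<Phi> 0 / fact n" for n
  have sums: "(\<lambda>n. a n * w ^ n) sums \<Phi> w" if "w \<in> ball 0 r" for w
    using holomorphic_power_series[OF hol that] by (simp add: a_def)
  define \<sigma> where "\<sigma> = (\<rho> + r) / 2"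
  have \<sigma>: "\<rho> < \<sigma>" "\<sigma> < r" "0 < \<sigma>" using \<rho> by (auto simp: \<sigma>_def)
  have "summable (\<lambda>n. a n * (of_real \<sigma>) ^ n)" using sums[of "of_real \<sigma>"] \<sigma> by (auto simp: sums_iff)
  from conv_radius_geI[OF this] have "ereal \<rho> < conv_radius a"
    using \<sigma> by (simp add: less_le_trans[of "ereal \<rho>" "ereal \<sigma>"])
  from powser_uniform_limit[OF this, of 0]
  have "uniform_limit (cball 0 \<rho>) (\<lambda>n x. \<Sum>i<n. a i * x ^ i) (\<lambda>x. \<Sum>i. a i * x ^ i) sequentially" by simp
  then have "eventually (\<lambda>n. \<forall>x\<in>cball 0 \<rho>. dist (\<Sum>i<n. a i * x ^ i) (\<Sum>i. a i * x ^ i) < \<epsilon>) sequentially"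
    using \<epsilon> unfolding uniform_limit_iff by blast
  then obtain n where n: "\<forall>x\<in>cball 0 \<rho>. dist (\<Sum>i<n. a i * x ^ i) (\<Sum>i. a i * x ^ i) < \<epsilon>"
    by (auto simp: eventually_sequentially)
  have "cmod (\<Phi> (q t) - (\<Sum>i<n. a i * q t ^ i)) < \<epsilon>" if "t \<in> K" for t
  proof -
    have "q t \<in> cball 0 \<rho>" "q t \<in> ball 0 r" using \<rho>(1)[OF that] \<rho>(2) by auto
    moreover from sums[OF this(2)] have "(\<Sum>i. a i * q t ^ i) = \<Phi> (q t)" by (simp add: sums_iff)
    ultimately show ?thesis using n[rule_format, of "q t"] by (simp add: dist_norm norm_minus_commute)
  qed
  moreover have "poly_approx \<gamma> K (\<lambda>t. \<Sum>i<n. a i * q t ^ i)"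
    by (intro poly_approx_sum poly_approx_mult[OF poly_approx_const poly_approx_power[OF q B] B])
  ultimately show "\<exists>g. poly_approx \<gamma> K g \<and> (\<forall>t\<in>K. cmod (\<Phi> (q t) - g t) < \<epsilon>)" by blast
qed

text \<open>Reflection lets a branch point below the curve be treated by the case of a ray going
  upwards.\<close>

lemma poly_approx_uminus_curve:
  assumes "poly_approx (\<lambda>t. - \<gamma> t) K f" shows "poly_approx \<gamma> K f"
  unfolding poly_approx_def
proof (intro allI impI)
  fix \<epsilon> :: real assume "0 < \<epsilon>"
  then obtain p where "\<forall>t\<in>K. cmod (f t - poly p (- \<gamma> t)) < \<epsilon>" using assms unfolding poly_approx_def by blast
  then show "\<exists>p. \<forall>t\<in>K. cmod (f t - poly p (\<gamma> t)) < \<epsilon>"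
    by (intro exI[of _ "pcompose p [:0, -1:]"]) (simp add: poly_pcompose)
qed

text \<open>A real shift keeps the imaginary part, so both numbers lie in the same open half plane
  or on the positive axis. Their arguments differ by less than \<pi>, and no multiple of 2 \<pi>
  \<i> appears.\<close>

lemma Ln_diff_real_shift:
  assumes "Im X \<noteq> 0 \<or> (0 < Re X - s \<and> 0 < Re X)"
  shows "Ln (X - of_real s) = Ln X + Ln ((X - of_real s) / X)"
proof -
  have nz: "X \<noteq> 0" "X - of_real s \<noteq> 0" using assms by (auto simp: complex_eq_iff)
  have "\<bar>Im (Ln (X - of_real s)) - Im (Ln X)\<bar> < pi"
  proof -
    consider "0 < Im X" | "Im X < 0" | "Im X = 0" by linarith
    then show ?thesis
    proof cases
      case 1
      then show ?thesis using Im_Ln_pos_lt_imp[of X] Im_Ln_pos_lt_imp[of "X - of_real s"] by auto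
    next
      case 2
      have "-pi < Im (Ln z) \<and> Im (Ln z) < 0" if "Im z < 0" for z
      proof -
        have nz: "z \<noteq> 0" using that by auto
        then have "\<not> (0 \<le> Im (Ln z) \<and> Im (Ln z) \<le> pi)" using Im_Ln_pos_le[OF nz] that by simp
        then show ?thesis using mpi_less_Im_Ln[OF nz] Im_Ln_le_pi[OF nz] by linarith
      qed
      from this[of X] this[of "X - of_real s"] show ?thesis using 2 by auto
    next
      case 3
      then have "Im (Ln X) = 0" "Im (Ln (X - of_real s)) = 0" using assms nz by (auto simp: Im_Ln_eq_0)
      then show ?thesis by simp
    qed
  qed
  then have "Ln (exp (Ln (X - of_real s) - Ln X)) = Ln (X - of_real s) - Ln X"
    by (intro Ln_exp) auto
  moreover have "exp (Ln (X - of_real s) - Ln X) = (X - of_real s) / X" using nz by (simp add: exp_diff)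
  ultimately show ?thesis by simp
qed

text \<open>The branch point is moved to \<open>\<zeta>\<close> from far away, where the logarithm is a convergent power series
  on the curve, along the vertical ray above \<open>\<zeta>\<close>, in steps shorter than the distance to the curve.\<close>
lemma poly_approx_Ln:
  assumes B: "\<And>t. t \<in> K \<Longrightarrow> cmod (\<gamma> t) \<le> B" and d: "0 < d"
    and far: "\<And>t \<tau>. t \<in> K \<Longrightarrow> 0 \<le> \<tau> \<Longrightarrow> d \<le> cmod (\<gamma> t - \<zeta> - \<i> * of_real \<tau>)"
  shows "poly_approx \<gamma> K (\<lambda>t. Ln (\<i> * (\<gamma> t - \<zeta>)))"
proof -
  \<comment> \<open>The inverse is carried along with the logarithm because the step downwards
    expands in powers of a multiple of it.\<close>
  define good where "good \<tau> \<longleftrightarrow> poly_approx \<gamma> K (\<lambda>t. inverse (\<gamma> t - \<zeta> - \<i> * of_real \<tau>)) \<and>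
    poly_approx \<gamma> K (\<lambda>t. Ln (\<i> * (\<gamma> t - \<zeta> - \<i> * of_real \<tau>)))" for \<tau>
  define B' where "B' = \<bar>B\<bar>"
  have B': "\<And>t. t \<in> K \<Longrightarrow> cmod (\<gamma> t) \<le> B'" "0 \<le> B'"
    unfolding B'_def using order_trans[OF B abs_ge_self] by auto
  \<comment> \<open>From this height on, the branch point lies above the disc of radius
    \<open>B'\<close> about 0, so power series at 0 apply.\<close>
  define T where "T = B' + 1 - Im \<zeta>"
  have base: "good \<tau>" if "T \<le> \<tau>" for \<tau>
  proof -
    let ?r = "\<tau> + Im \<zeta>"
    have r: "B' < ?r" using that by (simp add: T_def)
    have pos: "0 < Re (\<i> * (w - \<zeta> - \<i> * of_real \<tau>))" if "w \<in> ball 0 ?r" for w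
      using that abs_Im_le_cmod[of w] by simp
    have "w - \<zeta> - \<i> * of_real \<tau> \<noteq> 0" if "w \<in> ball 0 ?r" for w
      using pos[OF that] by (metis mult_zero_right less_irrefl zero_complex.sel(1))
    then have h1: "(\<lambda>w. inverse (w - \<zeta> - \<i> * of_real \<tau>)) holomorphic_on ball 0 ?r"
      by (intro holomorphic_intros) auto
    have "\<i> * (w - \<zeta> - \<i> * of_real \<tau>) \<notin> \<real>\<^sub>\<le>\<^sub>0" if "w \<in> ball 0 ?r" for w
      using pos[OF that] by (auto simp: complex_nonpos_Reals_iff)
    then have h2: "(\<lambda>w. Ln (\<i> * (w - \<zeta> - \<i> * of_real \<tau>))) holomorphic_on ball 0 ?r"
      by (intro holomorphic_intros) auto
    show ?thesis
      unfolding good_def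
      by (intro conjI poly_approx_holomorphic[OF poly_approx_self[of \<gamma> K] B'(1) h1 B'(1) r B'(2)]
        poly_approx_holomorphic[OF poly_approx_self[of \<gamma> K] B'(1) h2 B'(1) r B'(2)])
  qed
  have step: "good \<tau>" if "0 \<le> \<tau>" "good (\<tau> + d / 2)" for \<tau>
  proof -
    \<comment> \<open>Half the distance to the curve makes the ratio \<open>q\<close> at most 1/2 in
      modulus.\<close>
    define s where "s = d / 2"
    define u where "u t = inverse (\<gamma> t - \<zeta> - \<i> * of_real (\<tau> + s))" for t
    define q where "q t = \<i> * of_real s * u t" for t
    have pu: "poly_approx \<gamma> K u" and pl: "poly_approx \<gamma> K (\<lambda>t. Ln (\<i> * (\<gamma> t - \<zeta> - \<i> * of_real (\<tau> + s))))"
      using that(2) unfolding good_def u_def s_def by auto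
    have pq: "poly_approx \<gamma> K q"
      unfolding q_def by (rule poly_approx_mult[OF poly_approx_const pu B])
    have nz: "\<gamma> t - \<zeta> - \<i> * of_real (\<tau> + s) \<noteq> 0" if "t \<in> K" for t
      using far[OF that, of "\<tau> + s"] d \<open>0 \<le> \<tau>\<close> by (auto simp: s_def)
    have qle: "cmod (q t) \<le> 1 / 2" if "t \<in> K" for t
    proof -
      define A where "A = \<gamma> t - \<zeta> - \<i> * of_real (\<tau> + s)"
      have "d \<le> cmod A" unfolding A_def using \<open>0 \<le> \<tau>\<close> d by (intro far that) (auto simp: s_def)
      then have "inverse (cmod A) \<le> inverse d" using d by (intro le_imp_inverse_le)
      then have "s * inverse (cmod A) \<le> s * inverse d" using d by (intro mult_left_mono) (auto simp: s_def)
      moreover have "cmod (q t) = s * inverse (cmod A)"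
        unfolding q_def u_def A_def[symmetric] using d by (simp add: norm_mult norm_inverse s_def)
      ultimately show ?thesis using d by (simp add: s_def)
    qed
    have eq: "\<gamma> t - \<zeta> - \<i> * of_real \<tau> = (\<gamma> t - \<zeta> - \<i> * of_real (\<tau> + s)) * (1 + q t)" if "t \<in> K" for t
    proof -
      define A where "A = \<gamma> t - \<zeta> - \<i> * of_real (\<tau> + s)"
      have "A * u t = 1" using nz[OF that] by (simp add: u_def A_def)
      moreover have "A * (1 + q t) = A + \<i> * of_real s * (A * u t)" unfolding q_def by (simp add: algebra_simps)
      ultimately have "A * (1 + q t) = A + \<i> * of_real s" by simp
      then show ?thesis unfolding A_def by (simp add: algebra_simps)
    qed
    have n1: "1 + w \<notin> \<real>\<^sub>\<le>\<^sub>0" "1 + w \<noteq> 0" if "w \<in> ball 0 1" for w :: complex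
      using that abs_Re_le_cmod[of w] by (auto simp: complex_nonpos_Reals_iff complex_eq_iff)
    have h1: "(\<lambda>w::complex. inverse (1 + w)) holomorphic_on ball 0 1" using n1 by (intro holomorphic_intros) auto
    have h2: "(\<lambda>w::complex. Ln (1 + w)) holomorphic_on ball 0 1" using n1 by (intro holomorphic_intros) auto
    have half: "(1::real) / 2 < 1" "(0::real) \<le> 1 / 2" by auto
    note a1 = poly_approx_holomorphic[OF pq B h1 qle half]
    note a2 = poly_approx_holomorphic[OF pq B h2 qle half]
    have "poly_approx \<gamma> K (\<lambda>t. inverse (\<gamma> t - \<zeta> - \<i> * of_real \<tau>))"
      by (rule poly_approx_cong[OF _ poly_approx_mult[OF pu a1 B]]) (simp add: eq u_def)
    moreover have "poly_approx \<gamma> K (\<lambda>t. Ln (\<i> * (\<gamma> t - \<zeta> - \<i> * of_real \<tau>)))"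
    proof (rule poly_approx_cong[OF _ poly_approx_add[OF pl a2]])
      fix t assume t: "t \<in> K"
      define X where "X = \<i> * (\<gamma> t - \<zeta> - \<i> * of_real (\<tau> + s))"
      have X: "X - of_real s = \<i> * (\<gamma> t - \<zeta> - \<i> * of_real \<tau>)" by (simp add: X_def algebra_simps)
      have "X \<noteq> 0" using nz[OF t] by (simp add: X_def)
      have "(X - of_real s) / X = 1 + q t"
        unfolding X using eq[OF t] nz[OF t] by (simp add: X_def)
      moreover have "Im X \<noteq> 0 \<or> (0 < Re X - s \<and> 0 < Re X)"
      proof (cases "Im X = 0")
        case True
        then have re: "Re (\<gamma> t - \<zeta>) = 0" by (simp add: X_def)
        \<comment> \<open>On the vertical line through \<zeta> the distance condition keeps the
          curve off the upward ray, hence below \<zeta>; then both numbers are positive.\<close>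
        have "0 < Im \<zeta> + \<tau> - Im (\<gamma> t)"
        proof (rule ccontr)
          assume "\<not> 0 < Im \<zeta> + \<tau> - Im (\<gamma> t)"
          then have "0 \<le> Im (\<gamma> t - \<zeta>)" using \<open>0 \<le> \<tau>\<close> by simp
          from far[OF t this] have "d \<le> cmod (\<gamma> t - \<zeta> - \<i> * of_real (Im (\<gamma> t - \<zeta>)))" .
          moreover have "\<gamma> t - \<zeta> - \<i> * of_real (Im (\<gamma> t - \<zeta>)) = 0" using re by (simp add: complex_eq_iff)
          ultimately show False using d by simp
        qed
        then show ?thesis using d by (simp add: X_def s_def)
      qed simp
      from Ln_diff_real_shift[OF this] have "Ln (X - of_real s) = Ln X + Ln ((X - of_real s) / X)" .
      ultimately show "Ln (\<i> * (\<gamma> t - \<zeta> - \<i> * of_real (\<tau> + s))) + Ln (1 + q t) = Ln (\<i> * (\<gamma> t - \<zeta> - \<i> * of_real \<tau>))"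
        unfolding X[symmetric] X_def[symmetric] by simp
    qed
    ultimately show ?thesis unfolding good_def by blast
  qed
  have all: "good \<tau>" if "0 \<le> \<tau>" "T - real n * (d / 2) \<le> \<tau>" for n \<tau>
    using that
  proof (induction n arbitrary: \<tau>)
    case 0
    then show ?case using base by simp
  next
    case (Suc n)
    have "good (\<tau> + d / 2)" using Suc.prems d by (intro Suc.IH) (auto simp: algebra_simps add_divide_distrib)
    then show ?case using step Suc.prems by blast
  qed
  obtain n :: nat where "T / (d / 2) < real n" using reals_Archimedean2 by blast
  then have "T - real n * (d / 2) \<le> 0" using d by (simp add: field_simps)
  then have "good 0" by (intro all[of 0 n]) auto
  then show ?thesis unfolding good_def by simp
qed

section \<open>Mean square approximation by polynomials on a graph\<close>

text \<open>The difference \<open>w\<close> satisfies h \<le> |Im w| + L |Re w| by the Lipschitz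
  condition, and both parts are at most |w|. Growth in \<open>h\<close> is what keeps whole vertical
  rays away from the curve.\<close>

lemma graph_vertical_distance:
  assumes lip: "L-lipschitz_on UNIV y" and "0 \<le> h"
  shows "h / (1 + L) \<le> cmod (graph_curve y t - graph_curve y c - \<i> * of_real h)"
    and "h / (1 + L) \<le> cmod (graph_curve y t - graph_curve y c + \<i> * of_real h)"
proof -
  have L: "0 \<le> L" by (rule lipschitz_on_nonneg[OF lip])
  have yL: "\<bar>y t - y c\<bar> \<le> L * \<bar>t - c\<bar>" using lipschitz_onD[OF lip, of t c] by (simp add: dist_real_def)
  have main: "h / (1 + L) \<le> cmod w" if re: "\<bar>Re w\<bar> = \<bar>t - c\<bar>" and im: "h \<le> \<bar>Im w\<bar> + L * \<bar>t - c\<bar>" for w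
  proof -
    have "h \<le> cmod w + L * cmod w"
      using im re abs_Im_le_cmod[of w] abs_Re_le_cmod[of w] L mult_left_mono[of "\<bar>t - c\<bar>" "cmod w" L] by linarith
    then show ?thesis using L by (simp add: divide_le_eq algebra_simps)
  qed
  show "h / (1 + L) \<le> cmod (graph_curve y t - graph_curve y c - \<i> * of_real h)"
    using yL assms(2) by (intro main) (auto simp: graph_curve_def)
  show "h / (1 + L) \<le> cmod (graph_curve y t - graph_curve y c + \<i> * of_real h)"
    using yL assms(2) by (intro main) (auto simp: graph_curve_def)
qed

text \<open>The branch points lie at height \<open>h\<close> above and below \<gamma>(c), with cuts
  running vertically away from the curve. As \<open>h\<close> tends to 0 the moduli cancel and the
  difference of the arguments remains, which changes sign at \<open>c\<close>.\<close>

definition log_step :: "(real \<Rightarrow> real) \<Rightarrow> real \<Rightarrow> real \<Rightarrow> real \<Rightarrow> complex" where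
  "log_step y c h t = Ln (\<i> * (graph_curve y t - graph_curve y c - \<i> * of_real h))
     - Ln (- (\<i> * (graph_curve y t - graph_curve y c + \<i> * of_real h)))"

lemma log_step_args:
  assumes "0 < h"
  shows "\<i> * (graph_curve y t - graph_curve y c - \<i> * of_real h) \<notin> \<real>\<^sub>\<le>\<^sub>0"
    and "- (\<i> * (graph_curve y t - graph_curve y c + \<i> * of_real h)) \<notin> \<real>\<^sub>\<le>\<^sub>0"
  using assms by (auto simp: complex_nonpos_Reals_iff graph_curve_def)

lemma log_step_continuous:
  assumes "continuous_on UNIV y" "0 < h" shows "continuous_on UNIV (log_step y c h)"
proof -
  have "continuous_on UNIV (graph_curve y)"
    unfolding graph_curve_def[abs_def] Complex_eq by (intro continuous_intros assms)
  then show ?thesis unfolding log_step_def[abs_def] using log_step_args[OF assms(2)]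
    by (intro continuous_intros) auto
qed

lemma poly_approx_log_step:
  assumes lip: "L-lipschitz_on UNIV y" and h: "0 < h"
  shows "poly_approx (graph_curve y) {a..b} (log_step y c h)"
proof -
  let ?\<gamma> = "graph_curve y"
  have L: "0 \<le> L" by (rule lipschitz_on_nonneg[OF lip])
  have "continuous_on UNIV y" by (rule lipschitz_on_continuous_on[OF lip])
  then have "continuous_on {a..b} ?\<gamma>"
    unfolding graph_curve_def[abs_def] Complex_eq by (intro continuous_intros) (auto elim: continuous_on_subset)
  then have "bounded (?\<gamma> ` {a..b})" by (intro compact_imp_bounded compact_continuous_image) auto
  then obtain B where B: "\<And>t. t \<in> {a..b} \<Longrightarrow> cmod (?\<gamma> t) \<le> B" unfolding bounded_iff by blast
  have B': "\<And>t. t \<in> {a..b} \<Longrightarrow> cmod (- ?\<gamma> t) \<le> B" using B by simp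
  define d where "d = h / (1 + L)"
  have d: "0 < d" using h L by (simp add: d_def)
  have dle: "d \<le> (h + \<tau>) / (1 + L)" if "0 \<le> \<tau>" for \<tau>
    unfolding d_def using that L by (intro divide_right_mono) auto
  have far1: "d \<le> cmod (?\<gamma> t - (?\<gamma> c + \<i> * of_real h) - \<i> * of_real \<tau>)" if "0 \<le> \<tau>" for t \<tau>
    using order_trans[OF dle[OF that] graph_vertical_distance(1)[OF lip, of "h + \<tau>" t c]] h that
    by (simp add: algebra_simps)
  have far2: "d \<le> cmod (- ?\<gamma> t - (- ?\<gamma> c + \<i> * of_real h) - \<i> * of_real \<tau>)" if "0 \<le> \<tau>" for t \<tau>
  proof -
    have "- ?\<gamma> t - (- ?\<gamma> c + \<i> * of_real h) - \<i> * of_real \<tau> = - (?\<gamma> t - ?\<gamma> c + \<i> * of_real (h + \<tau>))"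
      by (simp add: algebra_simps)
    then show ?thesis
      using order_trans[OF dle[OF that] graph_vertical_distance(2)[OF lip, of "h + \<tau>" t c]] h that
      by (simp only: norm_minus_cancel)
  qed
  have 1: "poly_approx ?\<gamma> {a..b} (\<lambda>t. Ln (\<i> * (?\<gamma> t - (?\<gamma> c + \<i> * of_real h))))"
    by (rule poly_approx_Ln[OF B d far1])
  have 2: "poly_approx ?\<gamma> {a..b} (\<lambda>t. Ln (\<i> * (- ?\<gamma> t - (- ?\<gamma> c + \<i> * of_real h))))"
    by (rule poly_approx_uminus_curve, rule poly_approx_Ln[OF B' d far2])
  have 3: "poly_approx ?\<gamma> {a..b} (\<lambda>t. -1 * Ln (\<i> * (- ?\<gamma> t - (- ?\<gamma> c + \<i> * of_real h))))"
    by (rule poly_approx_mult[OF poly_approx_const 2 B])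
  show ?thesis
    by (rule poly_approx_cong[OF _ poly_approx_add[OF 1 3]]) (simp add: log_step_def algebra_simps)
qed

text \<open>The real part is the logarithm of the ratio of the distances to the two branch points.
  These are 2h apart and each is at least h / (1 + L) from the curve, so each distance is at most 3
  + 2L times the other. The bound is free of \<open>h\<close>, as dominated convergence
  needs.\<close>

lemma log_step_bounded:
  assumes lip: "L-lipschitz_on UNIV y" and h: "0 < h"
  shows "cmod (log_step y c h t) \<le> ln (3 + 2 * L) + 2 * pi"
proof -
  have L: "0 \<le> L" by (rule lipschitz_on_nonneg[OF lip])
  define w where "w = graph_curve y t - graph_curve y c"
  define p where "p = cmod (w - \<i> * of_real h)"
  define q where "q = cmod (w + \<i> * of_real h)"
  have hp: "h \<le> (1 + L) * p" "h \<le> (1 + L) * q"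
    using graph_vertical_distance[OF lip, of h t c] h L unfolding p_def q_def w_def by (simp_all add: divide_le_eq mult.commute)
  have pos: "0 < p" "0 < q"
    using hp h L order_less_le_trans[OF h hp(1)] order_less_le_trans[OF h hp(2)] by (auto simp: zero_less_mult_iff)
  have "q \<le> p + 2 * h"
    using norm_triangle_ineq[of "w - \<i> * of_real h" "2 * (\<i> * of_real h)"] h unfolding p_def q_def by (simp add: norm_mult algebra_simps)
  then have qp: "q \<le> (3 + 2 * L) * p" using hp by (simp add: algebra_simps)
  have "p \<le> q + 2 * h"
    using norm_triangle_ineq4[of "w + \<i> * of_real h" "2 * (\<i> * of_real h)"] h unfolding p_def q_def by (simp add: norm_mult algebra_simps)
  then have pq: "p \<le> (3 + 2 * L) * q" using hp by (simp add: algebra_simps)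
  have "ln q \<le> ln ((3 + 2 * L) * p)" "ln p \<le> ln ((3 + 2 * L) * q)"
    using qp pq pos by (meson ln_mono)+
  moreover have "ln ((3 + 2 * L) * p) = ln (3 + 2 * L) + ln p" "ln ((3 + 2 * L) * q) = ln (3 + 2 * L) + ln q"
    using pos L by (intro ln_mult_pos; simp)+
  ultimately have "ln q \<le> ln (3 + 2 * L) + ln p" "ln p \<le> ln (3 + 2 * L) + ln q" by simp_all
  then have re: "\<bar>ln p - ln q\<bar> \<le> ln (3 + 2 * L)" by linarith
  let ?X = "\<i> * (w - \<i> * of_real h)" and ?Y = "- (\<i> * (w + \<i> * of_real h))"
  have nz: "?X \<noteq> 0" "?Y \<noteq> 0" using pos by (auto simp: p_def q_def)
  have "Re (log_step y c h t) = ln p - ln q"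
    unfolding log_step_def w_def[symmetric] p_def q_def using nz by (simp add: norm_mult)
  moreover have "\<bar>Im (log_step y c h t)\<bar> \<le> 2 * pi"
    unfolding log_step_def w_def[symmetric]
    using mpi_less_Im_Ln[OF nz(1)] Im_Ln_le_pi[OF nz(1)] mpi_less_Im_Ln[OF nz(2)] Im_Ln_le_pi[OF nz(2)] by (simp del: mult_minus_right)
  ultimately show ?thesis using re cmod_le[of "log_step y c h t"] by linarith
qed

text \<open>For t \<noteq> c the limit is Ln u - Ln (- u) with u off the real axis, that is \<i>
  \<pi> or its negative; at t = c the two logarithms coincide, in accordance with sgn 0 = 0.\<close>

lemma log_step_tendsto:
  "(\<lambda>n. log_step y c (inverse (real (Suc n))) t) \<longlonglongrightarrow> \<i> * of_real (pi * sgn (t - c))"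
proof (cases "t = c")
  case True
  have "log_step y c (inverse (real (Suc n))) t = 0" for n
  proof -
    have "\<i> * (0 - \<i> * of_real (inverse (real (Suc n)))) = of_real (inverse (real (Suc n)))"
      "- (\<i> * (0 + \<i> * of_real (inverse (real (Suc n))))) = of_real (inverse (real (Suc n)))"
      by (simp_all add: algebra_simps)
    then show ?thesis unfolding log_step_def True by simp
  qed
  then show ?thesis using True by simp
next
  case False
  define w where "w = graph_curve y t - graph_curve y c"
  have w: "Re w = t - c" by (simp add: w_def graph_curve_def)
  have h: "(\<lambda>n. complex_of_real (inverse (real (Suc n)))) \<longlonglongrightarrow> of_real 0"
    by (intro tendsto_of_real LIMSEQ_inverse_real_of_nat)
  have n1: "\<i> * (w - \<i> * of_real 0) \<notin> \<real>\<^sub>\<le>\<^sub>0" "- (\<i> * (w + \<i> * of_real 0)) \<notin> \<real>\<^sub>\<le>\<^sub>0"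
    using w False by (auto simp: complex_nonpos_Reals_iff)
  have "(\<lambda>n. log_step y c (inverse (real (Suc n))) t) \<longlonglongrightarrow> Ln (\<i> * (w - \<i> * of_real 0)) - Ln (- (\<i> * (w + \<i> * of_real 0)))"
    unfolding log_step_def w_def[symmetric]
    by (intro tendsto_intros h n1)
  also have "Ln (\<i> * (w - \<i> * of_real 0)) - Ln (- (\<i> * (w + \<i> * of_real 0))) = \<i> * of_real (pi * sgn (t - c))"
  proof -
    have "\<i> * w \<noteq> 0" using w False by auto
    from Ln_minus[OF this] show ?thesis using w False by (auto simp: sgn_if)
  qed
  finally show ?thesis .
qed

section \<open>Mean square closure of the polynomials for a finite measure\<close>

lemma ennreal_cmod_square_triangle: "ennreal ((cmod (u - w))\<^sup>2) \<le> 2 * ennreal ((cmod (u - v))\<^sup>2) + 2 * ennreal ((cmod (v - w))\<^sup>2)"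
proof -
  have "cmod (u - w) \<le> cmod (u - v) + cmod (v - w)" using norm_triangle_ineq[of "u - v" "v - w"] by simp
  then have "(cmod (u - w))\<^sup>2 \<le> (cmod (u - v) + cmod (v - w))\<^sup>2" by (intro power_mono) auto
  also have "\<dots> \<le> 2 * (cmod (u - v))\<^sup>2 + 2 * (cmod (v - w))\<^sup>2"
    using sum_squares_bound[of "cmod (u - v)" "cmod (v - w)"] by (simp add: power2_sum)
  finally have "ennreal ((cmod (u - w))\<^sup>2) \<le> ennreal (2 * (cmod (u - v))\<^sup>2 + 2 * (cmod (v - w))\<^sup>2)" by (rule ennreal_leI)
  then show ?thesis by (simp add: ennreal_mult)
qed

locale graph_measure = finite_measure \<mu> for \<mu> :: "real measure" +
  fixes y :: "real \<Rightarrow> real" and L a b :: real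
  assumes lip: "L-lipschitz_on UNIV y" and sets_\<mu>: "sets \<mu> = sets borel" and supp: "AE t in \<mu>. t \<in> {a..b}"
begin

definition approx :: "(real \<Rightarrow> complex) \<Rightarrow> bool" where
  "approx f \<longleftrightarrow> f \<in> borel_measurable borel \<and>
    (\<forall>\<epsilon>>0. \<exists>p. (\<integral>\<^sup>+t. ennreal ((cmod (f t - poly p (graph_curve y t)))\<^sup>2) \<partial>\<mu>) < ennreal \<epsilon>)"

lemma meas_cong [measurable_cong]: "sets \<mu> = sets borel" by (rule sets_\<mu>)

lemma space_\<mu> [simp]: "space \<mu> = UNIV" using sets_eq_imp_space_eq[OF sets_\<mu>] by simp

lemma \<gamma>_cont: "continuous_on UNIV (graph_curve y)"
  unfolding graph_curve_def[abs_def] Complex_eq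
  by (intro continuous_intros lipschitz_on_continuous_on[OF lip])

lemma poly_meas [measurable]: "(\<lambda>t. poly p (graph_curve y t)) \<in> borel_measurable borel"
  by (intro borel_measurable_continuous_onI continuous_on_compose2[OF _ \<gamma>_cont, of UNIV "poly p"] continuous_intros) auto

lemma square_integral_triangle:
  assumes [measurable]: "f \<in> borel_measurable borel" "g \<in> borel_measurable borel" "h \<in> borel_measurable borel"
    and 1: "(\<integral>\<^sup>+t. ennreal ((cmod (f t - g t))\<^sup>2) \<partial>\<mu>) < ennreal (\<epsilon> / 4)"
    and 2: "(\<integral>\<^sup>+t. ennreal ((cmod (g t - h t))\<^sup>2) \<partial>\<mu>) < ennreal (\<epsilon> / 4)" and \<epsilon>: "0 < \<epsilon>"
  shows "(\<integral>\<^sup>+t. ennreal ((cmod (f t - h t))\<^sup>2) \<partial>\<mu>) < ennreal \<epsilon>"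
proof -
  have "(\<integral>\<^sup>+t. ennreal ((cmod (f t - h t))\<^sup>2) \<partial>\<mu>)
    \<le> (\<integral>\<^sup>+t. 2 * ennreal ((cmod (f t - g t))\<^sup>2) + 2 * ennreal ((cmod (g t - h t))\<^sup>2) \<partial>\<mu>)"
    by (intro nn_integral_mono ennreal_cmod_square_triangle)
  also have "\<dots> = 2 * (\<integral>\<^sup>+t. ennreal ((cmod (f t - g t))\<^sup>2) \<partial>\<mu>) + 2 * (\<integral>\<^sup>+t. ennreal ((cmod (g t - h t))\<^sup>2) \<partial>\<mu>)"
    by (simp add: nn_integral_add nn_integral_cmult)
  also have "\<dots> < 2 * ennreal (\<epsilon> / 4) + 2 * ennreal (\<epsilon> / 4)"
    by (intro add_strict_mono ennreal_mult_strict_left_mono 1 2) auto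
  also have "\<dots> = ennreal \<epsilon>"
  proof -
    have "2 * ennreal (\<epsilon> / 4) = ennreal (\<epsilon> / 2)" using \<epsilon> by (simp add: ennreal_mult'[of 2, symmetric, simplified])
    then show ?thesis using \<epsilon> by (simp flip: ennreal_plus)
  qed
  finally show ?thesis .
qed

lemma approx_limit:
  assumes [measurable]: "f \<in> borel_measurable borel"
    and lim: "\<And>\<epsilon>. 0 < \<epsilon> \<Longrightarrow> \<exists>g. approx g \<and> (\<integral>\<^sup>+t. ennreal ((cmod (f t - g t))\<^sup>2) \<partial>\<mu>) < ennreal \<epsilon>"
  shows "approx f"
  unfolding approx_def
proof (intro conjI allI impI)
  fix \<epsilon> :: real assume \<epsilon>: "0 < \<epsilon>"
  then have e: "0 < \<epsilon> / 4" by simp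
  obtain g where g: "approx g" "(\<integral>\<^sup>+t. ennreal ((cmod (f t - g t))\<^sup>2) \<partial>\<mu>) < ennreal (\<epsilon> / 4)" using lim[OF e] by blast
  have [measurable]: "g \<in> borel_measurable borel" using g by (simp add: approx_def)
  obtain p where "(\<integral>\<^sup>+t. ennreal ((cmod (g t - poly p (graph_curve y t)))\<^sup>2) \<partial>\<mu>) < ennreal (\<epsilon> / 4)"
    using g(1) e unfolding approx_def by blast
  from square_integral_triangle[OF _ _ _ g(2) this \<epsilon>]
  show "\<exists>p. (\<integral>\<^sup>+t. ennreal ((cmod (f t - poly p (graph_curve y t)))\<^sup>2) \<partial>\<mu>) < ennreal \<epsilon>" by auto
qed fact

lemma approx_const: "approx (\<lambda>t. c)"
  unfolding approx_def by (intro conjI allI impI exI[of _ "[:c:]"]) auto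

lemma approx_add:
  assumes f: "approx f" and g: "approx g" shows "approx (\<lambda>t. f t + g t)"
  unfolding approx_def
proof (intro conjI allI impI)
  have [measurable]: "f \<in> borel_measurable borel" "g \<in> borel_measurable borel" using f g by (auto simp: approx_def)
  show "(\<lambda>t. f t + g t) \<in> borel_measurable borel" by measurable
  fix \<epsilon> :: real assume \<epsilon>: "0 < \<epsilon>"
  then have e: "0 < \<epsilon> / 4" by simp
  obtain p where p: "(\<integral>\<^sup>+t. ennreal ((cmod (f t - poly p (graph_curve y t)))\<^sup>2) \<partial>\<mu>) < ennreal (\<epsilon> / 4)"
    using f e unfolding approx_def by blast
  obtain q where q: "(\<integral>\<^sup>+t. ennreal ((cmod (g t - poly q (graph_curve y t)))\<^sup>2) \<partial>\<mu>) < ennreal (\<epsilon> / 4)"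
    using g e unfolding approx_def by blast
  have "(\<integral>\<^sup>+t. ennreal ((cmod (f t + g t - poly (p + q) (graph_curve y t)))\<^sup>2) \<partial>\<mu>) < ennreal \<epsilon>"
    by (rule square_integral_triangle[where g="\<lambda>t. poly p (graph_curve y t) + g t"])
      (use p q \<epsilon> in \<open>auto simp: algebra_simps\<close>)
  then show "\<exists>p. (\<integral>\<^sup>+t. ennreal ((cmod (f t + g t - poly p (graph_curve y t)))\<^sup>2) \<partial>\<mu>) < ennreal \<epsilon>" by blast
qed

lemma approx_cmult:
  assumes f: "approx f" shows "approx (\<lambda>t. c * f t)"
proof (cases "c = 0")
  case True
  then show ?thesis using approx_const[of 0] by simp
next
  case False
  have [measurable]: "f \<in> borel_measurable borel" using f by (auto simp: approx_def)
  show ?thesis unfolding approx_def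
  proof (intro conjI allI impI)
    fix \<epsilon> :: real assume \<epsilon>: "0 < \<epsilon>"
    define C where "C = (cmod c)\<^sup>2"
    have C: "0 < C" using False by (simp add: C_def)
    then have "0 < \<epsilon> / C" using \<epsilon> by simp
    then obtain p where p: "(\<integral>\<^sup>+t. ennreal ((cmod (f t - poly p (graph_curve y t)))\<^sup>2) \<partial>\<mu>) < ennreal (\<epsilon> / C)"
      using f unfolding approx_def by blast
    have "(\<integral>\<^sup>+t. ennreal ((cmod (c * f t - poly (smult c p) (graph_curve y t)))\<^sup>2) \<partial>\<mu>)
      = (\<integral>\<^sup>+t. ennreal C * ennreal ((cmod (f t - poly p (graph_curve y t)))\<^sup>2) \<partial>\<mu>)"
      by (intro nn_integral_cong)
        (simp add: C_def norm_mult power_mult_distrib flip: ennreal_mult right_diff_distrib)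
    also have "\<dots> = ennreal C * (\<integral>\<^sup>+t. ennreal ((cmod (f t - poly p (graph_curve y t)))\<^sup>2) \<partial>\<mu>)"
      by (simp add: nn_integral_cmult)
    also have "\<dots> < ennreal C * ennreal (\<epsilon> / C)" using p C by (intro ennreal_mult_strict_left_mono) auto
    also have "\<dots> = ennreal \<epsilon>" using C \<epsilon> by (simp flip: ennreal_mult)
    finally show "\<exists>p. (\<integral>\<^sup>+t. ennreal ((cmod (c * f t - poly p (graph_curve y t)))\<^sup>2) \<partial>\<mu>) < ennreal \<epsilon>" by blast
  qed measurable
qed

lemma approx_sum: "(\<And>i. i \<in> I \<Longrightarrow> approx (f i)) \<Longrightarrow> approx (\<lambda>t. \<Sum>i\<in>I. f i t)"
  by (induction I rule: infinite_finite_induct) (auto intro!: approx_const approx_add)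

lemma approx_uniform:
  assumes [measurable]: "f \<in> borel_measurable borel" and f: "poly_approx (graph_curve y) {a..b} f"
  shows "approx f"
  unfolding approx_def
proof (intro conjI allI impI)
  fix \<epsilon> :: real assume \<epsilon>: "0 < \<epsilon>"
  \<comment> \<open>The added 1 covers the zero measure and makes the final inequality
    strict.\<close>
  define M where "M = measure \<mu> UNIV + 1"
  have M: "0 < M" by (simp add: M_def add_nonneg_pos)
  define e where "e = sqrt (\<epsilon> / M)"
  have e: "0 < e" "e\<^sup>2 = \<epsilon> / M" using \<epsilon> M by (auto simp: e_def)
  obtain p where p: "\<forall>t\<in>{a..b}. cmod (f t - poly p (graph_curve y t)) < e"
    using f e(1) unfolding poly_approx_def by blast
  have "(\<integral>\<^sup>+t. ennreal ((cmod (f t - poly p (graph_curve y t)))\<^sup>2) \<partial>\<mu>) \<le> (\<integral>\<^sup>+t. ennreal (\<epsilon> / M) \<partial>\<mu>)"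
    using supp
  proof (intro nn_integral_mono_AE, eventually_elim)
    case (elim t)
    have "(cmod (f t - poly p (graph_curve y t)))\<^sup>2 \<le> e\<^sup>2"
      by (rule power_mono[OF less_imp_le[OF p[rule_format, OF elim(2)]]]) simp
    then show ?case unfolding e(2) by (rule ennreal_leI)
  qed
  also have "\<dots> = ennreal (\<epsilon> / M * measure \<mu> UNIV)"
    using \<epsilon> M unfolding nn_integral_const space_\<mu> emeasure_eq_measure by (intro ennreal_mult[symmetric]) auto
  also have "\<dots> < ennreal \<epsilon>"
  proof (rule ennreal_lessI[OF \<epsilon>])
    have "\<epsilon> * measure \<mu> UNIV < \<epsilon> * M" using \<epsilon> by (simp add: M_def)
    then show "\<epsilon> / M * measure \<mu> UNIV < \<epsilon>" using M by (simp add: field_simps)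
  qed
  finally show "\<exists>p. (\<integral>\<^sup>+t. ennreal ((cmod (f t - poly p (graph_curve y t)))\<^sup>2) \<partial>\<mu>) < ennreal \<epsilon>" by blast
qed fact

lemma approx_dominated_limit:
  assumes F: "\<And>n. approx (F n)" and [measurable]: "f \<in> borel_measurable borel"
    and lim: "\<And>t. (\<lambda>n. F n t) \<longlonglongrightarrow> f t"
    and bd: "\<And>n t. cmod (f t - F n t) \<le> B t" and [measurable]: "B \<in> borel_measurable borel"
    and fin: "(\<integral>\<^sup>+t. ennreal ((B t)\<^sup>2) \<partial>\<mu>) < \<infinity>"
  shows "approx f"
proof (rule approx_limit)
  fix \<epsilon> :: real assume \<epsilon>: "0 < \<epsilon>"
  have [measurable]: "F n \<in> borel_measurable borel" for n using F by (auto simp: approx_def)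
  have "(\<lambda>n. \<integral>\<^sup>+t. ennreal ((cmod (f t - F n t))\<^sup>2) \<partial>\<mu>) \<longlonglongrightarrow> (\<integral>\<^sup>+t. 0 \<partial>\<mu>)"
  proof (rule nn_integral_dominated_convergence[where w="\<lambda>t. ennreal ((B t)\<^sup>2)"])
    show "AE t in \<mu>. ennreal ((cmod (f t - F n t))\<^sup>2) \<le> ennreal ((B t)\<^sup>2)" for n
      using bd by (intro AE_I2 ennreal_leI power_mono) auto
    show "AE t in \<mu>. (\<lambda>n. ennreal ((cmod (f t - F n t))\<^sup>2)) \<longlonglongrightarrow> 0"
    proof (intro AE_I2)
      fix t
      have "(\<lambda>n. (cmod (f t - F n t))\<^sup>2) \<longlonglongrightarrow> (cmod (f t - f t))\<^sup>2" by (intro tendsto_intros lim)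
      then show "(\<lambda>n. ennreal ((cmod (f t - F n t))\<^sup>2)) \<longlonglongrightarrow> 0"
        using tendsto_ennrealI[of "\<lambda>n. (cmod (f t - F n t))\<^sup>2" 0] by simp
    qed
  qed (use fin in auto)
  then have "eventually (\<lambda>n. (\<integral>\<^sup>+t. ennreal ((cmod (f t - F n t))\<^sup>2) \<partial>\<mu>) < ennreal \<epsilon>) sequentially"
    using \<epsilon> by (intro order_tendstoD(2)) auto
  then show "\<exists>g. approx g \<and> (\<integral>\<^sup>+t. ennreal ((cmod (f t - g t))\<^sup>2) \<partial>\<mu>) < ennreal \<epsilon>"
    using F by (auto simp: eventually_sequentially)
qed fact

lemma approx_bounded_limit:
  assumes F: "\<And>n. approx (F n)" and lim: "\<And>t. (\<lambda>n. F n t) \<longlonglongrightarrow> f t" and bd: "\<And>n t. cmod (F n t) \<le> B"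
  shows "approx f"
proof -
  have [measurable]: "F n \<in> borel_measurable borel" for n using F by (auto simp: approx_def)
  have m: "f \<in> borel_measurable borel" by (rule borel_measurable_LIMSEQ_metric[OF _ lim]) auto
  have "cmod (f t) \<le> B" for t
    by (rule LIMSEQ_le_const2[OF tendsto_norm[OF lim]]) (use bd in auto)
  then have "cmod (f t - F n t) \<le> 2 * B" for n t
    using norm_triangle_ineq4[of "f t" "F n t"] bd[of n t] \<open>\<And>t. cmod (f t) \<le> B\<close>[of t] by linarith
  then show ?thesis
    by (intro approx_dominated_limit[OF F m lim, where B="\<lambda>_. 2 * B"])
      (auto simp: emeasure_eq_measure ennreal_mult_less_top)
qed

lemma approx_sgn: "approx (\<lambda>t. of_real (sgn (t - c)))"
proof -
  have "approx (\<lambda>t. \<i> * of_real (pi * sgn (t - c)))"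
  proof (rule approx_bounded_limit[OF _ log_step_tendsto])
    show "approx (log_step y c (inverse (real (Suc n))))" for n
      by (intro approx_uniform poly_approx_log_step[OF lip] borel_measurable_continuous_onI log_step_continuous
          lipschitz_on_continuous_on[OF lip]) auto
    show "cmod (log_step y c (inverse (real (Suc n))) t) \<le> ln (3 + 2 * L) + 2 * pi" for n t
      by (rule log_step_bounded[OF lip]) simp
  qed
  from approx_cmult[OF this, of "1 / (\<i> * of_real pi)"] show ?thesis by simp
qed

lemma approx_atMost: "approx (\<lambda>t. indicator {..c} t)"
proof (rule approx_bounded_limit)
  \<comment> \<open>The jump is placed slightly to the right of \<open>c\<close>, so that the value
    at \<open>c\<close> is 1 and not 1/2.\<close>
  let ?F = "\<lambda>n t. 1 / 2 + (- 1 / 2) * complex_of_real (sgn (t - (c + inverse (real (Suc n)))))"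
  show "approx (?F n)" for n by (intro approx_add approx_const approx_cmult approx_sgn)
  show "cmod (?F n t) \<le> 1" for n t by (auto simp: sgn_if)
  fix t
  show "(\<lambda>n. ?F n t) \<longlonglongrightarrow> indicator {..c} t"
  proof (cases "t \<le> c")
    case True
    have "?F n t = 1" for n
    proof -
      have "0 < inverse (real (Suc n))" by simp
      then have "t - (c + inverse (real (Suc n))) < 0" using True by linarith
      then show ?thesis by (simp only: sgn_neg) simp
    qed
    then show ?thesis using True by simp
  next
    case False
    have "(\<lambda>n. c + inverse (real (Suc n))) \<longlonglongrightarrow> c + 0" by (intro tendsto_intros LIMSEQ_inverse_real_of_nat)
    then have "eventually (\<lambda>n. c + inverse (real (Suc n)) < t) sequentially"
      using False by (intro order_tendstoD(2)) auto
    then have "eventually (\<lambda>n. ?F n t = 0) sequentially" by eventually_elim (simp add: sgn_if)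
    then show ?thesis using False by (simp add: tendsto_eventually)
  qed
qed

text \<open>Closed half-lines generate the Borel sets and are stable under intersection; linear
  combinations give complements, and bounded pointwise limits give countable disjoint
  unions.\<close>

lemma approx_indicator:
  assumes "S \<in> sets borel" shows "approx (\<lambda>t. indicator S t)"
proof -
  let ?G = "range (\<lambda>c::real. {..c})"
  have "Int_stable ?G"
  proof (rule Int_stableI)
    fix A B assume "A \<in> ?G" "B \<in> ?G"
    then obtain c d where "A = {..c}" "B = {..d}" by blast
    then have "A \<inter> B = {..min c d}" by auto
    then show "A \<inter> B \<in> ?G" by blast
  qed
  moreover have "?G \<subseteq> Pow UNIV" by simp
  moreover have "S \<in> sigma_sets UNIV ?G" using assms unfolding borel_eq_atMost by simp
  ultimately show ?thesis
  proof (induction S rule: sigma_sets_induct_disjoint)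
    case (basic A)
    then show ?case using approx_atMost by auto
  next
    case empty
    then show ?case using approx_const[of 0] by simp
  next
    case (compl A)
    have "(\<lambda>t. indicator (UNIV - A) t) = (\<lambda>t. 1 + (-1) * (indicator A t :: complex))"
      by (auto simp: indicator_def)
    then show ?case using approx_add[OF approx_const[of 1] approx_cmult[OF compl(2), of "-1"]] by simp
  next
    case (union A)
    show ?case
    proof (rule approx_bounded_limit)
      let ?F = "\<lambda>n t. \<Sum>i<n. indicator (A i) t :: complex"
      show "approx (?F n)" for n using union by (intro approx_sum) auto
      have eq: "?F n t = indicator (\<Union>i<n. A i) t" for n t
        using union(1) by (subst indicator_UN_disjoint) (auto simp: disjoint_family_on_def)
      show "cmod (?F n t) \<le> 1" for n t unfolding eq by (simp add: indicator_def)
      fix t show "(\<lambda>n. ?F n t) \<longlonglongrightarrow> indicator (\<Union>i. A i) t"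
        unfolding eq by (rule LIMSEQ_indicator_UN)
    qed
  qed
qed

text \<open>Simple functions bounded by 2 |f| converge to \<open>f\<close>, so 3 |f| dominates the
  error.\<close>

lemma approx_square_integrable:
  assumes f [measurable]: "f \<in> borel_measurable borel" and fin: "(\<integral>\<^sup>+t. ennreal ((cmod (f t))\<^sup>2) \<partial>\<mu>) < \<infinity>"
  shows "approx f"
proof -
  obtain F where F: "\<And>i. simple_function borel (F i)" and lim: "\<And>t. (\<lambda>i. F i t) \<longlonglongrightarrow> f t"
    and bd: "\<And>i t. cmod (F i t) \<le> 2 * cmod (f t)"
    using borel_measurable_implies_sequence_metric[OF f, of 0] by (auto simp: dist_norm)
  show ?thesis
  proof (rule approx_dominated_limit[OF _ f lim])
    show "approx (F i)" for i
    proof -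
      have fr: "finite (range (F i))" using F[of i] by (simp add: simple_function_def)
      have eq: "(\<Sum>v\<in>range (F i). v * indicator (F i -` {v}) t) = F i t" for t
        using fr by (simp add: indicator_def sum.delta' if_distrib cong: if_cong)
      have "approx (\<lambda>t. \<Sum>v\<in>range (F i). v * indicator (F i -` {v}) t)"
        using F[of i] by (intro approx_sum approx_cmult approx_indicator) (auto simp: simple_function_def)
      then show ?thesis by (simp only: eq)
    qed
    show "cmod (f t - F n t) \<le> 3 * cmod (f t)" for n t
      using norm_triangle_ineq4[of "f t" "F n t"] bd[of n t] by linarith
    have "(\<integral>\<^sup>+t. ennreal ((3 * cmod (f t))\<^sup>2) \<partial>\<mu>) = 9 * (\<integral>\<^sup>+t. ennreal ((cmod (f t))\<^sup>2) \<partial>\<mu>)"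
      by (simp add: power_mult_distrib ennreal_mult nn_integral_cmult)
    then show "(\<integral>\<^sup>+t. ennreal ((3 * cmod (f t))\<^sup>2) \<partial>\<mu>) < \<infinity>"
      using fin by (simp add: ennreal_mult_less_top)
  qed measurable
qed

end

section \<open>Density in the weighted space\<close>

lemma exp_neg_measurable [measurable]: "exp_neg \<in> borel_measurable borel"
proof -
  have eq: "exp_neg = (\<lambda>x. if x = \<infinity> then 0 else if x = -\<infinity> then \<infinity> else ennreal (exp (- real_of_ereal x)))"
  proof
    fix x show "exp_neg x = (if x = \<infinity> then 0 else if x = -\<infinity> then \<infinity> else ennreal (exp (- real_of_ereal x)))"
      by (cases x) (auto simp: exp_neg_def)
  qed
  show ?thesis unfolding eq by measurable
qed

lemma subharmonic_weight_measurable: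
  assumes "subharmonic_on U \<phi>" "continuous_on UNIV y"
  shows "(\<lambda>t. exp_neg (if graph_curve y t \<in> U then \<phi> (graph_curve y t) else 0)) \<in> borel_measurable borel"
proof -
  note m = measurable_compose[OF graph_curve_measurable[OF assms(2)] subharmonic_measurable[OF assms(1), of 0]]
  show ?thesis by (rule measurable_compose[OF m exp_neg_measurable])
qed

text \<open>Compactness of [a, b] leaves finitely many local polynomials; in their product each
  interval needs only its own factor, the others being bounded on the curve.\<close>

lemma subharmonic_polynomial:
  assumes sub: "subharmonic_on U \<phi>" and lip: "L-lipschitz_on UNIV y" and gU: "graph_curve y ` {a..b} \<subseteq> U"
  shows "\<exists>Q::complex poly. Q \<noteq> 0 \<and>
    (\<integral>\<^sup>+t\<in>{a..b}. ennreal ((cmod (poly Q (graph_curve y t)))\<^sup>2) * exp_neg (\<phi> (graph_curve y t)) \<partial>lborel) < \<infinity>"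
proof -
  define \<gamma> where "\<gamma> = graph_curve y"
  have cy: "continuous_on UNIV y" by (rule lipschitz_on_continuous_on[OF lip])
  define w where "w t = exp_neg (if \<gamma> t \<in> U then \<phi> (\<gamma> t) else 0)" for t
  have [measurable]: "w \<in> borel_measurable borel"
    unfolding w_def \<gamma>_def by (rule subharmonic_weight_measurable[OF sub cy])
  have w: "exp_neg (\<phi> (\<gamma> t)) = w t" if "t \<in> {a..b}" for t
  proof -
    have "\<gamma> t \<in> U" using gU that unfolding \<gamma>_def by blast
    then show ?thesis by (simp add: w_def)
  qed
  have c\<gamma>: "continuous_on UNIV \<gamma>"
    unfolding \<gamma>_def graph_curve_def[abs_def] Complex_eq by (intro continuous_intros cy)
  have cp: "continuous_on S (\<lambda>t. poly p (\<gamma> t))" for p S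
    by (intro continuous_on_compose2[OF _ continuous_on_subset[OF c\<gamma>], of UNIV "poly p"] continuous_intros) auto
  then have [measurable]: "(\<lambda>t. poly p (\<gamma> t)) \<in> borel_measurable borel" for p
    by (intro borel_measurable_continuous_onI)
  define G where "G t0 r Q \<longleftrightarrow> 0 < r \<and> Q \<noteq> 0 \<and>
    (\<integral>\<^sup>+t\<in>{t0-r..t0+r}. ennreal ((cmod (poly Q (\<gamma> t)))\<^sup>2) * exp_neg (\<phi> (\<gamma> t)) \<partial>lborel) < \<infinity>" for t0 r Q
  have "\<exists>r Q. G t0 r Q" if "t0 \<in> {a..b}" for t0
  proof -
    have "graph_curve y t0 \<in> U" using gU that by blast
    from subharmonic_local_polynomial[OF sub lip this] show ?thesis unfolding G_def \<gamma>_def by blast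
  qed
  then obtain r Q where G: "\<And>t0. t0 \<in> {a..b} \<Longrightarrow> G t0 (r t0) (Q t0)" by metis
  have rQ: "0 < r t0" "Q t0 \<noteq> 0"
    "(\<integral>\<^sup>+t\<in>{t0-r t0..t0+r t0}. ennreal ((cmod (poly (Q t0) (\<gamma> t)))\<^sup>2) * exp_neg (\<phi> (\<gamma> t)) \<partial>lborel) < \<infinity>"
    if "t0 \<in> {a..b}" for t0
    using G[OF that] unfolding G_def by blast+
  obtain T where T: "T \<subseteq> {a..b}" "finite T" "{a..b} \<subseteq> (\<Union>s\<in>T. {s - r s<..<s + r s})"
  proof (rule compactE_image[of "{a..b}" "{a..b}" "\<lambda>s. {s - r s<..<s + r s}"])
    show "{a..b} \<subseteq> (\<Union>s\<in>{a..b}. {s - r s<..<s + r s})"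
      using rQ(1) by (intro subsetI UN_I) auto
  qed auto
  define P where "P = (\<Prod>s\<in>T. Q s)"
  have P0: "P \<noteq> 0" unfolding P_def using T rQ(2) by (auto simp: subset_iff)
  have "\<exists>M. \<forall>t\<in>{a..b}. (cmod (poly (\<Prod>u\<in>T-{s}. Q u) (\<gamma> t)))\<^sup>2 \<le> M" for s
  proof -
    have "bounded ((\<lambda>t. (cmod (poly (\<Prod>u\<in>T-{s}. Q u) (\<gamma> t)))\<^sup>2) ` {a..b})"
      by (intro compact_imp_bounded compact_continuous_image continuous_intros cp) auto
    then show ?thesis unfolding bounded_iff by (auto intro: order_trans[OF abs_ge_self])
  qed
  then obtain M where M: "\<And>s t. t \<in> {a..b} \<Longrightarrow> (cmod (poly (\<Prod>u\<in>T-{s}. Q u) (\<gamma> t)))\<^sup>2 \<le> M s" by metis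
  let ?q = "\<lambda>s t. ennreal ((cmod (poly (Q s) (\<gamma> t)))\<^sup>2) * w t * indicator ({s - r s..s + r s} \<inter> {a..b}) t"
  have "(\<integral>\<^sup>+t\<in>{a..b}. ennreal ((cmod (poly P (\<gamma> t)))\<^sup>2) * exp_neg (\<phi> (\<gamma> t)) \<partial>lborel)
    \<le> (\<integral>\<^sup>+t. (\<Sum>s\<in>T. ennreal (M s) * ?q s t) \<partial>lborel)"
  proof (intro nn_integral_mono)
    fix t
    show "ennreal ((cmod (poly P (\<gamma> t)))\<^sup>2) * exp_neg (\<phi> (\<gamma> t)) * indicator {a..b} t \<le> (\<Sum>s\<in>T. ennreal (M s) * ?q s t)"
    proof (cases "t \<in> {a..b}")
      case True
      then obtain s where s: "s \<in> T" "t \<in> {s - r s<..<s + r s}" using T(3) by blast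
      have "poly P (\<gamma> t) = poly (Q s) (\<gamma> t) * poly (\<Prod>u\<in>T-{s}. Q u) (\<gamma> t)"
        unfolding P_def prod.remove[OF T(2) s(1)] by simp
      then have "(cmod (poly P (\<gamma> t)))\<^sup>2 = (cmod (poly (\<Prod>u\<in>T-{s}. Q u) (\<gamma> t)))\<^sup>2 * (cmod (poly (Q s) (\<gamma> t)))\<^sup>2"
        by (simp add: norm_mult power_mult_distrib)
      also have "\<dots> \<le> M s * (cmod (poly (Q s) (\<gamma> t)))\<^sup>2" using M[OF True, of s] by (intro mult_right_mono) auto
      finally have "ennreal ((cmod (poly P (\<gamma> t)))\<^sup>2) \<le> ennreal (M s) * ennreal ((cmod (poly (Q s) (\<gamma> t)))\<^sup>2)"
        using ennreal_leI by (simp add: ennreal_mult'' flip: ennreal_mult'')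
      then have "ennreal ((cmod (poly P (\<gamma> t)))\<^sup>2) * exp_neg (\<phi> (\<gamma> t)) * indicator {a..b} t \<le> ennreal (M s) * ?q s t"
        using True s(2) by (auto simp: w mult.assoc[symmetric] intro!: mult_right_mono)
      also have "\<dots> \<le> (\<Sum>s\<in>T. ennreal (M s) * ?q s t)" using T s by (intro member_le_sum) auto
      finally show ?thesis .
    qed simp
  qed
  also have "\<dots> = (\<Sum>s\<in>T. ennreal (M s) * (\<integral>\<^sup>+t. ?q s t \<partial>lborel))"
    by (subst nn_integral_sum) (auto simp: nn_integral_cmult)
  also have "\<dots> < \<infinity>"
  proof -
    have "(\<integral>\<^sup>+t. ?q s t \<partial>lborel) < \<infinity>" if "s \<in> T" for s
    proof -
      have "(\<integral>\<^sup>+t. ?q s t \<partial>lborel) \<le> (\<integral>\<^sup>+t\<in>{s-r s..s+r s}. ennreal ((cmod (poly (Q s) (\<gamma> t)))\<^sup>2) * exp_neg (\<phi> (\<gamma> t)) \<partial>lborel)"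
        by (intro nn_integral_mono) (auto simp: w split: split_indicator)
      also have "\<dots> < \<infinity>" using rQ(3)[of s] T that by blast
      finally show ?thesis .
    qed
    then show ?thesis using T(2) by (auto simp: ennreal_mult_less_top)
  qed
  finally show ?thesis using P0 unfolding \<gamma>_def by blast
qed

text \<open>Clamping is 1-Lipschitz. The extension gives the curve a full interval around each end
  point, and points above zeros that fall outside [a, b].\<close>

lemma lipschitz_clamp:
  fixes y :: "real \<Rightarrow> real"
  assumes "a \<le> b" "L-lipschitz_on {a..b} y"
  shows "L-lipschitz_on UNIV (\<lambda>t. y (max a (min b t)))"
proof (rule lipschitz_onI)
  fix s t :: real
  have "dist (y (max a (min b s))) (y (max a (min b t))) \<le> L * dist (max a (min b s)) (max a (min b t))"
    using assms by (intro lipschitz_onD) auto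
  also have "dist (max a (min b s)) (max a (min b t)) \<le> dist s t"
    by (auto simp: dist_real_def max_def min_def)
  finally show "dist (y (max a (min b s))) (y (max a (min b t))) \<le> L * dist s t"
    using lipschitz_on_nonneg[OF assms(2)] by (simp add: mult_left_mono)
qed (rule lipschitz_on_nonneg[OF assms(2)])

text \<open>At points of non-differentiability, \<open>deriv\<close> has a fixed default value; hence differentiability
  almost everywhere plays no role.\<close>
lemma deriv_lipschitz_bounded:
  fixes y :: "real \<Rightarrow> real"
  assumes "L-lipschitz_on {a..b} y"
  shows "\<exists>K. \<forall>t\<in>{a<..<b}. \<bar>deriv y t\<bar> \<le> K"
proof (intro exI ballI)
  define d0 where "d0 = (SOME D::real. False)"
  fix t assume t: "t \<in> {a<..<b}"
  show "\<bar>deriv y t\<bar> \<le> max L \<bar>d0\<bar>"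
  proof (cases "\<exists>D. (y has_field_derivative D) (at t)")
    case True
    then have "(y has_field_derivative deriv y t) (at t)" using DERIV_imp_deriv by blast
    then have lim: "((\<lambda>s. \<bar>(y s - y t) / (s - t)\<bar>) \<longlongrightarrow> \<bar>deriv y t\<bar>) (at t)"
      unfolding has_field_derivative_iff by (intro tendsto_intros)
    have "eventually (\<lambda>s. s \<in> {a<..<b}) (at t)" using t by (intro eventually_at_in_open') auto
    then have "eventually (\<lambda>s. \<bar>(y s - y t) / (s - t)\<bar> \<le> L) (at t)"
    proof eventually_elim
      case (elim s)
      have "\<bar>y s - y t\<bar> \<le> L * \<bar>s - t\<bar>"
        using lipschitz_onD[OF assms, of s t] t elim by (simp add: dist_real_def)
      then show ?case using lipschitz_on_nonneg[OF assms] by (cases "s = t") (auto simp: abs_divide divide_le_eq)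
    qed
    then have "\<bar>deriv y t\<bar> \<le> L" by (intro tendsto_upperbound[OF lim]) auto
    then show ?thesis by simp
  next
    case False
    then have "deriv y t = d0" by (simp add: deriv_def d0_def)
    then show ?thesis by simp
  qed
qed

lemma lebesgue_on_ex_borel_complex:
  fixes f :: "real \<Rightarrow> complex"
  assumes "f \<in> borel_measurable (lebesgue_on {a..b})"
  shows "\<exists>f'\<in>borel_measurable borel. AE t in lborel. t \<in> {a..b} \<longrightarrow> f t = f' t"
proof -
  let ?g = "\<lambda>t. if t \<in> {a..b} then f t else 0"
  have "?g \<in> borel_measurable lebesgue" using assms by (subst borel_measurable_if) auto
  then have m: "(\<lambda>t. Re (?g t)) \<in> borel_measurable lebesgue" "(\<lambda>t. Im (?g t)) \<in> borel_measurable lebesgue" by auto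
  obtain u where u: "u \<in> borel_measurable lborel" "AE t in lborel. Re (?g t) = u t"
    using completion_ex_borel_measurable_real[OF m(1)] by blast
  obtain v where v: "v \<in> borel_measurable lborel" "AE t in lborel. Im (?g t) = v t"
    using completion_ex_borel_measurable_real[OF m(2)] by blast
  have "AE t in lborel. t \<in> {a..b} \<longrightarrow> f t = Complex (u t) (v t)"
    using u(2) v(2) by eventually_elim (auto simp: complex_eq_iff)
  moreover have "(\<lambda>t. Complex (u t) (v t)) \<in> borel_measurable borel" using u(1) v(1) by measurable
  ultimately show ?thesis by (rule bexI)
qed

theorem theorem1p1:
  fixes a b :: real and y :: "real \<Rightarrow> real" and \<phi> :: "complex \<Rightarrow> ereal"
    and U :: "complex set" and f :: "complex \<Rightarrow> complex" and \<epsilon> :: real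
  assumes "a < b"
    and "\<exists>L. L-lipschitz_on {a..b} y"
    and "graph_curve y ` {a..b} \<subseteq> U"
    and "subharmonic_on U \<phi>"
    and "in_wL2 a b y \<phi> f"
    and "\<epsilon> > 0"
  shows "\<exists>P :: complex poly. wL2sq a b y \<phi> (\<lambda>z. f z - poly P z) < ennreal \<epsilon>"
proof -
  note sub = assms(4)
  obtain L where L: "L-lipschitz_on {a..b} y" using assms(2) by blast
  \<comment> \<open>The extension serves the measure and the polynomials; \<open>deriv y\<close>
    below still refers to the original function.\<close>
  define y' where "y' t = y (max a (min b t))" for t
  have lip: "L-lipschitz_on UNIV y'"
    unfolding y'_def using lipschitz_clamp[OF _ L] assms(1) by simp
  define \<gamma> where "\<gamma> = graph_curve y'"
  have \<gamma>: "graph_curve y t = \<gamma> t" if "t \<in> {a..b}" for t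
    using that by (simp add: \<gamma>_def graph_curve_def y'_def)
  have gU: "graph_curve y' ` {a..b} \<subseteq> U" using assms(3) \<gamma> unfolding \<gamma>_def by auto
  have cy: "continuous_on UNIV y'" by (rule lipschitz_on_continuous_on[OF lip])
  define w where "w t = exp_neg (if \<gamma> t \<in> U then \<phi> (\<gamma> t) else 0)" for t
  have [measurable]: "w \<in> borel_measurable borel"
    unfolding w_def \<gamma>_def by (rule subharmonic_weight_measurable[OF sub cy])
  have w: "exp_neg (\<phi> (\<gamma> t)) = w t" if "t \<in> {a..b}" for t
  proof -
    have "\<gamma> t \<in> U" using gU that unfolding \<gamma>_def by blast
    then show ?thesis by (simp add: w_def)
  qed
  have c\<gamma>: "continuous_on UNIV \<gamma>"
    unfolding \<gamma>_def graph_curve_def[abs_def] Complex_eq by (intro continuous_intros cy)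
  have [measurable]: "(\<lambda>t. poly p (\<gamma> t)) \<in> borel_measurable borel" for p
    by (intro borel_measurable_continuous_onI continuous_on_compose2[OF _ c\<gamma>, of UNIV "poly p"] continuous_intros) auto
  obtain Q :: "complex poly" where Q0: "Q \<noteq> 0" and Qfin:
    "(\<integral>\<^sup>+t\<in>{a..b}. ennreal ((cmod (poly Q (\<gamma> t)))\<^sup>2) * exp_neg (\<phi> (\<gamma> t)) \<partial>lborel) < \<infinity>"
    using subharmonic_polynomial[OF sub lip gU] unfolding \<gamma>_def by blast
  have "(\<lambda>t. f (graph_curve y t)) \<in> borel_measurable (lebesgue_on {a..b})" using assms(5) by (simp add: in_wL2_def)
  from lebesgue_on_ex_borel_complex[OF this]
  obtain F0 where F0 [measurable]: "F0 \<in> borel_measurable borel"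
    and F0eq: "AE t in lborel. t \<in> {a..b} \<longrightarrow> f (graph_curve y t) = F0 t" by (rule bexE)
  \<comment> \<open>The arc length factor is left out of the measure and enters only through the
    bounds 1 and \<open>K\<close>.\<close>
  define W where "W t = ennreal ((cmod (poly Q (\<gamma> t)))\<^sup>2) * w t * indicator {a..b} t" for t
  have [measurable]: "W \<in> borel_measurable borel" unfolding W_def by measurable
  define \<mu> where "\<mu> = density lborel W"
  have "(\<integral>\<^sup>+t. W t \<partial>lborel) = (\<integral>\<^sup>+t\<in>{a..b}. ennreal ((cmod (poly Q (\<gamma> t)))\<^sup>2) * exp_neg (\<phi> (\<gamma> t)) \<partial>lborel)"
    by (intro nn_integral_cong) (auto simp: W_def w split: split_indicator)
  then have fm: "finite_measure \<mu>"
    using Qfin by (intro finite_measureI) (simp add: \<mu>_def emeasure_density)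
  interpret graph_measure \<mu> y' L a b
  proof (intro graph_measure.intro fm graph_measure_axioms.intro lip)
    show "AE t in \<mu>. t \<in> {a..b}"
      unfolding \<mu>_def by (subst AE_density) (auto simp: W_def indicator_def)
  qed (simp add: \<mu>_def)
  \<comment> \<open>At zeros of \<open>Q\<close> the quotient is 0, so |Q F| \<le> |F0| everywhere;
    equality holds off finitely many parameters.\<close>
  define F where "F t = F0 t / poly Q (\<gamma> t)" for t
  have [measurable]: "F \<in> borel_measurable borel" unfolding F_def by measurable
  have "(\<integral>\<^sup>+t. ennreal ((cmod (F t))\<^sup>2) \<partial>\<mu>) = (\<integral>\<^sup>+t. W t * ennreal ((cmod (F t))\<^sup>2) \<partial>lborel)"
    unfolding \<mu>_def by (rule nn_integral_density) measurable
  also have "\<dots> \<le> wL2sq a b y \<phi> f"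
    unfolding wL2sq_def using F0eq
  proof (intro nn_integral_mono_AE, eventually_elim)
    case (elim t)
    show ?case
    proof (cases "t \<in> {a..b}")
      case True
      have "cmod (poly Q (\<gamma> t)) * cmod (F t) \<le> cmod (F0 t)" by (simp add: F_def norm_divide)
      then have "(cmod (poly Q (\<gamma> t)) * cmod (F t))\<^sup>2 \<le> (cmod (F0 t))\<^sup>2" by (intro power_mono) auto
      then have "ennreal ((cmod (poly Q (\<gamma> t)))\<^sup>2) * ennreal ((cmod (F t))\<^sup>2) \<le> ennreal ((cmod (F0 t))\<^sup>2)"
        by (simp add: power_mult_distrib ennreal_leI flip: ennreal_mult)
      then have "ennreal ((cmod (poly Q (\<gamma> t)))\<^sup>2) * ennreal ((cmod (F t))\<^sup>2) * w t * 1
          \<le> ennreal ((cmod (F0 t))\<^sup>2) * w t * ennreal (sqrt (1 + (deriv y t)\<^sup>2))"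
        by (intro mult_mono) auto
      then show ?thesis using True elim by (simp add: W_def \<gamma> w mult_ac)
    qed (simp add: W_def)
  qed
  also have "\<dots> < \<infinity>" using assms(5) by (simp add: in_wL2_def)
  finally have "approx F" by (intro approx_square_integrable) auto
  obtain K0 where K0: "\<And>t. t \<in> {a<..<b} \<Longrightarrow> \<bar>deriv y t\<bar> \<le> K0" using deriv_lipschitz_bounded[OF L] by blast
  define K where "K = sqrt (1 + K0\<^sup>2)"
  have K: "0 < K" by (simp add: K_def add_pos_nonneg)
  have Kle: "sqrt (1 + (deriv y t)\<^sup>2) \<le> K" if "t \<in> {a<..<b}" for t
    unfolding K_def using power_mono[OF K0[OF that] abs_ge_zero, of 2] by simp
  have "0 < \<epsilon> / K" using assms(6) K by simp
  then obtain p where p: "(\<integral>\<^sup>+t. ennreal ((cmod (F t - poly p (\<gamma> t)))\<^sup>2) \<partial>\<mu>) < ennreal (\<epsilon> / K)"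
    using \<open>approx F\<close> unfolding approx_def \<gamma>_def by blast
  \<comment> \<open>Since Re (\<gamma> t) = t, the curve meets each root of \<open>Q\<close> at most
    once.\<close>
  have "finite {z. poly Q z = 0}" using Q0 by (rule poly_roots_finite)
  then have "finite (Re ` {z. poly Q z = 0})" by simp
  then have "AE t in lborel. t \<notin> Re ` {z. poly Q z = 0}"
    by (intro AE_not_in finite_imp_null_set_lborel)
  \<comment> \<open>The end points are removed because the bound on \<open>deriv y\<close> is
    available only in the open interval: at \<open>a\<close> and \<open>b\<close> the derivative
    would depend on values of \<open>y\<close> outside it.\<close>
  moreover have "AE t in lborel. t \<notin> {a, b}"
    by (intro AE_not_in finite_imp_null_set_lborel) simp
  ultimately have ae: "AE t in lborel. poly Q (\<gamma> t) \<noteq> 0 \<and> t \<notin> {a, b}"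
  proof eventually_elim
    case (elim t)
    have "Re (\<gamma> t) = t" by (simp add: \<gamma>_def graph_curve_def)
    then show ?case using elim by (force simp: image_iff)
  qed
  have "wL2sq a b y \<phi> (\<lambda>z. f z - poly (Q * p) z)
    \<le> (\<integral>\<^sup>+t. ennreal K * (W t * ennreal ((cmod (F t - poly p (\<gamma> t)))\<^sup>2)) \<partial>lborel)"
    unfolding wL2sq_def using F0eq ae
  proof (intro nn_integral_mono_AE, eventually_elim)
    case (elim t)
    show ?case
    proof (cases "t \<in> {a..b}")
      case True
      have nz: "poly Q (\<gamma> t) \<noteq> 0" and ab: "t \<in> {a<..<b}" using elim True by auto
      have "f (\<gamma> t) - poly (Q * p) (\<gamma> t) = poly Q (\<gamma> t) * (F t - poly p (\<gamma> t))"
        using nz elim True \<gamma>[OF True] by (simp add: F_def algebra_simps)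
      then have "ennreal ((cmod (f (\<gamma> t) - poly (Q * p) (\<gamma> t)))\<^sup>2)
          = ennreal ((cmod (poly Q (\<gamma> t)))\<^sup>2) * ennreal ((cmod (F t - poly p (\<gamma> t)))\<^sup>2)"
        by (simp add: norm_mult power_mult_distrib ennreal_mult)
      then have "ennreal ((cmod (f (\<gamma> t) - poly (Q * p) (\<gamma> t)))\<^sup>2) * w t * ennreal (sqrt (1 + (deriv y t)\<^sup>2))
        \<le> ennreal ((cmod (poly Q (\<gamma> t)))\<^sup>2) * ennreal ((cmod (F t - poly p (\<gamma> t)))\<^sup>2) * w t * ennreal K"
        using Kle[OF ab] by (auto intro!: mult_left_mono ennreal_leI)
      then show ?thesis using True by (simp add: W_def \<gamma> w mult_ac)
    qed simp
  qed
  also have "\<dots> = ennreal K * (\<integral>\<^sup>+t. W t * ennreal ((cmod (F t - poly p (\<gamma> t)))\<^sup>2) \<partial>lborel)"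
    by (rule nn_integral_cmult) measurable
  also have "(\<integral>\<^sup>+t. W t * ennreal ((cmod (F t - poly p (\<gamma> t)))\<^sup>2) \<partial>lborel) = (\<integral>\<^sup>+t. ennreal ((cmod (F t - poly p (\<gamma> t)))\<^sup>2) \<partial>\<mu>)"
    unfolding \<mu>_def by (rule nn_integral_density[symmetric]) measurable
  also have "ennreal K * \<dots> < ennreal K * ennreal (\<epsilon> / K)"
    using p K by (intro ennreal_mult_strict_left_mono) auto
  also have "\<dots> = ennreal \<epsilon>" using K assms(6) by (simp flip: ennreal_mult)
  finally show ?thesis by blast
qed

end
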